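(* Let $\mathcal{C}$ be a category of partitions, let $t\in\mathbb{C}$, and assume that $\mathcal{F}:\underline{\mathrm{Rep}}(\mathcal{C},t)\to\mathcal{D}$ is a (non-zero) monoidal $*$-functor, where $\mathcal{D}$ is a hom-finite $C^*$-category. Then $\mathcal{F}$ induces an equivalence between the semisimplification of $\underline{\mathrm{Rep}}(\mathcal{C},t)$ and the image of $\mathcal{F}$.
   Context: For $k,l\in\mathbb{N}_0$ let $P(k,l)$ be the set of set partitions of $\{1,\dots,k,1',\dots,l'\}$ ($k$ upper points, $l$ lower points). Operations: the tensor product $p\otimes q$ is horizontal concatenation; the involution $p^*\in P(l,k)$ swaps upper and lower points; for $p\in P(k,l)$, $q\in P(l,m)$, stack $p$ above $q$, identifying the lower points of $p$ with the upper points of $q$; $q\cdot p\in P(k,m)$ is the induced partition of the outer points by connected components, and $\ell(q,p)$ is the number of connected components containing only middle points. A category of partitions $\mathcal{C}$ is a collection of subsets $\mathcal{C}(k,l)\subseteq P(k,l)$ containing $\{\{1,2\}\}\in P(2,0)$ and $\{\{1,1'\}\}\in P(1,1)$ and closed under $\otimes$, $*$ and $\cdot$. For $t\in\mathbb{C}$, $\underline{\mathrm{Rep}}_0(\mathcal{C},t)$ is the $\mathbb{C}$-linear monoidal category with objects $[k]$, $k\in\mathbb{N}_0$, $\mathrm{Hom}([k],[l])=\mathbb{C}\,\mathcal{C}(k,l)$, composition extending $qp:=t^{\ell(q,p)}\,q\cdot p$, and tensor product $[k]\otimes[l]=[k+l]$, given on morphisms by $\otimes$ of partitions; $\underline{\mathrm{Rep}}(\mathcal{C},t)$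 is its Karoubi envelope (idempotent completion of the additive completion). It is pivotal with coinciding left and right traces: each $[k]$ is self-dual with evaluation pairing the point $i$ with $2k+1-i$, and the trace of a partition $p\in\mathcal{C}(k,k)$ is $t^c$, $c$ being the number of connected components after identifying $i$ with $i'$ for all $i$. A morphism $f:X\to Y$ is negligible if $\mathrm{tr}(f\circ g)=0$ for all $g:Y\to X$; the negligible morphisms form a tensor ideal $\mathcal{N}$, and the semisimplification of $\underline{\mathrm{Rep}}(\mathcal{C},t)$ is the quotient category $\underline{\mathrm{Rep}}(\mathcal{C},t)/\mathcal{N}$. A $*$-operation on a $\mathbb{C}$-linear monoidal category is a contravariant involutive antilinear monoidal endofunctor $*$ which is the identity on objects; a category with one is a $*$-category. It is positive if $f^*\circ f=0$ implies $f=0$ for every morphism $f$. A hom-finite $C^*$-category is a $\mathbb{C}$-linear Karoubian monoidal category with finite-dimensional morphism spaces admitting (and equipped with) a positive $*$-operation. The $*$-operation on $\underline{\mathrm{Rep}}(\mathcal{C},t)$ is the antilinear extension of the involution $p\mapsto p^*$ of partitions. A $*$-functor is a functor preserving the $*$-operations, i.e. $\mathcal{F}(f^* )=\mathcal{F}(f)^*$; for $\underline{\mathrm{Rep}}(\mathcal{C},t)$ this is required for morphisms between (finite direct sums of) the objects $[k]$. Functors between $\mathbb{C}$-linear categories are $\mathbb{C}$-linear. The image of $\mathcal{F}$ is understood as the category whose objects are the $\mathcal{F}(X)$ (indexed by the objects $X$ of $\underline{\mathrm{Rep}}(\mathcal{C},t)$) and whose morphism spaces are $\mathcal{F}(\mathrm{Hom}(X,Y))$.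 *)

theory Defs
  imports Complex_Main "HOL-Library.Disjoint_Sets"
begin

section \<open>Partitions\<close>

datatype point = Up nat | Lo nat

definition points :: "nat \<Rightarrow> nat \<Rightarrow> point set" where
  "points k l = Up ` {1..k} \<union> Lo ` {1..l}"

type_synonym partition = "point set set"

definition partitions :: "nat \<Rightarrow> nat \<Rightarrow> partition set" where
  "partitions k l = {p. partition_on (points k l) p}"

fun shift_point :: "nat \<Rightarrow> nat \<Rightarrow> point \<Rightarrow> point" where
  "shift_point k l (Up i) = Up (k + i)"
| "shift_point k l (Lo j) = Lo (l + j)"

text \<open>Horizontal concatenation; here \<open>p\<close> has \<open>k\<close> upper and \<open>l\<close> lower points.\<close>

definition part_tensor :: "nat \<Rightarrow> nat \<Rightarrow> partition \<Rightarrow> partition \<Rightarrow> partition" where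
  "part_tensor k l p q = p \<union> (\<lambda>B. shift_point k l ` B) ` q"

fun flip_point :: "point \<Rightarrow> point" where
  "flip_point (Up i) = Lo i"
| "flip_point (Lo j) = Up j"

definition part_star :: "partition \<Rightarrow> partition" where
  "part_star p = (\<lambda>B. flip_point ` B) ` p"

text \<open>The connected components of the hypergraph with vertex set \<open>\<Union>S\<close> and edges \<open>S\<close>.\<close>

definition components :: "'a set set \<Rightarrow> 'a set set" where
  "components S = \<Union>S // (\<Union>B\<in>S. B \<times> B)\<^sup>+"

datatype stack_point = Top nat | Mid nat | Bot nat

fun upper_point :: "point \<Rightarrow> stack_point" where
  "upper_point (Up i) = Top i"
| "upper_point (Lo j) = Mid j"

fun lower_point :: "point \<Rightarrow> stack_point" where
  "lower_point (Up i) = Mid i"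
| "lower_point (Lo j) = Bot j"

fun outer_point :: "point \<Rightarrow> stack_point" where
  "outer_point (Up i) = Top i"
| "outer_point (Lo j) = Bot j"

text \<open>\<open>p\<close> stacked above \<open>q\<close>; the arguments are in the order of the composition \<open>q \<cdot> p\<close>.\<close>

definition stack :: "partition \<Rightarrow> partition \<Rightarrow> stack_point set set" where
  "stack q p = (\<lambda>B. upper_point ` B) ` p \<union> (\<lambda>B. lower_point ` B) ` q"

definition part_comp :: "partition \<Rightarrow> partition \<Rightarrow> partition" where
  "part_comp q p = (\<lambda>c. outer_point -` c) ` components (stack q p) - {{}}"

definition loops :: "partition \<Rightarrow> partition \<Rightarrow> nat" where
  "loops q p = card {c \<in> components (stack q p). c \<subseteq> range Mid}"

definition closure_components :: "nat \<Rightarrow> partition \<Rightarrow> nat" where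
  "closure_components k p = card (components (p \<union> (\<lambda>i. {Up i, Lo i}) ` {1..k}))"

definition id_part :: "nat \<Rightarrow> partition" where
  "id_part k = (\<lambda>i. {Up i, Lo i}) ` {1..k}"

locale category_of_partitions =
  fixes C :: "nat \<Rightarrow> nat \<Rightarrow> partition set"
  assumes subset_partitions: "C k l \<subseteq> partitions k l"
    and pair_in: "{{Up 1, Up 2}} \<in> C 2 0"
    and identity_in: "{{Up 1, Lo 1}} \<in> C 1 1"
    and tensor_closed: "p \<in> C k l \<Longrightarrow> q \<in> C k' l' \<Longrightarrow> part_tensor k l p q \<in> C (k + k') (l + l')"
    and star_closed: "p \<in> C k l \<Longrightarrow> part_star p \<in> C l k"
    and comp_closed: "p \<in> C k l \<Longrightarrow> q \<in> C l m \<Longrightarrow> part_comp q p \<in> C k m"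


section \<open>Linear and monoidal categories, functors, equivalences\<close>

record ('o, 'm) lin_cat =
  ob :: "'o set"
  hom :: "'o \<Rightarrow> 'o \<Rightarrow> 'm set"
  ide :: "'o \<Rightarrow> 'm"
  cmp :: "'m \<Rightarrow> 'm \<Rightarrow> 'm" (infixl "\<cdot>\<index>" 70)
  zer :: "'o \<Rightarrow> 'o \<Rightarrow> 'm"
  add :: "'m \<Rightarrow> 'm \<Rightarrow> 'm" (infixl "\<oplus>\<index>" 65)
  scl :: "complex \<Rightarrow> 'm \<Rightarrow> 'm" (infixr "\<odot>\<index>" 75)

locale linear_category =
  fixes A :: "('o, 'm, 'z) lin_cat_scheme" (structure)
  assumes hom_ob: "f \<in> hom A X Y \<Longrightarrow> X \<in> ob A \<and> Y \<in> ob A"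
    and hom_disjoint: "f \<in> hom A X Y \<Longrightarrow> f \<in> hom A X' Y' \<Longrightarrow> X = X' \<and> Y = Y'"
    and ide_hom: "X \<in> ob A \<Longrightarrow> ide A X \<in> hom A X X"
    and cmp_hom: "f \<in> hom A X Y \<Longrightarrow> g \<in> hom A Y Z \<Longrightarrow> g \<cdot> f \<in> hom A X Z"
    and cmp_assoc: "f \<in> hom A W X \<Longrightarrow> g \<in> hom A X Y \<Longrightarrow> h \<in> hom A Y Z \<Longrightarrow> (h \<cdot> g) \<cdot> f = h \<cdot> (g \<cdot> f)"
    and ide_left: "f \<in> hom A X Y \<Longrightarrow> ide A Y \<cdot> f = f"
    and ide_right: "f \<in> hom A X Y \<Longrightarrow> f \<cdot> ide A X = f"
    and zer_hom: "X \<in> ob A \<Longrightarrow> Y \<in> ob A \<Longrightarrow> zer A X Y \<in> hom A X Y"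
    and add_hom: "f \<in> hom A X Y \<Longrightarrow> g \<in> hom A X Y \<Longrightarrow> f \<oplus> g \<in> hom A X Y"
    and scl_hom: "f \<in> hom A X Y \<Longrightarrow> a \<odot> f \<in> hom A X Y"
    and add_assoc: "f \<in> hom A X Y \<Longrightarrow> g \<in> hom A X Y \<Longrightarrow> h \<in> hom A X Y \<Longrightarrow> (f \<oplus> g) \<oplus> h = f \<oplus> (g \<oplus> h)"
    and add_commute: "f \<in> hom A X Y \<Longrightarrow> g \<in> hom A X Y \<Longrightarrow> f \<oplus> g = g \<oplus> f"
    and add_zer: "f \<in> hom A X Y \<Longrightarrow> f \<oplus> zer A X Y = f"
    and add_inverse: "f \<in> hom A X Y \<Longrightarrow> \<exists>g\<in>hom A X Y. f \<oplus> g = zer A X Y"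
    and scl_one: "f \<in> hom A X Y \<Longrightarrow> 1 \<odot> f = f"
    and scl_scl: "f \<in> hom A X Y \<Longrightarrow> a \<odot> (b \<odot> f) = (a * b) \<odot> f"
    and scl_add_left: "f \<in> hom A X Y \<Longrightarrow> (a + b) \<odot> f = a \<odot> f \<oplus> b \<odot> f"
    and scl_add_right: "f \<in> hom A X Y \<Longrightarrow> g \<in> hom A X Y \<Longrightarrow> a \<odot> (f \<oplus> g) = a \<odot> f \<oplus> a \<odot> g"
    and cmp_add_left: "f \<in> hom A X Y \<Longrightarrow> g \<in> hom A Y Z \<Longrightarrow> h \<in> hom A Y Z \<Longrightarrow> (g \<oplus> h) \<cdot> f = g \<cdot> f \<oplus> h \<cdot> f"
    and cmp_add_right: "f \<in> hom A X Y \<Longrightarrow> g \<in> hom A X Y \<Longrightarrow> h \<in> hom A Y Z \<Longrightarrow> h \<cdot> (f \<oplus> g) = h \<cdot> f \<oplus> h \<cdot> g"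
    and cmp_scl_left: "f \<in> hom A X Y \<Longrightarrow> g \<in> hom A Y Z \<Longrightarrow> (a \<odot> g) \<cdot> f = a \<odot> (g \<cdot> f)"
    and cmp_scl_right: "f \<in> hom A X Y \<Longrightarrow> g \<in> hom A Y Z \<Longrightarrow> g \<cdot> (a \<odot> f) = a \<odot> (g \<cdot> f)"

definition inverse_morphisms ::
    "('o, 'm, 'z) lin_cat_scheme \<Rightarrow> 'o \<Rightarrow> 'o \<Rightarrow> 'm \<Rightarrow> 'm \<Rightarrow> bool" where
  "inverse_morphisms A X Y f g \<longleftrightarrow> f \<in> hom A X Y \<and> g \<in> hom A Y X \<and>
     cmp A g f = ide A X \<and> cmp A f g = ide A Y"

definition isomorphism :: "('o, 'm, 'z) lin_cat_scheme \<Rightarrow> 'o \<Rightarrow> 'o \<Rightarrow> 'm \<Rightarrow> bool" where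
  "isomorphism A X Y f \<longleftrightarrow> (\<exists>g. inverse_morphisms A X Y f g)"

locale linear_functor =
  fixes A :: "('o, 'm, 'z) lin_cat_scheme"
    and B :: "('p, 'n, 'y) lin_cat_scheme"
    and Fo :: "'o \<Rightarrow> 'p" and Fm :: "'m \<Rightarrow> 'n"
  assumes fun_ob: "X \<in> ob A \<Longrightarrow> Fo X \<in> ob B"
    and fun_hom: "f \<in> hom A X Y \<Longrightarrow> Fm f \<in> hom B (Fo X) (Fo Y)"
    and fun_ide: "X \<in> ob A \<Longrightarrow> Fm (ide A X) = ide B (Fo X)"
    and fun_cmp: "f \<in> hom A X Y \<Longrightarrow> g \<in> hom A Y Z \<Longrightarrow> Fm (g \<cdot>\<^bsub>A\<^esub> f) = Fm g \<cdot>\<^bsub>B\<^esub> Fm f"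
    and fun_add: "f \<in> hom A X Y \<Longrightarrow> g \<in> hom A X Y \<Longrightarrow> Fm (f \<oplus>\<^bsub>A\<^esub> g) = Fm f \<oplus>\<^bsub>B\<^esub> Fm g"
    and fun_scl: "f \<in> hom A X Y \<Longrightarrow> Fm (a \<odot>\<^bsub>A\<^esub> f) = a \<odot>\<^bsub>B\<^esub> Fm f"

definition natural_isomorphism ::
    "('o, 'm, 'z) lin_cat_scheme \<Rightarrow> ('p, 'n, 'y) lin_cat_scheme \<Rightarrow>
     ('o \<Rightarrow> 'p) \<Rightarrow> ('m \<Rightarrow> 'n) \<Rightarrow> ('o \<Rightarrow> 'p) \<Rightarrow> ('m \<Rightarrow> 'n) \<Rightarrow> ('o \<Rightarrow> 'n) \<Rightarrow> bool" where
  "natural_isomorphism A B Fo Fm Go Gm \<eta> \<longleftrightarrow>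
     (\<forall>X\<in>ob A. isomorphism B (Fo X) (Go X) (\<eta> X)) \<and>
     (\<forall>X\<in>ob A. \<forall>Y\<in>ob A. \<forall>f\<in>hom A X Y. Gm f \<cdot>\<^bsub>B\<^esub> \<eta> X = \<eta> Y \<cdot>\<^bsub>B\<^esub> Fm f)"

definition linear_equivalence ::
    "('o, 'm, 'z) lin_cat_scheme \<Rightarrow> ('p, 'n, 'y) lin_cat_scheme \<Rightarrow>
     ('o \<Rightarrow> 'p) \<Rightarrow> ('m \<Rightarrow> 'n) \<Rightarrow> bool" where
  "linear_equivalence A B Fo Fm \<longleftrightarrow>
     linear_category A \<and> linear_category B \<and> linear_functor A B Fo Fm \<and>
     (\<exists>Go Gm \<eta> \<theta>. linear_functor B A Go Gm \<and>
        natural_isomorphism A A (\<lambda>X. X) (\<lambda>f. f) (Go \<circ> Fo) (Gm \<circ> Fm) \<eta> \<and>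
        natural_isomorphism B B (Fo \<circ> Go) (Fm \<circ> Gm) (\<lambda>X. X) (\<lambda>f. f) \<theta>)"

record ('o, 'm) mon_cat = "('o, 'm) lin_cat" +
  tob :: "'o \<Rightarrow> 'o \<Rightarrow> 'o" (infixl "\<otimes>\<index>" 78)
  tmor :: "'m \<Rightarrow> 'm \<Rightarrow> 'm" (infixl "\<boxtimes>\<index>" 78)
  unt :: "'o" ("\<I>\<index>")
  assoc :: "'o \<Rightarrow> 'o \<Rightarrow> 'o \<Rightarrow> 'm"
  lunit :: "'o \<Rightarrow> 'm"
  runit :: "'o \<Rightarrow> 'm"

locale monoidal_linear_category = linear_category A
  for A :: "('o, 'm, 'z) mon_cat_scheme" (structure) +
  assumes unt_ob: "\<I> \<in> ob A"
    and tob_ob: "X \<in> ob A \<Longrightarrow> Y \<in> ob A \<Longrightarrow> X \<otimes> Y \<in> ob A"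
    and tmor_hom: "f \<in> hom A X Y \<Longrightarrow> g \<in> hom A X' Y' \<Longrightarrow> f \<boxtimes> g \<in> hom A (X \<otimes> X') (Y \<otimes> Y')"
    and tmor_ide: "X \<in> ob A \<Longrightarrow> Y \<in> ob A \<Longrightarrow> ide A X \<boxtimes> ide A Y = ide A (X \<otimes> Y)"
    and tmor_cmp: "f \<in> hom A X Y \<Longrightarrow> g \<in> hom A Y Z \<Longrightarrow> f' \<in> hom A X' Y' \<Longrightarrow> g' \<in> hom A Y' Z' \<Longrightarrow>
        (g \<cdot> f) \<boxtimes> (g' \<cdot> f') = (g \<boxtimes> g') \<cdot> (f \<boxtimes> f')"
    and tmor_add_left: "f \<in> hom A X Y \<Longrightarrow> g \<in> hom A X Y \<Longrightarrow> h \<in> hom A X' Y' \<Longrightarrow>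
        (f \<oplus> g) \<boxtimes> h = f \<boxtimes> h \<oplus> g \<boxtimes> h"
    and tmor_add_right: "f \<in> hom A X Y \<Longrightarrow> g \<in> hom A X' Y' \<Longrightarrow> h \<in> hom A X' Y' \<Longrightarrow>
        f \<boxtimes> (g \<oplus> h) = f \<boxtimes> g \<oplus> f \<boxtimes> h"
    and tmor_scl_left: "f \<in> hom A X Y \<Longrightarrow> g \<in> hom A X' Y' \<Longrightarrow> (a \<odot> f) \<boxtimes> g = a \<odot> (f \<boxtimes> g)"
    and tmor_scl_right: "f \<in> hom A X Y \<Longrightarrow> g \<in> hom A X' Y' \<Longrightarrow> f \<boxtimes> (a \<odot> g) = a \<odot> (f \<boxtimes> g)"
    and assoc_iso: "X \<in> ob A \<Longrightarrow> Y \<in> ob A \<Longrightarrow> Z \<in> ob A \<Longrightarrow>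
        isomorphism A ((X \<otimes> Y) \<otimes> Z) (X \<otimes> (Y \<otimes> Z)) (assoc A X Y Z)"
    and lunit_iso: "X \<in> ob A \<Longrightarrow> isomorphism A (\<I> \<otimes> X) X (lunit A X)"
    and runit_iso: "X \<in> ob A \<Longrightarrow> isomorphism A (X \<otimes> \<I>) X (runit A X)"
    and assoc_natural: "f \<in> hom A X X' \<Longrightarrow> g \<in> hom A Y Y' \<Longrightarrow> h \<in> hom A Z Z' \<Longrightarrow>
        assoc A X' Y' Z' \<cdot> ((f \<boxtimes> g) \<boxtimes> h) = (f \<boxtimes> (g \<boxtimes> h)) \<cdot> assoc A X Y Z"
    and lunit_natural: "f \<in> hom A X Y \<Longrightarrow> lunit A Y \<cdot> (ide A \<I> \<boxtimes> f) = f \<cdot> lunit A X"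
    and runit_natural: "f \<in> hom A X Y \<Longrightarrow> runit A Y \<cdot> (f \<boxtimes> ide A \<I>) = f \<cdot> runit A X"
    and pentagon: "W \<in> ob A \<Longrightarrow> X \<in> ob A \<Longrightarrow> Y \<in> ob A \<Longrightarrow> Z \<in> ob A \<Longrightarrow>
        (ide A W \<boxtimes> assoc A X Y Z) \<cdot> assoc A W (X \<otimes> Y) Z \<cdot> (assoc A W X Y \<boxtimes> ide A Z)
        = assoc A W X (Y \<otimes> Z) \<cdot> assoc A (W \<otimes> X) Y Z"
    and triangle: "X \<in> ob A \<Longrightarrow> Y \<in> ob A \<Longrightarrow>
        (ide A X \<boxtimes> lunit A Y) \<cdot> assoc A X \<I> Y = runit A X \<boxtimes> ide A Y"

text \<open>Monoidal functors are strong: \<open>\<mu>\<close> and \<open>\<epsilon>\<close> are the (invertible) structure morphisms.\<close>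

locale monoidal_functor = linear_functor A B Fo Fm
  for A :: "('o, 'm, 'z) mon_cat_scheme"
    and B :: "('p, 'n, 'y) mon_cat_scheme"
    and Fo :: "'o \<Rightarrow> 'p" and Fm :: "'m \<Rightarrow> 'n" +
  fixes \<mu> :: "'o \<Rightarrow> 'o \<Rightarrow> 'n" and \<epsilon> :: "'n"
  assumes \<mu>_iso: "X \<in> ob A \<Longrightarrow> Y \<in> ob A \<Longrightarrow>
        isomorphism B (Fo X \<otimes>\<^bsub>B\<^esub> Fo Y) (Fo (X \<otimes>\<^bsub>A\<^esub> Y)) (\<mu> X Y)"
    and \<epsilon>_iso: "isomorphism B \<I>\<^bsub>B\<^esub> (Fo \<I>\<^bsub>A\<^esub>) \<epsilon>"
    and \<mu>_natural: "f \<in> hom A X Y \<Longrightarrow> g \<in> hom A X' Y' \<Longrightarrow>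
        \<mu> Y Y' \<cdot>\<^bsub>B\<^esub> (Fm f \<boxtimes>\<^bsub>B\<^esub> Fm g) = Fm (f \<boxtimes>\<^bsub>A\<^esub> g) \<cdot>\<^bsub>B\<^esub> \<mu> X X'"
    and \<mu>_assoc: "X \<in> ob A \<Longrightarrow> Y \<in> ob A \<Longrightarrow> Z \<in> ob A \<Longrightarrow>
        Fm (assoc A X Y Z) \<cdot>\<^bsub>B\<^esub> \<mu> (X \<otimes>\<^bsub>A\<^esub> Y) Z \<cdot>\<^bsub>B\<^esub> (\<mu> X Y \<boxtimes>\<^bsub>B\<^esub> ide B (Fo Z))
        = \<mu> X (Y \<otimes>\<^bsub>A\<^esub> Z) \<cdot>\<^bsub>B\<^esub> (ide B (Fo X) \<boxtimes>\<^bsub>B\<^esub> \<mu> Y Z) \<cdot>\<^bsub>B\<^esub> assoc B (Fo X) (Fo Y) (Fo Z)"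
    and \<mu>_lunit: "X \<in> ob A \<Longrightarrow>
        Fm (lunit A X) \<cdot>\<^bsub>B\<^esub> \<mu> \<I>\<^bsub>A\<^esub> X \<cdot>\<^bsub>B\<^esub> (\<epsilon> \<boxtimes>\<^bsub>B\<^esub> ide B (Fo X)) = lunit B (Fo X)"
    and \<mu>_runit: "X \<in> ob A \<Longrightarrow>
        Fm (runit A X) \<cdot>\<^bsub>B\<^esub> \<mu> X \<I>\<^bsub>A\<^esub> \<cdot>\<^bsub>B\<^esub> (ide B (Fo X) \<boxtimes>\<^bsub>B\<^esub> \<epsilon>) = runit B (Fo X)"


section \<open>Hom-finite C*-categories\<close>

text \<open>
  A \<open>*\<close>-operation is a contravariant antilinear monoidal endofunctor that is the identity on
  objects and whose monoidal structure morphisms are identities; compatibility with the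
  coherence isomorphisms then says that these are unitary.
\<close>

locale star_operation = monoidal_linear_category A
  for A :: "('o, 'm, 'z) mon_cat_scheme" (structure) +
  fixes star :: "'m \<Rightarrow> 'm"
  assumes star_hom: "f \<in> hom A X Y \<Longrightarrow> star f \<in> hom A Y X"
    and star_star: "f \<in> hom A X Y \<Longrightarrow> star (star f) = f"
    and star_ide: "X \<in> ob A \<Longrightarrow> star (ide A X) = ide A X"
    and star_cmp: "f \<in> hom A X Y \<Longrightarrow> g \<in> hom A Y Z \<Longrightarrow> star (g \<cdot> f) = star f \<cdot> star g"
    and star_add: "f \<in> hom A X Y \<Longrightarrow> g \<in> hom A X Y \<Longrightarrow> star (f \<oplus> g) = star f \<oplus> star g"
    and star_scl: "f \<in> hom A X Y \<Longrightarrow> star (a \<odot> f) = cnj a \<odot> star f"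
    and star_tmor: "f \<in> hom A X Y \<Longrightarrow> g \<in> hom A X' Y' \<Longrightarrow> star (f \<boxtimes> g) = star f \<boxtimes> star g"
    and star_assoc: "X \<in> ob A \<Longrightarrow> Y \<in> ob A \<Longrightarrow> Z \<in> ob A \<Longrightarrow>
        inverse_morphisms A ((X \<otimes> Y) \<otimes> Z) (X \<otimes> (Y \<otimes> Z)) (assoc A X Y Z) (star (assoc A X Y Z))"
    and star_lunit: "X \<in> ob A \<Longrightarrow> inverse_morphisms A (\<I> \<otimes> X) X (lunit A X) (star (lunit A X))"
    and star_runit: "X \<in> ob A \<Longrightarrow> inverse_morphisms A (X \<otimes> \<I>) X (runit A X) (star (runit A X))"

text \<open>Karoubian means additive with split idempotents.\<close>

definition karoubian :: "('o, 'm, 'z) lin_cat_scheme \<Rightarrow> bool" where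
  "karoubian A \<longleftrightarrow>
     (\<exists>Z\<in>ob A. ide A Z = zer A Z Z) \<and>
     (\<forall>X\<in>ob A. \<forall>Y\<in>ob A. \<exists>S\<in>ob A. \<exists>i\<in>hom A X S. \<exists>j\<in>hom A Y S. \<exists>p\<in>hom A S X. \<exists>q\<in>hom A S Y.
        p \<cdot>\<^bsub>A\<^esub> i = ide A X \<and> q \<cdot>\<^bsub>A\<^esub> j = ide A Y \<and>
        p \<cdot>\<^bsub>A\<^esub> j = zer A Y X \<and> q \<cdot>\<^bsub>A\<^esub> i = zer A X Y \<and>
        i \<cdot>\<^bsub>A\<^esub> p \<oplus>\<^bsub>A\<^esub> j \<cdot>\<^bsub>A\<^esub> q = ide A S) \<and>
     (\<forall>X\<in>ob A. \<forall>e\<in>hom A X X. e \<cdot>\<^bsub>A\<^esub> e = e \<longrightarrow>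
        (\<exists>Y\<in>ob A. \<exists>r\<in>hom A X Y. \<exists>s\<in>hom A Y X. r \<cdot>\<^bsub>A\<^esub> s = ide A Y \<and> s \<cdot>\<^bsub>A\<^esub> r = e))"

definition hom_finite :: "('o, 'm, 'z) lin_cat_scheme \<Rightarrow> bool" where
  "hom_finite A \<longleftrightarrow> (\<forall>X\<in>ob A. \<forall>Y\<in>ob A. \<exists>bs. set bs \<subseteq> hom A X Y \<and>
     (\<forall>f\<in>hom A X Y. \<exists>cs. length cs = length bs \<and>
        f = foldr (add A) (map2 (scl A) cs bs) (zer A X Y)))"

locale hom_finite_cstar_category = star_operation A star
  for A :: "('o, 'm, 'z) mon_cat_scheme" (structure) and star :: "'m \<Rightarrow> 'm" +
  assumes karoubian: "karoubian A"
    and hom_finite: "hom_finite A"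
    and positive: "f \<in> hom A X Y \<Longrightarrow> star f \<cdot> f = zer A X X \<Longrightarrow> f = zer A X Y"


section \<open>The category Rep(C, t)\<close>

text \<open>
  A morphism from \<open>[k]\<close> to \<open>[l]\<close>, i.e. a formal linear combination of partitions in \<open>C k l\<close>,
  is represented by its coefficient function.
\<close>

type_synonym lincomb = "partition \<Rightarrow> complex"

definition lin_hom :: "(nat \<Rightarrow> nat \<Rightarrow> partition set) \<Rightarrow> nat \<Rightarrow> nat \<Rightarrow> lincomb set" where
  "lin_hom C k l = {\<phi>. \<forall>p. p \<notin> C k l \<longrightarrow> \<phi> p = 0}"

definition lin_id :: "nat \<Rightarrow> lincomb" where
  "lin_id k = (\<lambda>p. of_bool (p = id_part k))"

definition lin_comp :: "complex \<Rightarrow> nat \<Rightarrow> nat \<Rightarrow> nat \<Rightarrow> lincomb \<Rightarrow> lincomb \<Rightarrow> lincomb" where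
  "lin_comp t k l m \<psi> \<phi> = (\<lambda>r. \<Sum>p\<in>partitions k l. \<Sum>q\<in>partitions l m.
     \<psi> q * \<phi> p * t ^ loops q p * of_bool (r = part_comp q p))"

definition lin_tensor :: "nat \<Rightarrow> nat \<Rightarrow> nat \<Rightarrow> nat \<Rightarrow> lincomb \<Rightarrow> lincomb \<Rightarrow> lincomb" where
  "lin_tensor k l k' l' \<phi> \<psi> = (\<lambda>r. \<Sum>p\<in>partitions k l. \<Sum>q\<in>partitions k' l'.
     \<phi> p * \<psi> q * of_bool (r = part_tensor k l p q))"

text \<open>Antilinear extension: the coefficient at \<open>r = p\<^sup>*\<close> is the conjugate of that at \<open>p = r\<^sup>*\<close>.\<close>

definition lin_star :: "lincomb \<Rightarrow> lincomb" where
  "lin_star \<phi> = (\<lambda>r. cnj (\<phi> (part_star r)))"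

definition lin_trace :: "complex \<Rightarrow> nat \<Rightarrow> lincomb \<Rightarrow> complex" where
  "lin_trace t k \<phi> = (\<Sum>p\<in>partitions k k. \<phi> p * t ^ closure_components k p)"

text \<open>
  Additive completion: the list \<open>ks\<close> stands for the direct sum of the objects \<open>[ks ! i]\<close>, and
  \<open>M j i\<close> is the component of the morphism \<open>M\<close> from the \<open>i\<close>-th summand of the source to the
  \<open>j\<close>-th summand of the target (and \<open>0\<close> if there are no such summands).
\<close>

type_synonym lmatrix = "nat \<Rightarrow> nat \<Rightarrow> lincomb"

definition mk_mat :: "nat list \<Rightarrow> nat list \<Rightarrow> lmatrix \<Rightarrow> lmatrix" where
  "mk_mat ks ls M = (\<lambda>j i. if j < length ls \<and> i < length ks then M j i else (\<lambda>p. 0))"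

definition mat_hom :: "(nat \<Rightarrow> nat \<Rightarrow> partition set) \<Rightarrow> nat list \<Rightarrow> nat list \<Rightarrow> lmatrix set" where
  "mat_hom C ks ls = {M. M = mk_mat ks ls M \<and>
     (\<forall>i<length ks. \<forall>j<length ls. M j i \<in> lin_hom C (ks ! i) (ls ! j))}"

definition mat_id :: "nat list \<Rightarrow> lmatrix" where
  "mat_id ks = mk_mat ks ks (\<lambda>j i. if j = i then lin_id (ks ! i) else (\<lambda>p. 0))"

definition mat_comp ::
    "complex \<Rightarrow> nat list \<Rightarrow> nat list \<Rightarrow> nat list \<Rightarrow> lmatrix \<Rightarrow> lmatrix \<Rightarrow> lmatrix" where
  "mat_comp t ks ls ms N M = mk_mat ks ms (\<lambda>n i p.
     \<Sum>j<length ls. lin_comp t (ks ! i) (ls ! j) (ms ! n) (N n j) (M j i) p)"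

definition list_tensor :: "nat list \<Rightarrow> nat list \<Rightarrow> nat list" where
  "list_tensor ks ls = map (\<lambda>(k, l). k + l) (List.product ks ls)"

text \<open>Kronecker product, in the lexicographic ordering of the summands used by \<open>list_tensor\<close>.\<close>

definition mat_tensor ::
    "nat list \<Rightarrow> nat list \<Rightarrow> nat list \<Rightarrow> nat list \<Rightarrow> lmatrix \<Rightarrow> lmatrix \<Rightarrow> lmatrix" where
  "mat_tensor ks ls ks' ls' M N = mk_mat (list_tensor ks ks') (list_tensor ls ls') (\<lambda>j i.
     (let a = i div length ks'; a' = i mod length ks'; b = j div length ls'; b' = j mod length ls'
      in lin_tensor (ks ! a) (ls ! b) (ks' ! a') (ls' ! b') (M b a) (N b' a')))"

definition mat_star :: "lmatrix \<Rightarrow> lmatrix" where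
  "mat_star M = (\<lambda>j i. lin_star (M i j))"

definition mat_trace :: "complex \<Rightarrow> nat list \<Rightarrow> lmatrix \<Rightarrow> complex" where
  "mat_trace t ks M = (\<Sum>i<length ks. lin_trace t (ks ! i) (M i i))"

text \<open>
  Idempotent completion: objects are pairs of an object of the additive completion and an
  idempotent \<open>e\<close> on it, morphisms \<open>(ks, e) \<rightarrow> (ls, d)\<close> are the matrices \<open>M\<close> with
  \<open>M e = M = d M\<close>, tagged with source and target.
  The tensor product of objects is strictly associative and unital, so the coherence
  isomorphisms are identities.
\<close>

type_synonym rep_ob = "nat list \<times> lmatrix"
type_synonym rep_mor = "rep_ob \<times> rep_ob \<times> lmatrix"

definition Rep :: "(nat \<Rightarrow> nat \<Rightarrow> partition set) \<Rightarrow> complex \<Rightarrow> (rep_ob, rep_mor) mon_cat" where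
  "Rep C t =
    (let tens = (\<lambda>(ks, e) (ls, d). (list_tensor ks ls, mat_tensor ks ks ls ls e d));
         one = ([0], mat_id [0])
     in
     \<lparr> ob = {(ks, e). e \<in> mat_hom C ks ks \<and> mat_comp t ks ks ks e e = e},
       hom = (\<lambda>(ks, e) (ls, d). {((ks, e), (ls, d), M) | M.
          e \<in> mat_hom C ks ks \<and> mat_comp t ks ks ks e e = e \<and>
          d \<in> mat_hom C ls ls \<and> mat_comp t ls ls ls d d = d \<and>
          M \<in> mat_hom C ks ls \<and> mat_comp t ks ks ls M e = M \<and> mat_comp t ks ls ls d M = M}),
       ide = (\<lambda>(ks, e). ((ks, e), (ks, e), e)),
       cmp = (\<lambda>(Y', Z, N) (X, Y, M). (X, Z, mat_comp t (fst X) (fst Y) (fst Z) N M)),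
       zer = (\<lambda>X Y. (X, Y, \<lambda>j i p. 0)),
       add = (\<lambda>(X', Y', N) (X, Y, M). (X, Y, \<lambda>j i p. N j i p + M j i p)),
       scl = (\<lambda>a (X, Y, M). (X, Y, \<lambda>j i p. a * M j i p)),
       tob = tens,
       tmor = (\<lambda>(X, Y, M) (X', Y', N).
          (tens X X', tens Y Y', mat_tensor (fst X) (fst Y) (fst X') (fst Y') M N)),
       unt = one,
       assoc = (\<lambda>X Y Z. (tens (tens X Y) Z, tens X (tens Y Z), snd (tens (tens X Y) Z))),
       lunit = (\<lambda>X. (tens one X, X, snd X)),
       runit = (\<lambda>X. (tens X one, X, snd X)) \<rparr>)"

text \<open>The direct sum of the \<open>[ks ! i]\<close>, as an object of \<open>Rep C t\<close>.\<close>

definition sum_ob :: "nat list \<Rightarrow> rep_ob" where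
  "sum_ob ks = (ks, mat_id ks)"

text \<open>
  On objects \<open>(ks, e)\<close> with non-self-adjoint \<open>e\<close>, the \<open>*\<close>-operation of \<open>Rep C t\<close> is not the
  identity; preservation is therefore only asked for on finite direct sums of the \<open>[k]\<close>.
\<close>

definition rep_star_functor ::
    "(nat \<Rightarrow> nat \<Rightarrow> partition set) \<Rightarrow> ('n \<Rightarrow> 'n) \<Rightarrow> (rep_mor \<Rightarrow> 'n) \<Rightarrow> bool" where
  "rep_star_functor C star Fm \<longleftrightarrow> (\<forall>ks ls. \<forall>M\<in>mat_hom C ks ls.
     Fm (sum_ob ls, sum_ob ks, mat_star M) = star (Fm (sum_ob ks, sum_ob ls, M)))"


section \<open>Semisimplification and image\<close>

definition rep_trace :: "complex \<Rightarrow> rep_mor \<Rightarrow> complex" where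
  "rep_trace t = (\<lambda>(X, Y, M). mat_trace t (fst X) M)"

definition negligible ::
    "(nat \<Rightarrow> nat \<Rightarrow> partition set) \<Rightarrow> complex \<Rightarrow> rep_ob \<Rightarrow> rep_ob \<Rightarrow> rep_mor set" where
  "negligible C t X Y =
     {f \<in> hom (Rep C t) X Y. \<forall>g\<in>hom (Rep C t) Y X. rep_trace t (f \<cdot>\<^bsub>Rep C t\<^esub> g) = 0}"

text \<open>
  Quotient of a category by an ideal \<open>N\<close>. Morphisms are cosets tagged with source and target.
  For an ideal, the unions below are unions of equal cosets.
\<close>

definition coset :: "('o, 'm, 'z) lin_cat_scheme \<Rightarrow> ('o \<Rightarrow> 'o \<Rightarrow> 'm set) \<Rightarrow> 'o \<Rightarrow> 'o \<Rightarrow> 'm \<Rightarrow> 'm set" where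
  "coset A N X Y f = (\<lambda>n. f \<oplus>\<^bsub>A\<^esub> n) ` N X Y"

definition quotient_cat ::
    "('o, 'm, 'z) lin_cat_scheme \<Rightarrow> ('o \<Rightarrow> 'o \<Rightarrow> 'm set) \<Rightarrow> ('o, 'o \<times> 'o \<times> 'm set) lin_cat" where
  "quotient_cat A N =
    \<lparr> ob = ob A,
      hom = (\<lambda>X Y. {(X, Y, coset A N X Y f) | f. f \<in> hom A X Y}),
      ide = (\<lambda>X. (X, X, coset A N X X (ide A X))),
      cmp = (\<lambda>(Y', Z, d) (X, Y, c). (X, Z, \<Union>g\<in>d. \<Union>f\<in>c. coset A N X Z (g \<cdot>\<^bsub>A\<^esub> f))),
      zer = (\<lambda>X Y. (X, Y, coset A N X Y (zer A X Y))),
      add = (\<lambda>(X', Y', d) (X, Y, c). (X, Y, \<Union>g\<in>d. \<Union>f\<in>c. coset A N X Y (g \<oplus>\<^bsub>A\<^esub> f))),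
      scl = (\<lambda>a (X, Y, c). (X, Y, \<Union>f\<in>c. coset A N X Y (a \<odot>\<^bsub>A\<^esub> f))) \<rparr>"

definition semisimplification ::
    "(nat \<Rightarrow> nat \<Rightarrow> partition set) \<Rightarrow> complex \<Rightarrow> (rep_ob, rep_ob \<times> rep_ob \<times> rep_mor set) lin_cat" where
  "semisimplification C t = quotient_cat (Rep C t) (negligible C t)"

text \<open>
  The object \<open>X\<close> of the image stands for \<open>Fo X\<close>; a morphism \<open>Fm f\<close> with \<open>f : X \<rightarrow> Y\<close> is tagged
  with \<open>X\<close> and \<open>Y\<close>, since \<open>Fo\<close> need not be injective.
\<close>

definition image_cat ::
    "('o, 'm, 'z) lin_cat_scheme \<Rightarrow> ('p, 'n, 'y) lin_cat_scheme \<Rightarrow> ('o \<Rightarrow> 'p) \<Rightarrow> ('m \<Rightarrow> 'n) \<Rightarrow>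
     ('o, 'o \<times> 'o \<times> 'n) lin_cat" where
  "image_cat A B Fo Fm =
    \<lparr> ob = ob A,
      hom = (\<lambda>X Y. {(X, Y, Fm f) | f. f \<in> hom A X Y}),
      ide = (\<lambda>X. (X, X, ide B (Fo X))),
      cmp = (\<lambda>(Y', Z, g) (X, Y, f). (X, Z, g \<cdot>\<^bsub>B\<^esub> f)),
      zer = (\<lambda>X Y. (X, Y, zer B (Fo X) (Fo Y))),
      add = (\<lambda>(X', Y', g) (X, Y, f). (X, Y, g \<oplus>\<^bsub>B\<^esub> f)),
      scl = (\<lambda>a (X, Y, f). (X, Y, a \<odot>\<^bsub>B\<^esub> f)) \<rparr>"

end

theory Submission
  imports Defs
begin

text \<open>
  The kernel of \<open>F\<close> is the ideal of negligible morphisms. Decomposing into matrix entries and using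
  cyclicity of the trace, it suffices to treat \<open>\<phi> : [k] \<rightarrow> [l]\<close>. Bending the upper strands down one at
  a time is an invertible operation that is a composition with tensor products, so it preserves both
  \<open>F \<phi> = 0\<close> and the trace form, and reduces everything to \<open>k = 0\<close>. There \<open>\<psi> \<circ> \<phi>\<close> is the scalar
  \<open>tr (\<phi> \<circ> \<psi>)\<close> for every \<open>\<psi> : [l] \<rightarrow> [0]\<close>. Since \<open>F\<close> is non-zero, it does not kill the identity of
  the unit object, so \<open>F \<phi> = 0\<close> makes all these scalars vanish. Conversely, if \<open>\<phi>\<^sup>* \<circ> \<phi> = 0\<close> then
  \<open>F \<phi> = 0\<close> by positivity.

  The combinatorial input is that composing partitions and counting loops can be carried out in any
  order: this gives associativity of the composition as well as
  \<open>tr (q \<circ> p) = t\<^sup>c\<close>, where \<open>c\<close> is the number of components of \<open>p \<union> q\<^sup>*\<close>.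
\<close>

section \<open>Connected components of hypergraphs\<close>

text \<open>\<open>D\<close> carries no duality and no trace, and the endomorphisms of its unit need
  not be scalars, so a trace cannot be pushed through the functor. Bending avoids this: with source
  \<open>[0]\<close> the trace becomes the coefficient of a morphism in the one-dimensional space
  Hom([0],[0]), and a linear functor that keeps the identity of \<open>[0]\<close> alive detects
  that coefficient. Positivity needs an operation \<open>star\<close> that is respected by the
  functor, which is granted only on direct sums of the \<open>[k]\<close>; on \<open>(ks, e)\<close>
  with \<open>e\<close> not self-adjoint there is nothing to apply it to. This is why the
  idempotents and the direct sums are stripped off before any analysis. The exponent in the trace of
  a composite depends only on how the blocks of two partitions of the same points overlap. Such a
  count is symmetric and blind to relabelling, which yields cyclicity of the trace and invariance
  under bending at once. Once the negligible morphisms are known to be a kernel, a coset is a fibre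
  of the functor; so the comparison is the identity on objects and bijective on morphisms.\<close>

definition conn :: "'a set set \<Rightarrow> ('a \<times> 'a) set" where
  "conn S = (\<Union>B\<in>S. B \<times> B)\<^sup>+"

lemma components_conn: "components S = \<Union>S // conn S"
  by (simp add: components_def conn_def)

lemma conn_edge: "B \<in> S \<Longrightarrow> x \<in> B \<Longrightarrow> y \<in> B \<Longrightarrow> (x, y) \<in> conn S"
  unfolding conn_def by (rule r_into_trancl) blast

lemma conn_trans: "(x, y) \<in> conn S \<Longrightarrow> (y, z) \<in> conn S \<Longrightarrow> (x, z) \<in> conn S"
  unfolding conn_def by (rule trancl_trans)

lemma trans_conn: "trans (conn S)"
  by (simp add: conn_def)

lemma conn_sym: "(x, y) \<in> conn S \<Longrightarrow> (y, x) \<in> conn S"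
proof -
  have "sym (\<Union>B\<in>S. B \<times> B)" by (auto simp: sym_def)
  then show "(x, y) \<in> conn S \<Longrightarrow> (y, x) \<in> conn S"
    unfolding conn_def by (meson symD sym_trancl)
qed

text \<open>Serves as the induction rule for \<open>conn\<close>: anything transitive that holds
  along edges holds along paths.\<close>

lemma conn_least:
  assumes "(x, y) \<in> conn S"
    and "\<And>B x y. B \<in> S \<Longrightarrow> x \<in> B \<Longrightarrow> y \<in> B \<Longrightarrow> (x, y) \<in> R" "trans R"
  shows "(x, y) \<in> R"
proof -
  have "(\<Union>B\<in>S. B \<times> B)\<^sup>+ \<subseteq> R\<^sup>+"
    using assms(2) by (intro trancl_mono_subset) blast
  also have "R\<^sup>+ = R" using \<open>trans R\<close> by (rule trancl_id)
  finally show ?thesis using assms(1) by (auto simp: conn_def)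
qed

lemma conn_subset: "(x, y) \<in> conn S \<Longrightarrow> x \<in> \<Union>S \<and> y \<in> \<Union>S"
  using conn_least[of x y S "\<Union>S \<times> \<Union>S"] by (auto simp: trans_def)

text \<open>Every vertex lies on an edge, so the transitive closure is reflexive without adding the
  diagonal. Hence \<open>conn S\<close> also remembers the vertex set, and it alone determines the
  components.\<close>

lemma conn_refl: "(x, x) \<in> conn S \<longleftrightarrow> x \<in> \<Union>S"
  using conn_subset conn_edge by (metis Union_iff)

lemma equiv_conn: "equiv (\<Union>S) (conn S)"
  by (intro equivI symI transI refl_onI)
    (auto simp: conn_refl simp del: Union_iff dest: conn_subset intro: conn_sym conn_trans)

lemma conn_mono:
  assumes "\<And>B x y. B \<in> S \<Longrightarrow> x \<in> B \<Longrightarrow> y \<in> B \<Longrightarrow> (x, y) \<in> conn T"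
  shows "conn S \<subseteq> conn T"
proof (rule subrelI)
  fix x y assume *: "(x, y) \<in> conn S"
  show "(x, y) \<in> conn T" by (rule conn_least[OF * _ trans_conn]) (rule assms)
qed

lemma Union_conn: "\<Union>S = Domain (conn S)"
  using conn_refl[of _ S] conn_subset[of _ _ S] by (auto simp del: Union_iff)

lemma components_cong: "conn S = conn T \<Longrightarrow> components S = components T"
  by (simp add: components_conn Union_conn)

lemma components_Union: "\<Union>(components S) = \<Union>S"
  unfolding components_conn by (rule Union_quotient[OF equiv_conn])

lemma components_nonempty: "{} \<notin> components S"
  unfolding components_conn using equiv_conn in_quotient_imp_non_empty by blast

lemma components_eqI: "c \<in> components S \<Longrightarrow> x \<in> c \<Longrightarrow> c = conn S `` {x}"
  unfolding components_conn by (auto elim!: quotientE dest: equiv_class_eq[OF equiv_conn])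

lemma componentsI: "x \<in> \<Union>S \<Longrightarrow> conn S `` {x} \<in> components S"
  unfolding components_conn by (rule quotientI)

lemma componentsE:
  assumes "c \<in> components S"
  obtains x where "x \<in> \<Union>S" "x \<in> c" "c = conn S `` {x}"
  using assms conn_refl unfolding components_conn by (metis Image_singleton_iff quotientE)

lemma components_disjoint: "disjoint (components S)"
  unfolding components_conn disjoint_def using quotient_disj[OF equiv_conn] by blast

lemma conn_iff_components: "(x, y) \<in> conn S \<longleftrightarrow> (\<exists>c\<in>components S. x \<in> c \<and> y \<in> c)"
proof
  assume "(x, y) \<in> conn S"
  then show "\<exists>c\<in>components S. x \<in> c \<and> y \<in> c"
    using componentsI[of x S] conn_subset[of x y S] conn_refl[of x S] by blast
qed (auto dest: components_eqI)

text \<open>Two blocks of a disjoint family that share a point are equal, so sharing a block is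
  already transitive.\<close>

lemma conn_disjoint_iff:
  assumes "disjoint S"
  shows "(x, y) \<in> conn S \<longleftrightarrow> (\<exists>B\<in>S. x \<in> B \<and> y \<in> B)"
proof
  assume "(x, y) \<in> conn S"
  then have "(x, y) \<in> {(x, y). \<exists>B\<in>S. x \<in> B \<and> y \<in> B}"
  proof (rule conn_least)
    show "trans {(x, y). \<exists>B\<in>S. x \<in> B \<and> y \<in> B}"
    proof (rule transI, clarify)
      fix x y z A B assume "A \<in> S" "B \<in> S" "x \<in> A" "y \<in> A" "y \<in> B" "z \<in> B"
      moreover then have "A = B" using disjointD[OF assms] by blast
      ultimately show "\<exists>B\<in>S. x \<in> B \<and> z \<in> B" by blast
    qed
  qed blast
  then show "\<exists>B\<in>S. x \<in> B \<and> y \<in> B" by simp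
qed (blast intro: conn_edge)

lemma components_id:
  assumes "disjoint S" "{} \<notin> S"
  shows "components S = S"
proof -
  have *: "conn S `` {x} = B" if "B \<in> S" "x \<in> B" for x B
  proof (intro set_eqI)
    fix y
    show "y \<in> conn S `` {x} \<longleftrightarrow> y \<in> B"
      using that disjointD[OF assms(1), of B] unfolding Image_singleton_iff conn_disjoint_iff[OF assms(1)]
      by blast
  qed
  show ?thesis
  proof (intro equalityI subsetI)
    fix c assume "c \<in> components S"
    then obtain x where "x \<in> \<Union>S" "c = conn S `` {x}" by (auto simp: components_conn quotient_def)
    then show "c \<in> S" using * by auto
  next
    fix B assume "B \<in> S"
    moreover then obtain x where "x \<in> B" using assms(2) by (metis ex_in_conv)
    ultimately show "B \<in> components S" using * componentsI by (metis UnionI)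
  qed
qed

text \<open>A partition is the set of classes of its own relation. Equalities of composed partitions
  are reduced to equalities of relations in this way.\<close>

lemma partition_eq_conn:
  assumes "disjoint S" "{} \<notin> S" "disjoint T" "{} \<notin> T" "conn S = conn T"
  shows "S = T"
  using assms components_cong components_id by metis

text \<open>Contracting an edge leaves a singleton. On an existing vertex it joins nothing and adds
  no vertex, so such debris can be discarded.\<close>

lemma conn_Un_singletons:
  assumes "\<And>B. B \<in> Z \<Longrightarrow> \<exists>x\<in>\<Union>S. B = {x}"
  shows "conn (S \<union> Z) = conn S"
proof
  show "conn (S \<union> Z) \<subseteq> conn S"
    by (rule conn_mono) (auto intro: conn_edge simp: conn_refl simp del: Union_iff dest!: assms)
  show "conn S \<subseteq> conn (S \<union> Z)"
    by (rule conn_mono) (auto intro: conn_edge)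
qed

section \<open>Images of hypergraphs under relabellings and contractions\<close>

lemma conn_image:
  assumes "(x, y) \<in> conn S"
  shows "(f x, f y) \<in> conn ((`) f ` S)"
proof -
  have "(x, y) \<in> {(x, y). (f x, f y) \<in> conn ((`) f ` S)}"
    using assms
  proof (rule conn_least)
    show "trans {(x, y). (f x, f y) \<in> conn ((`) f ` S)}"
      by (intro transI) (auto intro: conn_trans)
  qed (auto intro: conn_edge)
  then show ?thesis by simp
qed

text \<open>A map that only identifies vertices which are connected anyway merges no components: a
  path in the image lifts edge by edge, and the gaps between consecutive lifts lie inside
  fibres.\<close>

lemma conn_collapse:
  assumes fib: "\<And>x y. x \<in> \<Union>S \<Longrightarrow> y \<in> \<Union>S \<Longrightarrow> f x = f y \<Longrightarrow> (x, y) \<in> conn S"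
    and "x \<in> \<Union>S" "y \<in> \<Union>S"
  shows "(f x, f y) \<in> conn ((`) f ` S) \<longleftrightarrow> (x, y) \<in> conn S"
proof
  assume "(f x, f y) \<in> conn ((`) f ` S)"
  then have "(f x, f y) \<in> {(u, v). \<exists>x y. u = f x \<and> v = f y \<and> (x, y) \<in> conn S}"
  proof (rule conn_least)
    show "trans {(u, v). \<exists>x y. u = f x \<and> v = f y \<and> (x, y) \<in> conn S}"
    proof (rule transI)
      fix u v w
      assume "(u, v) \<in> {(u, v). \<exists>x y. u = f x \<and> v = f y \<and> (x, y) \<in> conn S}"
        "(v, w) \<in> {(u, v). \<exists>x y. u = f x \<and> v = f y \<and> (x, y) \<in> conn S}"
      then obtain x y y' z where *: "u = f x" "v = f y" "v = f y'" "w = f z"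
        "(x, y) \<in> conn S" "(y', z) \<in> conn S" by blast
      \<comment> \<open>The two lifted paths end and start at possibly different preimages of
        \<open>v\<close>; the fibre condition bridges them.\<close>
      then have "(y, y') \<in> conn S" using fib conn_subset by metis
      then have "(x, z) \<in> conn S" using * by (meson conn_trans)
      then show "(u, w) \<in> {(u, v). \<exists>x y. u = f x \<and> v = f y \<and> (x, y) \<in> conn S}" using * by blast
    qed
  qed (auto intro: conn_edge)
  then obtain x' y' where *: "f x = f x'" "f y = f y'" "(x', y') \<in> conn S" by auto
  then have "(x, x') \<in> conn S" "(y', y) \<in> conn S" using fib assms conn_subset by metis+
  then show "(x, y) \<in> conn S" using * by (meson conn_trans)
qed (rule conn_image)

text \<open>Since fibres lie inside components, different components have different images, so
  counting survives even a non-injective \<open>f\<close>.\<close>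

lemma bij_betw_components_collapse:
  assumes fib: "\<And>x y. x \<in> \<Union>S \<Longrightarrow> y \<in> \<Union>S \<Longrightarrow> f x = f y \<Longrightarrow> (x, y) \<in> conn S"
  shows "bij_betw ((`) f) (components S) (components ((`) f ` S))"
proof -
  have cl: "f ` (conn S `` {x}) = conn ((`) f ` S) `` {f x}" if "x \<in> \<Union>S" for x
  proof (intro equalityI subsetI)
    fix v assume v: "v \<in> conn ((`) f ` S) `` {f x}"
    then obtain y where "v = f y" "y \<in> \<Union>S" using conn_subset[of _ v] by fastforce
    then show "v \<in> f ` (conn S `` {x})" using v conn_collapse[of S f x y] fib that by auto
  qed (auto intro: conn_image)
  have comps: "components T = (\<lambda>x. conn T `` {x}) ` \<Union>T" for T :: "'c set set"
    by (auto simp: components_conn quotient_def)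
  have U: "\<Union>((`) f ` S) = f ` \<Union>S" by auto
  show ?thesis unfolding bij_betw_def
  proof
    show "(`) f ` components S = components ((`) f ` S)"
      unfolding comps U image_image using cl by (intro image_cong) auto
    show "inj_on ((`) f) (components S)"
    proof (rule inj_onI)
      fix c d assume cd: "c \<in> components S" "d \<in> components S" "f ` c = f ` d"
      obtain x where x: "x \<in> c" using cd(1) components_nonempty by (metis ex_in_conv)
      then obtain y where y: "y \<in> d" "f x = f y" using cd(3) by (metis imageE imageI)
      have "x \<in> \<Union>S" using x cd(1) components_Union[of S] by blast
      moreover have "y \<in> \<Union>S" using y(1) cd(2) components_Union[of S] by blast
      ultimately have "(x, y) \<in> conn S" using fib y by blast
      then have "conn S `` {x} = conn S `` {y}" by (meson equiv_class_eq_iff equiv_conn)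
      then show "c = d" using components_eqI[OF cd(1) x] components_eqI[OF cd(2) y(1)] by simp
    qed
  qed
qed

text \<open>Makes injective relabellings a special case of contractions.\<close>

lemma inj_fibres: "inj f \<Longrightarrow> x \<in> \<Union>S \<Longrightarrow> y \<in> \<Union>S \<Longrightarrow> f x = f y \<Longrightarrow> (x, y) \<in> conn S"
  by (auto simp: conn_refl inj_eq)

lemma conn_inj_iff:
  assumes f: "inj f"
  shows "(f x, f y) \<in> conn ((`) f ` S) \<longleftrightarrow> (x, y) \<in> conn S"
proof
  assume *: "(f x, f y) \<in> conn ((`) f ` S)"
  have "f x \<in> f ` \<Union>S" "f y \<in> f ` \<Union>S" using conn_subset[OF *] by auto
  then have "x \<in> \<Union>S" "y \<in> \<Union>S" using f by (auto simp: inj_image_mem_iff simp del: Union_iff)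
  then show "(x, y) \<in> conn S" using conn_collapse[of S f x y] inj_fibres[OF f, of _ S] * by simp
qed (rule conn_image)

lemma components_inj:
  assumes "inj f"
  shows "components ((`) f ` S) = (`) f ` components S"
  using bij_betw_components_collapse[of S f] inj_fibres[OF assms, of _ S]
  by (simp add: bij_betw_def del: Union_iff)

lemma card_components_collapse:
  assumes "\<And>x y. x \<in> \<Union>S \<Longrightarrow> y \<in> \<Union>S \<Longrightarrow> f x = f y \<Longrightarrow> (x, y) \<in> conn S"
  shows "card (components ((`) f ` S)) = card (components S)"
  using bij_betw_same_card[OF bij_betw_components_collapse[of S f]] assms by simp

lemma card_components_inj_subset:
  assumes "inj f"
  shows "card {c \<in> components ((`) f ` S). c \<subseteq> M} = card {c \<in> components S. c \<subseteq> f -` M}"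
proof -
  have "{c \<in> components ((`) f ` S). c \<subseteq> M} = (`) f ` {c \<in> components S. c \<subseteq> f -` M}"
    unfolding components_inj[OF assms] by auto
  moreover have "inj_on ((`) f) {c \<in> components S. c \<subseteq> f -` M}"
    by (rule inj_on_image) (rule inj_on_subset[OF assms subset_UNIV])
  ultimately show ?thesis by (simp add: card_image)
qed

section \<open>Restricting components to a subset of the vertices\<close>

definition cut :: "'a set \<Rightarrow> 'a set set \<Rightarrow> 'a set set" where
  "cut W S = (\<lambda>c. c \<inter> W) ` S - {{}}"

text \<open>Edges of \<open>S2\<close> stay in \<open>W\<close>, so a path leaves \<open>W\<close>
  only through \<open>S1\<close>. Each excursion stays in one component of \<open>S1\<close>, and
  the trace of that component on \<open>W\<close> provides a single edge replacing it. Hence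
  hypergraphs can be glued in stages.\<close>

lemma conn_cut:
  assumes "\<Union>S2 \<subseteq> W"
  shows "conn (cut W (components S1) \<union> S2) = conn (S1 \<union> S2) \<inter> W \<times> W" (is "conn ?T = _")
proof (intro equalityI subsetI)
  have "conn ?T \<subseteq> conn (S1 \<union> S2)"
  proof (rule conn_mono)
    fix B x y assume B: "B \<in> ?T" "x \<in> B" "y \<in> B"
    have "conn S1 \<subseteq> conn (S1 \<union> S2)" by (rule conn_mono) (auto intro: conn_edge)
    moreover have "(x, y) \<in> conn S1 \<or> B \<in> S2"
      using B unfolding conn_iff_components[of x y S1] cut_def by blast
    ultimately show "(x, y) \<in> conn (S1 \<union> S2)" using B by (auto intro: conn_edge)
  qed
  moreover have "\<Union>?T \<subseteq> W" using assms by (auto simp: cut_def)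
  ultimately show "z \<in> conn (S1 \<union> S2) \<inter> W \<times> W" if "z \<in> conn ?T" for z
    using that conn_subset[of "fst z" "snd z" ?T] by (metis IntI mem_Times_iff prod.collapse subsetD)
next
  fix z assume *: "z \<in> conn (S1 \<union> S2) \<inter> W \<times> W"
  obtain x y where xy: "z = (x, y)" by fastforce
  with * have z: "(x, y) \<in> conn (S1 \<union> S2)" "x \<in> W" "y \<in> W" by simp_all
  have cutI: "(u, v) \<in> conn ?T" if uv: "(u, v) \<in> conn S1" "u \<in> W" "v \<in> W" for u v
  proof -
    obtain c where "c \<in> components S1" "u \<in> c" "v \<in> c"
      using uv(1) unfolding conn_iff_components by auto
    then have "c \<inter> W \<in> ?T" "u \<in> c \<inter> W" "v \<in> c \<inter> W" using uv by (auto simp: cut_def)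
    then show ?thesis by (rule conn_edge)
  qed
  \<comment> \<open>Needed when the path starts with an edge of \<open>S1\<close>: then
    \<open>x\<close> itself is the last vertex known to lie in \<open>W\<close>, and it must still
    be a vertex after cutting.\<close>
  have xx: "(x, x) \<in> conn ?T"
  proof (cases "x \<in> \<Union>S1")
    case True
    then show ?thesis using cutI z(2) by (simp only: conn_refl[symmetric])
  next
    case False
    then have "x \<in> \<Union>S2" using conn_subset[OF z(1)] by simp
    then show ?thesis by (auto intro: conn_edge)
  qed
  \<comment> \<open>The path may currently be outside \<open>W\<close>, so the induction keeps track
    of a vertex \<open>u\<close> of \<open>W\<close> from which the current one is reached inside
    \<open>S1\<close>.\<close>
  have "\<exists>u\<in>W. (x, u) \<in> conn ?T \<and> (u = y \<or> (u, y) \<in> conn S1)"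
    using z(1) unfolding conn_def[of "S1 \<union> S2"]
  proof (induction rule: trancl_induct)
    case (base y)
    then obtain B where B: "B \<in> S1 \<or> B \<in> S2" "x \<in> B" "y \<in> B" by auto
    from B(1) show ?case
    proof
      assume "B \<in> S1"
      then have "(x, y) \<in> conn S1" using B by (auto intro: conn_edge)
      then show ?thesis using xx z(2) by auto
    next
      assume "B \<in> S2"
      then have "(x, y) \<in> conn ?T" "y \<in> W" using B assms by (auto intro: conn_edge)
      then show ?thesis by auto
    qed
  next
    case (step y y')
    then obtain u where u: "u \<in> W" "(x, u) \<in> conn ?T" "u = y \<or> (u, y) \<in> conn S1" by blast
    obtain B where B: "B \<in> S1 \<or> B \<in> S2" "y \<in> B" "y' \<in> B" using step by auto
    from B(1) show ?case
    proof
      assume "B \<in> S1"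
      then have "(y, y') \<in> conn S1" using B by (auto intro: conn_edge)
      then show ?thesis using u conn_trans by metis
    next
      assume B2: "B \<in> S2"
      then have W: "y \<in> W" "y' \<in> W" using B assms by auto
      have "(y, y') \<in> conn ?T" using B B2 by (auto intro: conn_edge)
      moreover have "(x, y) \<in> conn ?T" using u cutI W conn_trans by metis
      ultimately show ?thesis using W conn_trans by metis
    qed
  qed
  then show "z \<in> conn ?T" unfolding xy using cutI z(3) conn_trans by metis
qed

lemma components_cut:
  assumes "\<Union>S2 \<subseteq> W"
  shows "components (cut W (components S1) \<union> S2) = cut W (components (S1 \<union> S2))" (is "components ?T = ?R")
proof -
  have "disjoint ?R"
  proof (rule disjointI)
    fix a b assume "a \<in> ?R" "b \<in> ?R" "a \<noteq> b"
    then obtain c d where "a = c \<inter> W" "b = d \<inter> W" "c \<in> components (S1 \<union> S2)" "d \<in> components (S1 \<union> S2)"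
      unfolding cut_def by auto
    then show "a \<inter> b = {}" using disjointD[OF components_disjoint, of c "S1 \<union> S2" d] \<open>a \<noteq> b\<close> by auto
  qed
  moreover have "{} \<notin> ?R" by (simp add: cut_def)
  moreover have "conn ?R = conn ?T"
    unfolding conn_cut[OF assms] set_eq_iff split_paired_All conn_disjoint_iff[OF \<open>disjoint ?R\<close>]
    by (auto simp: cut_def conn_iff_components)
  ultimately show ?thesis using components_id[of ?R] components_cong[of ?R ?T] by simp
qed

lemma finite_components: "finite (\<Union>S) \<Longrightarrow> finite (components S)"
  by (metis components_Union finite_UnionD)

text \<open>Components that miss \<open>W\<close> are components of \<open>S1\<close> and lie in
  \<open>M\<close> automatically. The others are determined by their traces on \<open>W\<close>, and
  because the complement of \<open>W\<close> lies in \<open>M\<close>, the trace also decides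
  containment in \<open>M\<close>.\<close>

lemma card_components_cut:
  assumes S2: "\<Union>S2 \<subseteq> W" and fin: "finite (\<Union>S1)" "finite (\<Union>S2)" and M: "- W \<subseteq> M"
  shows "card {c \<in> components (S1 \<union> S2). c \<subseteq> M}
    = card {c \<in> components S1. c \<inter> W = {}} + card {c \<in> components (cut W (components S1) \<union> S2). c \<subseteq> M}"
proof -
  let ?C = "components (S1 \<union> S2)"
  have finC: "finite ?C" using fin by (intro finite_components) auto
  have sub: "conn S1 \<subseteq> conn (S1 \<union> S2)" by (rule conn_mono) (auto intro: conn_edge)
  \<comment> \<open>A component of \<open>S1\<close> without points in \<open>W\<close> is touched
    by no edge of \<open>S2\<close>, so it does not grow.\<close>
  have off: "conn (S1 \<union> S2) `` {x} = conn S1 `` {x}" if x: "x \<in> \<Union>S1" "conn S1 `` {x} \<inter> W = {}" for x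
  proof -
    have "(x, y) \<in> conn S1" if "(x, y) \<in> conn (S1 \<union> S2)" for y
      using that unfolding conn_def[of "S1 \<union> S2"]
    proof (induction rule: trancl_induct)
      case (base y)
      have "x \<notin> \<Union>S2" using x S2 conn_refl[of x S1] by auto
      then show ?case using base by (auto intro: conn_edge)
    next
      case (step y z)
      then have "y \<notin> \<Union>S2" using x(2) S2 by auto
      then have "(y, z) \<in> conn S1" using step(2) by (auto intro: conn_edge)
      with step(3) show ?case by (rule conn_trans)
    qed
    then show ?thesis using sub by blast
  qed
  have inner: "{c \<in> ?C. c \<inter> W = {}} = {c \<in> components S1. c \<inter> W = {}}"
  proof (intro equalityI subsetI)
    fix c assume "c \<in> {c \<in> ?C. c \<inter> W = {}}"
    then have c: "c \<in> ?C" "c \<inter> W = {}" by simp_all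
    obtain x where x: "x \<in> \<Union>(S1 \<union> S2)" "x \<in> c" and c_eq: "c = conn (S1 \<union> S2) `` {x}"
      using c(1) by (rule componentsE)
    have x1: "x \<in> \<Union>S1" using x S2 c(2) by auto
    have "conn S1 `` {x} \<inter> W = {}" using c(2) c_eq sub by auto
    with x1 have "c = conn S1 `` {x}" using off c_eq by simp
    then show "c \<in> {c \<in> components S1. c \<inter> W = {}}" using componentsI[OF x1] c(2) by simp
  next
    fix c assume "c \<in> {c \<in> components S1. c \<inter> W = {}}"
    then have c: "c \<in> components S1" "c \<inter> W = {}" by simp_all
    obtain x where x: "x \<in> \<Union>S1" "c = conn S1 `` {x}" using c(1) by (rule componentsE)
    then have "c = conn (S1 \<union> S2) `` {x}" using off c(2) by simp
    then show "c \<in> {c \<in> ?C. c \<inter> W = {}}" using componentsI[of x "S1 \<union> S2"] x(1) c(2) by simp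
  qed
  define A where "A = {c \<in> ?C. c \<subseteq> M \<and> c \<inter> W \<noteq> {}}"
  define B where "B = {c \<in> ?C. c \<inter> W = {}}"
  have sub_iff: "c \<inter> W \<subseteq> M \<longleftrightarrow> c \<subseteq> M" for c using M by blast
  have outer: "{c \<in> components (cut W (components S1) \<union> S2). c \<subseteq> M} = (\<lambda>c. c \<inter> W) ` A"
    unfolding components_cut[OF S2]
  proof (intro equalityI subsetI)
    fix d assume "d \<in> {c \<in> cut W ?C. c \<subseteq> M}"
    then obtain c where "c \<in> ?C" "d = c \<inter> W" "d \<noteq> {}" "d \<subseteq> M" unfolding cut_def by blast
    then show "d \<in> (\<lambda>c. c \<inter> W) ` A" unfolding A_def using sub_iff[of c] by blast
  next
    fix d assume "d \<in> (\<lambda>c. c \<inter> W) ` A"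
    then obtain c where "c \<in> ?C" "d = c \<inter> W" "d \<noteq> {}" "c \<subseteq> M" unfolding A_def by blast
    then show "d \<in> {c \<in> cut W ?C. c \<subseteq> M}" unfolding cut_def using sub_iff[of c] by simp
  qed
  have "inj_on (\<lambda>c. c \<inter> W) A"
  proof (rule inj_onI)
    fix c d assume "c \<in> A" "d \<in> A" and eq: "c \<inter> W = d \<inter> W"
    then have "c \<in> ?C" "d \<in> ?C" "c \<inter> d \<noteq> {}" by (auto simp: A_def)
    then show "c = d" using disjointD[OF components_disjoint, of c "S1 \<union> S2" d] by auto
  qed
  then have "card A = card {c \<in> components (cut W (components S1) \<union> S2). c \<subseteq> M}"
    unfolding outer by (simp add: card_image)
  moreover have "{c \<in> ?C. c \<subseteq> M} = B \<union> A"
    using M by (auto simp: A_def B_def)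
  moreover have "card (B \<union> A) = card B + card A"
    by (intro card_Un_disjoint) (use finC in \<open>auto simp: A_def B_def\<close>)
  ultimately show ?thesis using inner by (simp add: B_def)
qed

section \<open>Composition of partitions\<close>

lemma inj_outer_point: "inj outer_point"
proof (rule injI)
  show "x = y" if "outer_point x = outer_point y" for x y using that by (cases x; cases y) auto
qed

lemma flip_point_flip_point [simp]: "flip_point (flip_point x) = x"
  by (cases x) auto

lemma inj_flip_point: "inj flip_point"
  by (metis flip_point_flip_point injI)

lemma part_star_part_star [simp]: "part_star (part_star p) = p"
  by (simp add: part_star_def image_image)

lemma range_outer_point: "range outer_point = - range Mid"
proof (rule set_eqI)
  fix x show "x \<in> range outer_point \<longleftrightarrow> x \<in> - range Mid"
    by (cases x) (auto intro: range_eqI[of _ outer_point "Up _"] range_eqI[of _ outer_point "Lo _"]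
      elim!: outer_point.elims[OF sym])
qed

lemma partitionsD:
  assumes "p \<in> partitions k l"
  shows "disjoint p" "{} \<notin> p" "\<Union>p = points k l"
  using assms by (auto simp: partitions_def partition_on_def)

lemma finite_points: "finite (points k l)"
  by (simp add: points_def)

lemma finite_partitions: "finite (partitions k l)"
  unfolding partitions_def by (rule finitely_many_partition_on) (rule finite_points)

lemma part_comp_partition: "disjoint (part_comp q p)" "{} \<notin> part_comp q p"
proof -
  show "disjoint (part_comp q p)"
  proof (rule disjointI)
    fix a b assume "a \<in> part_comp q p" "b \<in> part_comp q p" "a \<noteq> b"
    then obtain c d where "a = outer_point -` c" "b = outer_point -` d"
        "c \<in> components (stack q p)" "d \<in> components (stack q p)"
      unfolding part_comp_def by auto
    then show "a \<inter> b = {}"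
      using disjointD[OF components_disjoint, of c "stack q p" d] \<open>a \<noteq> b\<close> by auto
  qed
qed (simp add: part_comp_def)

lemma conn_part_comp: "(a, b) \<in> conn (part_comp q p) \<longleftrightarrow> (outer_point a, outer_point b) \<in> conn (stack q p)"
proof -
  have "(\<exists>B\<in>part_comp q p. a \<in> B \<and> b \<in> B)
      \<longleftrightarrow> (\<exists>c\<in>components (stack q p). outer_point a \<in> c \<and> outer_point b \<in> c)"
  proof
    assume "\<exists>B\<in>part_comp q p. a \<in> B \<and> b \<in> B"
    then show "\<exists>c\<in>components (stack q p). outer_point a \<in> c \<and> outer_point b \<in> c"
      by (auto simp: part_comp_def)
  next
    assume "\<exists>c\<in>components (stack q p). outer_point a \<in> c \<and> outer_point b \<in> c"
    then obtain c where "c \<in> components (stack q p)" "a \<in> outer_point -` c" "b \<in> outer_point -` c" by auto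
    moreover from this have "outer_point -` c \<in> part_comp q p" by (auto simp: part_comp_def)
    ultimately show "\<exists>B\<in>part_comp q p. a \<in> B \<and> b \<in> B" by metis
  qed
  then show ?thesis
    using conn_disjoint_iff[OF part_comp_partition(1)[of q p], of a b]
      conn_iff_components[of "outer_point a" "outer_point b" "stack q p"] by metis
qed

lemma part_comp_eqI:
  assumes "disjoint p'" "{} \<notin> p'"
    and "\<And>a b. (outer_point a, outer_point b) \<in> conn (stack q p) \<longleftrightarrow> (a, b) \<in> conn p'"
  shows "part_comp q p = p'"
proof (rule partition_eq_conn[OF part_comp_partition assms(1,2)])
  show "conn (part_comp q p) = conn p'"
  proof (intro set_eqI, clarify)
    show "(a, b) \<in> conn (part_comp q p) \<longleftrightarrow> (a, b) \<in> conn p'" for a b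
      unfolding conn_part_comp by (rule assms(3))
  qed
qed

text \<open>Composition is an instance of \<open>cut\<close>, with \<open>W\<close> the complement
  of the middle points. The injection \<open>s\<close> places the stack inside a larger
  picture.\<close>

lemma cut_stack:
  assumes s: "inj s"
  shows "cut (- range (s \<circ> Mid)) (components ((`) s ` stack q p)) = (`) (s \<circ> outer_point) ` part_comp q p"
proof -
  have "s ` c \<inter> - range (s \<circ> Mid) = (s \<circ> outer_point) ` (outer_point -` c)" for c
  proof -
    have "s ` c \<inter> - range (s \<circ> Mid) = s ` (c \<inter> range outer_point)"
      unfolding range_outer_point using s by (auto simp: inj_eq)
    also have "c \<inter> range outer_point = outer_point ` (outer_point -` c)" by auto
    finally show ?thesis by (simp only: image_comp)
  qed
  then have "cut (- range (s \<circ> Mid)) (components ((`) s ` stack q p))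
      = (\<lambda>c. (s \<circ> outer_point) ` (outer_point -` c)) ` components (stack q p) - {{}}"
    unfolding cut_def components_inj[OF s] by (simp add: image_image)
  also have "\<dots> = (`) (s \<circ> outer_point) ` ((\<lambda>c. outer_point -` c) ` components (stack q p) - {{}})"
    by auto
  finally show ?thesis by (simp add: part_comp_def)
qed

text \<open>Inside any surrounding hypergraph that avoids the middle points, a composite may be
  replaced by the full stack without changing connectivity elsewhere.\<close>

lemma conn_stack_glue:
  assumes "inj s" "\<Union>S \<inter> range (s \<circ> Mid) = {}"
  shows "conn ((`) (s \<circ> outer_point) ` part_comp q p \<union> S)
    = conn ((`) s ` stack q p \<union> S) \<inter> (- range (s \<circ> Mid)) \<times> (- range (s \<circ> Mid))"
proof -
  have "\<Union>S \<subseteq> - range (s \<circ> Mid)" using assms(2) by blast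
  from conn_cut[OF this, of "(`) s ` stack q p"] show ?thesis unfolding cut_stack[OF assms(1)] .
qed

lemma finite_stack: "finite (\<Union>p) \<Longrightarrow> finite (\<Union>q) \<Longrightarrow> finite (\<Union>(stack q p))"
proof -
  have "\<Union>(stack q p) = upper_point ` \<Union>p \<union> lower_point ` \<Union>q" by (auto simp: stack_def)
  then show "finite (\<Union>p) \<Longrightarrow> finite (\<Union>q) \<Longrightarrow> finite (\<Union>(stack q p))" by simp
qed

text \<open>The components missing the complement of the middle points are exactly the loops; they
  are all that is lost when a stack is replaced by its composite.\<close>

lemma card_stack_glue:
  assumes s: "inj s" and S: "\<Union>S \<inter> range (s \<circ> Mid) = {}"
    and fin: "finite (\<Union>p)" "finite (\<Union>q)" "finite (\<Union>S)" and M: "range (s \<circ> Mid) \<subseteq> M"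
  shows "card {c \<in> components ((`) s ` stack q p \<union> S). c \<subseteq> M}
    = loops q p + card {c \<in> components ((`) (s \<circ> outer_point) ` part_comp q p \<union> S). c \<subseteq> M}"
proof -
  let ?W = "- range (s \<circ> Mid)"
  have "\<Union>((`) s ` stack q p) = s ` \<Union>(stack q p)" by auto
  then have "finite (\<Union>((`) s ` stack q p))" using finite_stack[OF fin(1,2)] by simp
  moreover have "\<Union>S \<subseteq> ?W" using S by blast
  ultimately have "card {c \<in> components ((`) s ` stack q p \<union> S). c \<subseteq> M}
    = card {c \<in> components ((`) s ` stack q p). c \<inter> ?W = {}}
      + card {c \<in> components (cut ?W (components ((`) s ` stack q p)) \<union> S). c \<subseteq> M}"
    using card_components_cut[of S ?W "(`) s ` stack q p" M] fin(3) M by simp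
  moreover have "{c \<in> components ((`) s ` stack q p). c \<inter> ?W = {}}
      = {c \<in> components ((`) s ` stack q p). c \<subseteq> range (s \<circ> Mid)}"
    by auto
  moreover have "s -` range (s \<circ> Mid) = range Mid" using s by (auto simp: inj_eq)
  ultimately show ?thesis
    unfolding cut_stack[OF s] loops_def by (simp only: card_components_inj_subset[OF s])
qed

text \<open>Points of a vertical stack of several partitions are pairs of a level and an index.\<close>

fun lev :: "nat \<Rightarrow> nat \<Rightarrow> point \<Rightarrow> nat \<times> nat" where
  "lev i j (Up n) = (i, n)"
| "lev i j (Lo n) = (j, n)"

fun slev :: "nat \<Rightarrow> nat \<Rightarrow> nat \<Rightarrow> stack_point \<Rightarrow> nat \<times> nat" where
  "slev i j k (Top n) = (i, n)"
| "slev i j k (Mid n) = (j, n)"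
| "slev i j k (Bot n) = (k, n)"

lemma slev_upper: "slev i j k (upper_point x) = lev i j x" by (cases x) auto
lemma slev_lower: "slev i j k (lower_point x) = lev j k x" by (cases x) auto
lemma slev_outer: "slev i j k (outer_point x) = lev i k x" by (cases x) auto

lemma slev_stack: "(`) (slev i j k) ` stack q p = (`) (lev i j) ` p \<union> (`) (lev j k) ` q"
  by (simp add: stack_def image_Un image_image slev_upper slev_lower)

lemma slev_comp_outer: "slev i j k \<circ> outer_point = lev i k"
  by (auto simp: slev_outer)

lemma inj_slev:
  assumes "i \<noteq> j" "i \<noteq> k" "j \<noteq> k"
  shows "inj (slev i j k)"
proof (rule injI)
  show "x = y" if "slev i j k x = slev i j k y" for x y using that assms by (cases x; cases y) auto
qed

lemma levels_disjoint:
  assumes "l \<noteq> i" "l \<noteq> j"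
  shows "\<Union>((`) (lev i j) ` p) \<inter> {x. fst x = l} = {}"
proof (rule ccontr)
  assume "\<Union>((`) (lev i j) ` p) \<inter> {x. fst x = l} \<noteq> {}"
  then obtain x where x: "x \<in> \<Union>((`) (lev i j) ` p)" "fst x = l" by blast
  then obtain a where "x = lev i j a" by blast
  with x(2) have "fst (lev i j a) = l" by simp
  then show False using assms by (cases a) auto
qed

lemma range_slev_Mid: "range (slev i j k \<circ> Mid) = {x. fst x = j}"
  by (auto simp: image_iff)

lemma conn_levels_glue:
  assumes "i \<noteq> j" "i \<noteq> k" "j \<noteq> k" "\<Union>S \<inter> {x. fst x = j} = {}"
  shows "conn ((`) (lev i k) ` part_comp q p \<union> S)
    = conn ((`) (lev i j) ` p \<union> (`) (lev j k) ` q \<union> S) \<inter> {x. fst x \<noteq> j} \<times> {x. fst x \<noteq> j}"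
  using conn_stack_glue[OF inj_slev, of i j k S q p] assms
  unfolding slev_stack slev_comp_outer range_slev_Mid Collect_neg_eq by blast

lemma card_levels_glue:
  assumes "i \<noteq> j" "i \<noteq> k" "j \<noteq> k" "\<Union>S \<inter> {x. fst x = j} = {}"
    and "finite (\<Union>p)" "finite (\<Union>q)" "finite (\<Union>S)" "{x. fst x = j} \<subseteq> M"
  shows "card {c \<in> components ((`) (lev i j) ` p \<union> (`) (lev j k) ` q \<union> S). c \<subseteq> M}
    = loops q p + card {c \<in> components ((`) (lev i k) ` part_comp q p \<union> S). c \<subseteq> M}"
  using card_stack_glue[OF inj_slev, of i j k S p q M] assms
  unfolding slev_stack slev_comp_outer range_slev_Mid by blast

lemma conn_part_comp_levels:
  assumes "i \<noteq> j" "i \<noteq> k" "j \<noteq> k"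
  shows "(a, b) \<in> conn (part_comp q p)
    \<longleftrightarrow> (lev i k a, lev i k b) \<in> conn ((`) (lev i j) ` p \<union> (`) (lev j k) ` q)"
  using conn_inj_iff[OF inj_slev[OF assms], of "outer_point a" "outer_point b" "stack q p"]
  unfolding slev_stack slev_outer conn_part_comp by blast

lemma loops_levels:
  assumes "i \<noteq> j" "i \<noteq> k" "j \<noteq> k"
  shows "loops q p = card {c \<in> components ((`) (lev i j) ` p \<union> (`) (lev j k) ` q). c \<subseteq> {x. fst x = j}}"
proof -
  have "slev i j k -` {x. fst x = j} = range Mid"
  proof (rule set_eqI)
    show "x \<in> slev i j k -` {x. fst x = j} \<longleftrightarrow> x \<in> range Mid" for x using assms by (cases x) auto
  qed
  then show ?thesis
    using card_components_inj_subset[OF inj_slev[OF assms], of "stack q p" "{x. fst x = j}"]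
    unfolding slev_stack loops_def by simp
qed

text \<open>Both bracketings come from the same triple stack \<open>T\<close> on levels 0 to 3: one
  removes level 1 first, the other level 2, and in the end only connectivity between levels 0 and 3
  is read off.\<close>

lemma part_comp_assoc: "part_comp r (part_comp q p) = part_comp (part_comp r q) p"
proof (rule partition_eq_conn)
  define T where "T = (`) (lev 0 1) ` p \<union> (`) (lev 1 2) ` q \<union> (`) (lev 2 3) ` r"
  show "conn (part_comp r (part_comp q p)) = conn (part_comp (part_comp r q) p)"
  proof (intro set_eqI, clarify)
    fix a b
    have lev03: "fst (lev 0 3 c) \<noteq> 1" "fst (lev 0 3 c) \<noteq> 2" for c by (cases c; simp)+
    have 1: "conn ((`) (lev 0 2) ` part_comp q p \<union> (`) (lev 2 3) ` r) = conn T \<inter> {x. fst x \<noteq> 1} \<times> {x. fst x \<noteq> 1}"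
      unfolding T_def by (rule conn_levels_glue) (simp_all add: levels_disjoint)
    have "conn ((`) (lev 1 3) ` part_comp r q \<union> (`) (lev 0 1) ` p)
        = conn ((`) (lev 1 2) ` q \<union> (`) (lev 2 3) ` r \<union> (`) (lev 0 1) ` p) \<inter> {x. fst x \<noteq> 2} \<times> {x. fst x \<noteq> 2}"
      by (rule conn_levels_glue) (simp_all add: levels_disjoint)
    then have 2: "conn ((`) (lev 0 1) ` p \<union> (`) (lev 1 3) ` part_comp r q) = conn T \<inter> {x. fst x \<noteq> 2} \<times> {x. fst x \<noteq> 2}"
      unfolding T_def by (simp only: Un_ac)
    have "(a, b) \<in> conn (part_comp r (part_comp q p)) \<longleftrightarrow> (lev 0 3 a, lev 0 3 b) \<in> conn T"
      using conn_part_comp_levels[of 0 2 3 a b r "part_comp q p"] lev03 unfolding 1 by simp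
    also have "\<dots> \<longleftrightarrow> (a, b) \<in> conn (part_comp (part_comp r q) p)"
      using conn_part_comp_levels[of 0 1 3 a b "part_comp r q" p] lev03 unfolding 2 by simp
    finally show "(a, b) \<in> conn (part_comp r (part_comp q p)) \<longleftrightarrow> (a, b) \<in> conn (part_comp (part_comp r q) p)" .
  qed
qed (rule part_comp_partition)+

text \<open>The components of the triple stack inside the two inner levels are counted in two ways.
  Composing one pair first removes some of them as loops, and the rest are the loops of the second
  composition.\<close>

lemma loops_assoc:
  assumes "finite (\<Union>p)" "finite (\<Union>q)" "finite (\<Union>r)"
  shows "loops r (part_comp q p) + loops q p = loops (part_comp r q) p + loops r q"
proof -
  define T where "T = (`) (lev 0 1) ` p \<union> (`) (lev 1 2) ` q \<union> (`) (lev 2 3) ` r"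
  define M :: "(nat \<times> nat) set" where "M = {x. fst x = 1 \<or> fst x = 2}"
  have fin: "finite (\<Union>((`) f ` P))" if "finite (\<Union>P)" for f :: "point \<Rightarrow> nat \<times> nat" and P
  proof -
    have "\<Union>((`) f ` P) = f ` \<Union>P" by auto
    then show ?thesis using that by simp
  qed
  \<comment> \<open>After the first gluing, level \<open>m\<close> carries no points, so lying in
    the inner levels means lying in the remaining level \<open>l\<close>.\<close>
  have sub: "{c \<in> components S. c \<subseteq> M} = {c \<in> components S. c \<subseteq> {x. fst x = l}}"
    if "\<Union>S \<inter> {x. fst x = m} = {}" "l = 1 \<and> m = 2 \<or> l = 2 \<and> m = 1" for S l m
  proof -
    have M_eq: "M = {x. fst x = l} \<union> {x. fst x = m}" using that(2) by (auto simp: M_def)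
    have "c \<subseteq> M \<longleftrightarrow> c \<subseteq> {x. fst x = l}" if c: "c \<in> components S" for c
    proof -
      have "c \<subseteq> \<Union>S" using c components_Union[of S] by blast
      then show ?thesis unfolding M_eq using \<open>\<Union>S \<inter> {x. fst x = m} = {}\<close> by blast
    qed
    then show ?thesis by blast
  qed
  have "card {c \<in> components T. c \<subseteq> M}
      = loops q p + card {c \<in> components ((`) (lev 0 2) ` part_comp q p \<union> (`) (lev 2 3) ` r). c \<subseteq> M}"
    unfolding T_def by (rule card_levels_glue) (use assms fin in \<open>auto simp: levels_disjoint M_def\<close>)
  also have "{c \<in> components ((`) (lev 0 2) ` part_comp q p \<union> (`) (lev 2 3) ` r). c \<subseteq> M}
      = {c \<in> components ((`) (lev 0 2) ` part_comp q p \<union> (`) (lev 2 3) ` r). c \<subseteq> {x. fst x = 2}}"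
    by (rule sub[where m = 1]) (simp_all add: Int_Un_distrib2 levels_disjoint)
  also have "card \<dots> = loops r (part_comp q p)"
    by (rule loops_levels[symmetric]) auto
  finally have 1: "card {c \<in> components T. c \<subseteq> M} = loops q p + loops r (part_comp q p)" .
  have "T = (`) (lev 1 2) ` q \<union> (`) (lev 2 3) ` r \<union> (`) (lev 0 1) ` p"
    unfolding T_def by (simp only: Un_ac)
  then have "card {c \<in> components T. c \<subseteq> M}
      = card {c \<in> components ((`) (lev 1 2) ` q \<union> (`) (lev 2 3) ` r \<union> (`) (lev 0 1) ` p). c \<subseteq> M}" by simp
  also have "\<dots> = loops r q + card {c \<in> components ((`) (lev 1 3) ` part_comp r q \<union> (`) (lev 0 1) ` p). c \<subseteq> M}"
    by (rule card_levels_glue) (use assms fin in \<open>auto simp: levels_disjoint M_def\<close>)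
  also have "{c \<in> components ((`) (lev 1 3) ` part_comp r q \<union> (`) (lev 0 1) ` p). c \<subseteq> M}
      = {c \<in> components ((`) (lev 0 1) ` p \<union> (`) (lev 1 3) ` part_comp r q). c \<subseteq> {x. fst x = 1}}"
    unfolding Un_commute[of "(`) (lev 1 3) ` part_comp r q"]
    by (rule sub[where m = 2]) (simp_all add: Int_Un_distrib2 levels_disjoint)
  also have "card \<dots> = loops (part_comp r q) p"
    by (rule loops_levels[symmetric]) auto
  finally show ?thesis using 1 by simp
qed

section \<open>Contractions of stacks: identities, bending and closing up\<close>

lemma upper_points: "upper_point ` points k l = Top ` {1..k} \<union> Mid ` {1..l}"
  by (simp add: points_def image_Un image_image)

lemma lower_points: "lower_point ` points k l = Mid ` {1..k} \<union> Bot ` {1..l}"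
  by (simp add: points_def image_Un image_image)

text \<open>
  If \<open>f\<close> contracts a stack to the partition \<open>p\<close> (up to singletons), where \<open>g\<close> picks a point in each
  fibre, then the composition is \<open>p\<close> up to relabelling and there are no loops.
\<close>

lemma stack_contract:
  assumes p: "disjoint p" "{} \<notin> p"
    and image: "(`) f ` stack q' p' = p \<union> Z" "\<And>B. B \<in> Z \<Longrightarrow> \<exists>x\<in>\<Union>p. B = {x}"
    and fib: "\<And>x. x \<in> \<Union>(stack q' p') \<Longrightarrow> (x, g (f x)) \<in> conn (stack q' p')"
    and outer: "\<And>a. outer_point a \<in> \<Union>(stack q' p') \<longleftrightarrow> \<sigma> a \<in> \<Union>p"
      "\<And>a. outer_point a \<in> \<Union>(stack q' p') \<Longrightarrow> f (outer_point a) = \<sigma> a"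
    and \<sigma>: "\<And>a. \<sigma> (\<sigma> a) = a"
  shows "part_comp q' p' = (`) \<sigma> ` p" "loops q' p' = 0"
proof -
  let ?S = "stack q' p'"
  have inj: "inj \<sigma>" by (metis \<sigma> injI)
  have im: "conn ((`) f ` ?S) = conn p"
    unfolding image(1) by (rule conn_Un_singletons) (rule image(2))
  have fib': "(x, y) \<in> conn ?S" if "x \<in> \<Union>?S" "y \<in> \<Union>?S" "f x = f y" for x y
    using fib[OF that(1)] fib[OF that(2)] that(3) by (metis conn_sym conn_trans)
  have conn_iff: "(x, y) \<in> conn ?S \<longleftrightarrow> (f x, f y) \<in> conn p" if "x \<in> \<Union>?S" "y \<in> \<Union>?S" for x y
    using conn_collapse[of ?S f x y] fib' that unfolding im by blast
  show "part_comp q' p' = (`) \<sigma> ` p"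
  proof (rule part_comp_eqI)
    show "disjoint ((`) \<sigma> ` p)"
    proof (rule disjointI)
      fix a b assume "a \<in> (`) \<sigma> ` p" "b \<in> (`) \<sigma> ` p" "a \<noteq> b"
      then obtain c d where "c \<in> p" "d \<in> p" "c \<noteq> d" "a = \<sigma> ` c" "b = \<sigma> ` d" by auto
      then show "a \<inter> b = {}" using disjointD[OF p(1), of c d] inj by (simp add: image_Int[symmetric])
    qed
    show "{} \<notin> (`) \<sigma> ` p" using p(2) by auto
    fix a b
    have "(a, b) \<in> conn ((`) \<sigma> ` p) \<longleftrightarrow> (\<sigma> a, \<sigma> b) \<in> conn p"
      using conn_inj_iff[OF inj, of "\<sigma> a" "\<sigma> b" p] by (simp add: \<sigma>)
    moreover have "(outer_point a, outer_point b) \<in> conn ?S \<longleftrightarrow> (\<sigma> a, \<sigma> b) \<in> conn p"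
    proof (cases "outer_point a \<in> \<Union>?S \<and> outer_point b \<in> \<Union>?S")
      case True
      then show ?thesis using conn_iff outer(2) by simp
    next
      case False
      then show ?thesis using conn_subset[of "outer_point a" "outer_point b" ?S]
          conn_subset[of "\<sigma> a" "\<sigma> b" p] outer(1) by metis
    qed
    ultimately show "(outer_point a, outer_point b) \<in> conn ?S \<longleftrightarrow> (a, b) \<in> conn ((`) \<sigma> ` p)" by simp
  qed
  have "\<not> c \<subseteq> range Mid" if c: "c \<in> components ?S" for c
  proof -
    obtain x where x: "x \<in> \<Union>?S" "c = conn ?S `` {x}" using c by (rule componentsE)
    have "f x \<in> \<Union>((`) f ` ?S)" using x(1) by auto
    moreover have "\<Union>((`) f ` ?S) = \<Union>p" using im by (simp only: Union_conn)
    ultimately have "\<sigma> (\<sigma> (f x)) \<in> \<Union>p" by (simp add: \<sigma>)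
    then have o: "outer_point (\<sigma> (f x)) \<in> \<Union>?S" using outer(1) by metis
    then have "f (outer_point (\<sigma> (f x))) = f x" using outer(2) \<sigma> by simp
    then have "(x, outer_point (\<sigma> (f x))) \<in> conn ?S" using fib'[OF x(1) o] by simp
    then have "outer_point (\<sigma> (f x)) \<in> c" using x(2) by simp
    then show ?thesis using range_outer_point by blast
  qed
  then have "{c \<in> components ?S. c \<subseteq> range Mid} = {}" by blast
  then show "loops q' p' = 0" by (simp only: loops_def card.empty)
qed

text \<open>The strands of the identity are contracted: \<open>f\<close> pulls each bottom point
  back to the lower point of \<open>p\<close> above it, so the strands become singletons and
  \<open>p\<close> remains, with no relabelling.\<close>

lemma part_comp_id_left:
  assumes "p \<in> partitions k l"
  shows "part_comp (id_part l) p = p" "loops (id_part l) p = 0"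
proof -
  note p = partitionsD[OF assms]
  define f where "f x = (case x of Top i \<Rightarrow> Up i | Mid i \<Rightarrow> Lo i | Bot i \<Rightarrow> Lo i)" for x
  have fu: "f (upper_point x) = x" for x by (cases x) (auto simp: f_def)
  have stack: "stack (id_part l) p = (`) upper_point ` p \<union> (\<lambda>i. {Mid i, Bot i}) ` {1..l}"
    by (simp add: stack_def id_part_def image_image)
  have U: "\<Union>(stack (id_part l) p) = upper_point ` points k l \<union> Mid ` {1..l} \<union> Bot ` {1..l}"
    unfolding stack p(3)[symmetric] by auto
  have im: "(`) f ` stack (id_part l) p = p \<union> (\<lambda>i. {Lo i}) ` {1..l}"
    unfolding stack by (simp add: image_Un image_image fu) (simp add: f_def)
  have "(x, upper_point (f x)) \<in> conn (stack (id_part l) p)" if x: "x \<in> \<Union>(stack (id_part l) p)" for x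
  proof (cases x)
    case (Bot i)
    then have "i \<in> {1..l}" using x unfolding U upper_points lower_points by (auto elim!: upper_point.elims[OF sym])
    then have "{Mid i, Bot i} \<in> stack (id_part l) p" by (simp add: stack)
    then show ?thesis using Bot by (intro conn_edge) (auto simp: f_def)
  qed (use x in \<open>simp_all add: f_def conn_refl\<close>)
  moreover have "outer_point a \<in> \<Union>(stack (id_part l) p) \<longleftrightarrow> a \<in> \<Union>p" for a
    unfolding U upper_points lower_points p(3) by (cases a) (auto simp: points_def)
  moreover have "f (outer_point a) = a" for a by (cases a) (auto simp: f_def)
  moreover have "\<exists>x\<in>\<Union>p. B = {x}" if "B \<in> (\<lambda>i. {Lo i}) ` {1..l}" for B
    using that unfolding p(3) by (auto simp: points_def)
  ultimately have *: "part_comp (id_part l) p = (`) (\<lambda>x. x) ` p" "loops (id_part l) p = 0"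
    using stack_contract[OF p(1,2) im, of upper_point "\<lambda>x. x"] by blast+
  then show "part_comp (id_part l) p = p" "loops (id_part l) p = 0" by simp_all
qed

lemma part_comp_id_right:
  assumes "p \<in> partitions k l"
  shows "part_comp p (id_part k) = p" "loops p (id_part k) = 0"
proof -
  note p = partitionsD[OF assms]
  define f where "f x = (case x of Top i \<Rightarrow> Up i | Mid i \<Rightarrow> Up i | Bot i \<Rightarrow> Lo i)" for x
  have fl: "f (lower_point x) = x" for x by (cases x) (auto simp: f_def)
  have stack: "stack p (id_part k) = (`) lower_point ` p \<union> (\<lambda>i. {Top i, Mid i}) ` {1..k}"
    by (auto simp add: stack_def id_part_def image_image)
  have U: "\<Union>(stack p (id_part k)) = lower_point ` points k l \<union> Top ` {1..k} \<union> Mid ` {1..k}"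
    unfolding stack p(3)[symmetric] by auto
  have im: "(`) f ` stack p (id_part k) = p \<union> (\<lambda>i. {Up i}) ` {1..k}"
    unfolding stack by (simp add: image_Un image_image fl) (simp add: f_def)
  have "(x, lower_point (f x)) \<in> conn (stack p (id_part k))" if x: "x \<in> \<Union>(stack p (id_part k))" for x
  proof (cases x)
    case (Top i)
    then have "i \<in> {1..k}" using x unfolding U upper_points lower_points by (auto elim!: lower_point.elims[OF sym])
    then have "{Top i, Mid i} \<in> stack p (id_part k)" by (simp add: stack)
    then show ?thesis using Top by (intro conn_edge) (auto simp: f_def)
  qed (use x in \<open>simp_all add: f_def conn_refl\<close>)
  moreover have "outer_point a \<in> \<Union>(stack p (id_part k)) \<longleftrightarrow> a \<in> \<Union>p" for a
    unfolding U upper_points lower_points p(3) by (cases a) (auto simp: points_def)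
  moreover have "f (outer_point a) = a" for a by (cases a) (auto simp: f_def)
  moreover have "\<exists>x\<in>\<Union>p. B = {x}" if "B \<in> (\<lambda>i. {Up i}) ` {1..k}" for B
    using that unfolding p(3) by (auto simp: points_def)
  ultimately have *: "part_comp p (id_part k) = (`) (\<lambda>x. x) ` p" "loops p (id_part k) = 0"
    using stack_contract[OF p(1,2) im, of lower_point "\<lambda>x. x"] by blast+
  then show "part_comp p (id_part k) = p" "loops p (id_part k) = 0" by simp_all
qed

text \<open>Bending the last upper strand down. As a transposition it also undoes itself.\<close>

definition rot_point :: "nat \<Rightarrow> nat \<Rightarrow> point \<Rightarrow> point" where
  "rot_point k l x = (if x = Up (k + 1) then Lo (l + 1) else if x = Lo (l + 1) then Up (k + 1) else x)"

definition rot :: "nat \<Rightarrow> nat \<Rightarrow> partition \<Rightarrow> partition" where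
  "rot k l p = (`) (rot_point k l) ` p"

lemma rot_point_rot_point [simp]: "rot_point k l (rot_point k l x) = x"
  by (auto simp: rot_point_def)

lemma inj_rot_point: "inj (rot_point k l)"
  by (metis rot_point_rot_point injI)

lemma rot_rot [simp]: "rot k l (rot k l p) = p"
  by (simp add: rot_def image_image)

lemma rot_star: "rot l k (part_star p) = part_star (rot k l p)"
proof -
  have "rot_point l k (flip_point x) = flip_point (rot_point k l x)" for x
    by (cases x) (auto simp: rot_point_def)
  then show ?thesis by (simp add: rot_def part_star_def image_image)
qed

text \<open>Coevaluation to the right of \<open>k\<close> identity strands: the starred pair
  consists of lower points, which the shift moves to positions \<open>k + 1\<close> and
  \<open>k + 2\<close>.\<close>

definition cup :: "nat \<Rightarrow> partition" where
  "cup k = part_tensor k k (id_part k) (part_star {{Up 1, Up 2}})"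

text \<open>The last upper point of \<open>p\<close> is led by the cup to middle point
  \<open>k + 2\<close>, and from there by the added identity strand to the bottom point
  \<open>l + 1\<close>. Contracting this path turns the stack into \<open>p\<close> with one point
  relabelled.\<close>

lemma rot_eq_part_comp:
  assumes "p \<in> partitions (k + 1) l"
  shows "part_comp (part_tensor (k + 1) l p (id_part 1)) (cup k) = rot k l p"
    "loops (part_tensor (k + 1) l p (id_part 1)) (cup k) = 0"
proof -
  note p = partitionsD[OF assms]
  let ?S = "stack (part_tensor (k + 1) l p (id_part 1)) (cup k)"
  \<comment> \<open>The minimum identifies both feet of the cup, and \<open>Bot (l + 1)\<close> goes
    to the same point; all other strands are contracted vertically.\<close>
  define f where "f x = (case x of Top i \<Rightarrow> Up i | Mid i \<Rightarrow> Up (min i (k + 1))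
    | Bot i \<Rightarrow> if i = l + 1 then Up (k + 1) else Lo i)" for x
  have stack: "?S = (`) lower_point ` p \<union> ((\<lambda>i. {Top i, Mid i}) ` {1..k} \<union>
      {{Mid (k + 1), Mid (k + 2)}, {Mid (k + 2), Bot (l + 1)}})"
    by (auto simp add: stack_def id_part_def cup_def part_star_def part_tensor_def image_image image_Un)
  have U: "\<Union>?S = lower_point ` points (k + 1) l \<union> Top ` {1..k} \<union> Mid ` {1..k}
      \<union> {Mid (k + 1), Mid (k + 2), Bot (l + 1)}"
    unfolding stack p(3)[symmetric] by auto
  have fl: "f (lower_point x) = x" if "x \<in> points (k + 1) l" for x
    using that by (auto simp: f_def points_def)
  have "f ` lower_point ` B = B" if "B \<in> p" for B
  proof -
    have "B \<subseteq> points (k + 1) l" using that p(3) by blast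
    then have "(\<lambda>x. f (lower_point x)) ` B = (\<lambda>x. x) ` B" using fl by (intro image_cong) auto
    then show ?thesis by (simp add: image_image)
  qed
  then have "(`) f ` (`) lower_point ` p = p" by (simp add: image_image)
  then have im: "(`) f ` ?S = p \<union> (`) f ` ((\<lambda>i. {Top i, Mid i}) ` {1..k} \<union>
      {{Mid (k + 1), Mid (k + 2)}, {Mid (k + 2), Bot (l + 1)}})"
    unfolding stack image_Un by simp
  have sing: "\<exists>x\<in>\<Union>p. B = {x}" if "B \<in> (`) f ` ((\<lambda>i. {Top i, Mid i}) ` {1..k} \<union>
      {{Mid (k + 1), Mid (k + 2)}, {Mid (k + 2), Bot (l + 1)}})" for B
    using that unfolding p(3) by (auto simp: points_def f_def)
  have e1: "(Mid (k + 2), Mid (k + 1)) \<in> conn ?S"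
    by (rule conn_edge[of "{Mid (k + 1), Mid (k + 2)}"]) (unfold stack, auto)
  moreover have "(Bot (l + 1), Mid (k + 2)) \<in> conn ?S"
    by (rule conn_edge[of "{Mid (k + 2), Bot (l + 1)}"]) (unfold stack, auto)
  ultimately have e2: "(Bot (l + 1), Mid (k + 1)) \<in> conn ?S" by (metis conn_trans)
  have fib: "(x, lower_point (f x)) \<in> conn ?S" if x: "x \<in> \<Union>?S" for x
  proof (cases x)
    case (Top i)
    then have "i \<in> {1..k}" using x unfolding U upper_points lower_points by (auto elim!: lower_point.elims[OF sym])
    then have "{Top i, Mid i} \<in> ?S" unfolding stack by simp
    then show ?thesis using Top by (intro conn_edge) (auto simp: f_def)
  next
    case (Mid i)
    then have "i \<le> k + 1 \<or> i = k + 2" using x unfolding U upper_points lower_points by (auto simp: points_def)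
    then show ?thesis using Mid e1 x by (auto simp: f_def conn_refl min_def)
  next
    case (Bot i)
    then show ?thesis using e2 x by (auto simp: f_def conn_refl)
  qed
  have outer1: "outer_point a \<in> \<Union>?S \<longleftrightarrow> rot_point k l a \<in> \<Union>p" for a
    unfolding U upper_points lower_points p(3) by (cases a) (auto simp: points_def rot_point_def)
  have outer2: "f (outer_point a) = rot_point k l a" if "outer_point a \<in> \<Union>?S" for a
    using that unfolding U upper_points lower_points by (cases a) (auto simp: points_def rot_point_def f_def)
  show "part_comp (part_tensor (k + 1) l p (id_part 1)) (cup k) = rot k l p"
    "loops (part_tensor (k + 1) l p (id_part 1)) (cup k) = 0"
    using stack_contract[OF p(1,2) im sing fib outer1 outer2 rot_point_rot_point] unfolding rot_def by blast+
qed

text \<open>Contracting the closing strands folds \<open>q\<close> back onto \<open>p\<close>: the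
  bottom of \<open>q\<close> meets the top of \<open>p\<close>, while the middle points become the
  lower points of both. What the composition loses as loops is added back on the left. The
  right-hand side is symmetric up to a flip.\<close>

lemma closure_components_part_comp:
  assumes "p \<in> partitions k l" "q \<in> partitions l k"
  shows "closure_components k (part_comp q p) + loops q p = card (components (p \<union> part_star q))"
proof -
  note p = partitionsD[OF assms(1)] and q = partitionsD[OF assms(2)]
  define L where "L = (\<lambda>i. {Top i, Bot i}) ` {1..k}"
  define f where "f x = (case x of Top i \<Rightarrow> Up i | Mid i \<Rightarrow> Lo i | Bot i \<Rightarrow> Up i)" for x
  let ?S = "stack q p \<union> L"
  have L: "L = (`) outer_point ` ((\<lambda>i. {Up i, Lo i}) ` {1..k})" by (simp add: L_def image_image)
  have fu: "f (upper_point x) = x" and fl: "f (lower_point x) = flip_point x" for x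
    by (cases x; simp add: f_def)+
  have U: "\<Union>?S = upper_point ` points k l \<union> lower_point ` points l k \<union> Top ` {1..k} \<union> Bot ` {1..k}"
    unfolding stack_def L_def p(3)[symmetric] q(3)[symmetric] by auto
  have fib0: "(x, upper_point (f x)) \<in> conn ?S" if x: "x \<in> \<Union>?S" for x
  proof (cases x)
    case (Top i)
    then have "upper_point (f x) = x" by (simp add: f_def)
    then show ?thesis using x by (simp only: conn_refl)
  next
    case (Mid i)
    then have "upper_point (f x) = x" by (simp add: f_def)
    then show ?thesis using x by (simp only: conn_refl)
  next
    case (Bot i)
    then have "i \<in> {1..k}" using x unfolding U upper_points lower_points by (auto simp: points_def)
    then have "{Top i, Bot i} \<in> ?S" by (simp add: L_def)
    then show ?thesis using Bot by (intro conn_edge) (auto simp: f_def)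
  qed
  have fib: "(x, y) \<in> conn ?S" if "x \<in> \<Union>?S" "y \<in> \<Union>?S" "f x = f y" for x y
    using fib0[OF that(1)] fib0[OF that(2)] that(3) by (metis conn_sym conn_trans)
  have ft: "f (Top i) = Up i" "f (Bot i) = Up i" for i by (simp_all add: f_def)
  have "conn ((`) f ` ?S) = conn ((p \<union> part_star q) \<union> (\<lambda>i. {Up i}) ` {1..k})"
    unfolding image_Un stack_def L_def part_star_def by (simp add: image_image fu fl ft Un_assoc)
  also have "\<dots> = conn (p \<union> part_star q)"
  proof (rule conn_Un_singletons)
    show "\<exists>x\<in>\<Union>(p \<union> part_star q). B = {x}" if "B \<in> (\<lambda>i. {Up i}) ` {1..k}" for B
      using that unfolding Union_Un_distrib p(3) by (auto simp: points_def)
  qed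
  finally have "conn ((`) f ` ?S) = conn (p \<union> part_star q)" .
  then have "components ((`) f ` ?S) = components (p \<union> part_star q)" by (rule components_cong)
  then have "card (components (p \<union> part_star q)) = card (components ((`) f ` ?S))" by (simp only:)
  also have "\<dots> = card (components ?S)" using fib by (rule card_components_collapse)
  \<comment> \<open>The gluing lemma is used with \<open>UNIV\<close> for \<open>M\<close>, so that
    all components are counted.\<close>
  also have "\<dots> = loops q p + card (components ((`) outer_point ` part_comp q p \<union> L))"
  proof -
    have "\<Union>L \<inter> range (id \<circ> Mid) = {}" "finite (\<Union>L)" by (auto simp: L_def)
    then show ?thesis
      using card_stack_glue[of id L p q UNIV] p(3) q(3) by (simp add: finite_points)
  qed
  also have "(`) outer_point ` part_comp q p \<union> L
      = (`) outer_point ` (part_comp q p \<union> (\<lambda>i. {Up i, Lo i}) ` {1..k})"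
    unfolding L image_Un ..
  also have "card (components \<dots>) = closure_components k (part_comp q p)"
    unfolding closure_components_def by (rule card_components_collapse) (rule inj_fibres[OF inj_outer_point])
  finally show ?thesis by simp
qed

lemma card_components_inj:
  "inj f \<Longrightarrow> card (components ((`) f ` p \<union> (`) f ` q)) = card (components (p \<union> q))"
  unfolding image_Un[symmetric] by (rule card_components_collapse) (rule inj_fibres)

section \<open>Closure of the set of all partitions under the operations\<close>

lemma Union_part_comp: "\<Union>(part_comp q p) = outer_point -` \<Union>(stack q p)"
  by (intro set_eqI) (simp only: conn_refl[symmetric] conn_part_comp vimage_eq)

lemma part_comp_in_partitions:
  assumes "p \<in> partitions k l" "q \<in> partitions l m"
  shows "part_comp q p \<in> partitions k m"
proof -
  note p = partitionsD[OF assms(1)] and q = partitionsD[OF assms(2)]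
  have "\<Union>(stack q p) = upper_point ` points k l \<union> lower_point ` points l m"
    unfolding stack_def p(3)[symmetric] q(3)[symmetric] by auto
  then have "\<Union>(part_comp q p) = outer_point -` (Top ` {1..k} \<union> Mid ` {1..l} \<union> Bot ` {1..m})"
    unfolding Union_part_comp upper_points lower_points by auto
  also have "x \<in> \<dots> \<longleftrightarrow> x \<in> points k m" for x by (cases x) (auto simp: points_def)
  then have "outer_point -` (Top ` {1..k} \<union> Mid ` {1..l} \<union> Bot ` {1..m}) = points k m" by blast
  finally show ?thesis by (simp add: partitions_def partition_on_def part_comp_partition)
qed

lemma partitions_image:
  assumes "inj f" "f ` points k l = points k' l'" "p \<in> partitions k l"
  shows "(`) f ` p \<in> partitions k' l'"
proof -
  note p = partitionsD[OF assms(3)]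
  have "disjoint ((`) f ` p)"
  proof (rule disjointI)
    fix a b assume "a \<in> (`) f ` p" "b \<in> (`) f ` p" "a \<noteq> b"
    then obtain c d where "c \<in> p" "d \<in> p" "c \<noteq> d" "a = f ` c" "b = f ` d" by auto
    then show "a \<inter> b = {}" using disjointD[OF p(1), of c d] assms(1) by (simp add: image_Int[symmetric])
  qed
  moreover have "\<Union>((`) f ` p) = points k' l'"
    unfolding assms(2)[symmetric] p(3)[symmetric] by auto
  ultimately show ?thesis using p(2) by (auto simp: partitions_def partition_on_def)
qed

lemma part_star_in_partitions:
  assumes "p \<in> partitions k l"
  shows "part_star p \<in> partitions l k"
  unfolding part_star_def
  by (rule partitions_image[OF inj_flip_point _ assms]) (auto simp: points_def image_Un image_image)

lemma rot_in_partitions: "p \<in> partitions (k + 1) l \<Longrightarrow> rot k l p \<in> partitions k (l + 1)"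
  and rot_in_partitions': "p \<in> partitions k (l + 1) \<Longrightarrow> rot k l p \<in> partitions (k + 1) l"
proof -
  have sub: "rot_point k l ` points (k + 1) l \<subseteq> points k (l + 1)" "rot_point k l ` points k (l + 1) \<subseteq> points (k + 1) l"
    by (auto simp: points_def rot_point_def)
  \<comment> \<open>As the relabelling is an involution, the two inclusions force equality.\<close>
  have "points k (l + 1) = rot_point k l ` rot_point k l ` points k (l + 1)"
    "points (k + 1) l = rot_point k l ` rot_point k l ` points (k + 1) l"
    by (simp_all add: image_image)
  then have eq: "rot_point k l ` points (k + 1) l = points k (l + 1)" "rot_point k l ` points k (l + 1) = points (k + 1) l"
    using sub by (metis image_mono subset_antisym)+
  show "p \<in> partitions (k + 1) l \<Longrightarrow> rot k l p \<in> partitions k (l + 1)"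
    "p \<in> partitions k (l + 1) \<Longrightarrow> rot k l p \<in> partitions (k + 1) l"
    unfolding rot_def using partitions_image[OF inj_rot_point] eq by blast+
qed

section \<open>Linear combinations of partitions\<close>

text \<open>Here \<open>partitions\<close> takes the place of \<open>C\<close>: the identities of
  composition and trace hold for all partitions, and \<open>C\<close> enters later through its
  closure properties.\<close>

lemma lin_hom_partitions: "\<phi> \<in> lin_hom partitions k l \<longleftrightarrow> (\<forall>p. p \<notin> partitions k l \<longrightarrow> \<phi> p = 0)"
  by (simp add: lin_hom_def)

text \<open>Evaluates on a composite the linear functional with values \<open>h\<close> on the
  basis. Taking \<open>h\<close> to be a trace weight or the weight of a further composition reduces
  those to statements about pairs of partitions.\<close>

lemma sum_lin_comp:
  "(\<Sum>r\<in>partitions k m. lin_comp t k l m \<psi> \<phi> r * h r)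
    = (\<Sum>p\<in>partitions k l. \<Sum>q\<in>partitions l m. \<psi> q * \<phi> p * t ^ loops q p * h (part_comp q p))"
proof -
  have "(\<Sum>r\<in>partitions k m. lin_comp t k l m \<psi> \<phi> r * h r)
      = (\<Sum>r\<in>partitions k m. \<Sum>p\<in>partitions k l. \<Sum>q\<in>partitions l m.
          if r = part_comp q p then \<psi> q * \<phi> p * t ^ loops q p * h r else 0)"
    unfolding lin_comp_def sum_distrib_right by (intro sum.cong refl) auto
  also have "\<dots> = (\<Sum>p\<in>partitions k l. \<Sum>r\<in>partitions k m. \<Sum>q\<in>partitions l m.
          if r = part_comp q p then \<psi> q * \<phi> p * t ^ loops q p * h r else 0)"
    by (rule sum.swap)
  also have "\<dots> = (\<Sum>p\<in>partitions k l. \<Sum>q\<in>partitions l m. \<Sum>r\<in>partitions k m.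
          if r = part_comp q p then \<psi> q * \<phi> p * t ^ loops q p * h r else 0)"
    by (intro sum.cong refl sum.swap)
  also have "\<dots> = (\<Sum>p\<in>partitions k l. \<Sum>q\<in>partitions l m. \<psi> q * \<phi> p * t ^ loops q p * h (part_comp q p))"
    by (intro sum.cong refl) (simp add: finite_partitions part_comp_in_partitions)
  finally show ?thesis .
qed

lemma finite_Union_partition: "p \<in> partitions k l \<Longrightarrow> finite (\<Union>p)"
  using partitionsD(3) finite_points by metis

lemma lin_comp_assoc:
  "lin_comp t k m n \<chi> (lin_comp t k l m \<psi> \<phi>) = lin_comp t k l n (lin_comp t l m n \<chi> \<psi>) \<phi>"
proof
  fix s
  let ?P = "partitions"
  have "lin_comp t k m n \<chi> (lin_comp t k l m \<psi> \<phi>) s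
      = (\<Sum>r'\<in>?P m n. \<Sum>r\<in>?P k m. lin_comp t k l m \<psi> \<phi> r *
          (\<chi> r' * t ^ loops r' r * of_bool (s = part_comp r' r)))"
    unfolding lin_comp_def[of t k m n] by (subst sum.swap) (simp add: mult_ac)
  also have "\<dots> = (\<Sum>r'\<in>?P m n. \<Sum>p\<in>?P k l. \<Sum>q\<in>?P l m. \<psi> q * \<phi> p * t ^ loops q p *
          (\<chi> r' * t ^ loops r' (part_comp q p) * of_bool (s = part_comp r' (part_comp q p))))"
    unfolding sum_lin_comp ..
  also have "\<dots> = (\<Sum>p\<in>?P k l. \<Sum>r'\<in>?P m n. \<Sum>q\<in>?P l m. \<psi> q * \<phi> p * t ^ loops q p *
          (\<chi> r' * t ^ loops r' (part_comp q p) * of_bool (s = part_comp r' (part_comp q p))))"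
    by (rule sum.swap)
  also have "\<dots> = (\<Sum>p\<in>?P k l. \<Sum>q\<in>?P l m. \<Sum>r'\<in>?P m n. \<psi> q * \<phi> p * t ^ loops q p *
          (\<chi> r' * t ^ loops r' (part_comp q p) * of_bool (s = part_comp r' (part_comp q p))))"
    by (intro sum.cong refl sum.swap)
  also have "\<dots> = (\<Sum>p\<in>?P k l. \<Sum>q\<in>?P l m. \<Sum>r'\<in>?P m n. \<chi> r' * \<psi> q * t ^ loops r' q *
          (\<phi> p * t ^ loops (part_comp r' q) p * of_bool (s = part_comp (part_comp r' q) p)))"
  proof (intro sum.cong refl)
    fix p q r assume "p \<in> ?P k l" "q \<in> ?P l m" "r \<in> ?P m n"
    \<comment> \<open>The scalars of the two bracketings agree because the total number of loops
      does.\<close>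
    then have "t ^ loops q p * t ^ loops r (part_comp q p) = t ^ loops r q * t ^ loops (part_comp r q) p"
      unfolding power_add[symmetric]
      using loops_assoc[of p q r] by (simp add: finite_Union_partition add.commute)
    then show "\<psi> q * \<phi> p * t ^ loops q p * (\<chi> r * t ^ loops r (part_comp q p) * of_bool (s = part_comp r (part_comp q p)))
      = \<chi> r * \<psi> q * t ^ loops r q * (\<phi> p * t ^ loops (part_comp r q) p * of_bool (s = part_comp (part_comp r q) p))"
      unfolding part_comp_assoc by (simp add: mult_ac)
  qed
  also have "\<dots> = (\<Sum>p\<in>?P k l. \<Sum>r\<in>?P l n. lin_comp t l m n \<chi> \<psi> r *
      (\<phi> p * t ^ loops r p * of_bool (s = part_comp r p)))"
    unfolding sum_lin_comp ..
  also have "\<dots> = lin_comp t k l n (lin_comp t l m n \<chi> \<psi>) \<phi> s"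
    unfolding lin_comp_def[of t k l n] by (simp add: mult_ac)
  finally show "lin_comp t k m n \<chi> (lin_comp t k l m \<psi> \<phi>) s = lin_comp t k l n (lin_comp t l m n \<chi> \<psi>) \<phi> s" .
qed

lemma lin_comp_sum_left: "lin_comp t k l m (\<lambda>p. \<Sum>j\<in>A. f j p) \<phi> = (\<lambda>r. \<Sum>j\<in>A. lin_comp t k l m (f j) \<phi> r)"
proof
  fix r
  show "lin_comp t k l m (\<lambda>p. \<Sum>j\<in>A. f j p) \<phi> r = (\<Sum>j\<in>A. lin_comp t k l m (f j) \<phi> r)"
    unfolding lin_comp_def sum_distrib_right
    by (subst sum.swap[of _ A]) (rule sum.swap)
qed

lemma lin_comp_sum_right: "lin_comp t k l m \<psi> (\<lambda>p. \<Sum>j\<in>A. f j p) = (\<lambda>r. \<Sum>j\<in>A. lin_comp t k l m \<psi> (f j) r)"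
proof
  fix r
  show "lin_comp t k l m \<psi> (\<lambda>p. \<Sum>j\<in>A. f j p) r = (\<Sum>j\<in>A. lin_comp t k l m \<psi> (f j) r)"
    unfolding lin_comp_def sum_distrib_right sum_distrib_left
    by (subst sum.swap[of _ A]) (rule sum.swap)
qed

lemma lin_comp_add_left: "lin_comp t k l m (\<lambda>p. \<psi> p + \<psi>' p) \<phi> = (\<lambda>r. lin_comp t k l m \<psi> \<phi> r + lin_comp t k l m \<psi>' \<phi> r)"
  by (simp add: lin_comp_def distrib_left distrib_right sum.distrib)

lemma lin_comp_add_right: "lin_comp t k l m \<psi> (\<lambda>p. \<phi> p + \<phi>' p) = (\<lambda>r. lin_comp t k l m \<psi> \<phi> r + lin_comp t k l m \<psi> \<phi>' r)"
  by (simp add: lin_comp_def distrib_left distrib_right sum.distrib)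

lemma lin_comp_scl_left: "lin_comp t k l m (\<lambda>p. a * \<psi> p) \<phi> = (\<lambda>r. a * lin_comp t k l m \<psi> \<phi> r)"
  by (simp add: lin_comp_def sum_distrib_left mult_ac)

lemma lin_comp_scl_right: "lin_comp t k l m \<psi> (\<lambda>p. a * \<phi> p) = (\<lambda>r. a * lin_comp t k l m \<psi> \<phi> r)"
  by (simp add: lin_comp_def sum_distrib_left mult_ac)

lemma lin_comp_zero_left [simp]: "lin_comp t k l m (\<lambda>p. 0) \<phi> = (\<lambda>r. 0)"
  by (simp add: lin_comp_def)

lemma lin_comp_zero_right [simp]: "lin_comp t k l m \<psi> (\<lambda>p. 0) = (\<lambda>r. 0)"
  by (simp add: lin_comp_def)

lemma id_part_in_partitions: "id_part k \<in> partitions k k"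
proof -
  have "disjoint (id_part k)" by (rule disjointI) (auto simp: id_part_def)
  moreover have "\<Union>(id_part k) = points k k" by (auto simp: id_part_def points_def)
  ultimately show ?thesis by (auto simp: partitions_def partition_on_def id_part_def)
qed

lemma lin_comp_id_left:
  assumes "\<phi> \<in> lin_hom partitions k l"
  shows "lin_comp t k l l (lin_id l) \<phi> = \<phi>"
proof
  fix r
  have "lin_comp t k l l (lin_id l) \<phi> r = (\<Sum>p\<in>partitions k l. \<Sum>q\<in>partitions l l.
      if q = id_part l then \<phi> p * t ^ loops q p * of_bool (r = part_comp q p) else 0)"
    unfolding lin_comp_def lin_id_def by (intro sum.cong refl) auto
  also have "\<dots> = (\<Sum>p\<in>partitions k l. if p = r then \<phi> p else 0)"
    by (intro sum.cong refl) (auto simp: finite_partitions id_part_in_partitions part_comp_id_left)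
  also have "\<dots> = \<phi> r" using assms by (simp add: finite_partitions lin_hom_partitions)
  finally show "lin_comp t k l l (lin_id l) \<phi> r = \<phi> r" .
qed

lemma lin_comp_id_right:
  assumes "\<phi> \<in> lin_hom partitions k l"
  shows "lin_comp t k k l \<phi> (lin_id k) = \<phi>"
proof
  fix r
  have "lin_comp t k k l \<phi> (lin_id k) r = (\<Sum>p\<in>partitions k k. \<Sum>q\<in>partitions k l.
      if p = id_part k then \<phi> q * t ^ loops q p * of_bool (r = part_comp q p) else 0)"
    unfolding lin_comp_def lin_id_def by (intro sum.cong refl) auto
  also have "\<dots> = (\<Sum>q\<in>partitions k l. \<Sum>p\<in>partitions k k.
      if p = id_part k then \<phi> q * t ^ loops q p * of_bool (r = part_comp q p) else 0)"
    by (rule sum.swap)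
  also have "\<dots> = (\<Sum>q\<in>partitions k l. if q = r then \<phi> q else 0)"
    by (intro sum.cong refl) (auto simp: finite_partitions id_part_in_partitions part_comp_id_right)
  also have "\<dots> = \<phi> r" using assms by (simp add: finite_partitions lin_hom_partitions)
  finally show "lin_comp t k k l \<phi> (lin_id k) r = \<phi> r" .
qed

text \<open>The bilinear form \<open>tr (\<phi> \<circ> \<psi>\<^sup>*)\<close> (without conjugation) on the span of \<open>P(k, l)\<close>.\<close>

definition pairing :: "complex \<Rightarrow> nat \<Rightarrow> nat \<Rightarrow> lincomb \<Rightarrow> lincomb \<Rightarrow> complex" where
  "pairing t k l \<phi> \<psi> = (\<Sum>p\<in>partitions k l. \<Sum>q\<in>partitions k l. \<phi> p * \<psi> q * t ^ card (components (p \<union> q)))"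

lemma sum_partitions_star: "(\<Sum>p\<in>partitions k l. f p) = (\<Sum>p\<in>partitions l k. f (part_star p))"
  by (rule sum.reindex_bij_witness[of _ part_star part_star]) (auto simp: part_star_in_partitions)

lemma sum_partitions_rot: "(\<Sum>p\<in>partitions k (l + 1). f p) = (\<Sum>p\<in>partitions (k + 1) l. f (rot k l p))"
  by (rule sum.reindex_bij_witness[of _ "rot k l" "rot k l"]) (auto simp: rot_in_partitions[simplified] rot_in_partitions'[simplified])

text \<open>The loops of the composition and the components of its closure add up in the exponent of
  \<open>t\<close>. Precomposing with \<open>part_star\<close> is the linear, not antilinear,
  extension of the flip.\<close>

lemma lin_trace_comp: "lin_trace t l (lin_comp t l k l \<phi> \<psi>) = pairing t k l \<phi> (\<psi> \<circ> part_star)"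
proof -
  have "lin_trace t l (lin_comp t l k l \<phi> \<psi>) = (\<Sum>p\<in>partitions l k. \<Sum>q\<in>partitions k l.
      \<phi> q * \<psi> p * t ^ loops q p * t ^ closure_components l (part_comp q p))"
    unfolding lin_trace_def sum_lin_comp ..
  also have "\<dots> = (\<Sum>p\<in>partitions l k. \<Sum>q\<in>partitions k l. \<phi> q * \<psi> p * t ^ card (components (p \<union> part_star q)))"
    by (intro sum.cong refl) (simp add: closure_components_part_comp[symmetric] power_add mult_ac)
  also have "\<dots> = (\<Sum>p\<in>partitions k l. \<Sum>q\<in>partitions k l. \<phi> q * \<psi> (part_star p) * t ^ card (components (part_star p \<union> part_star q)))"
    by (rule sum_partitions_star)
  \<comment> \<open>Flipping both partitions relabels the points of their union, so the number of
    components is unchanged.\<close>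
  also have "\<dots> = (\<Sum>p\<in>partitions k l. \<Sum>q\<in>partitions k l. \<phi> q * \<psi> (part_star p) * t ^ card (components (p \<union> q)))"
    unfolding part_star_def[of p for p] using card_components_inj[OF inj_flip_point] by simp
  also have "\<dots> = (\<Sum>q\<in>partitions k l. \<Sum>p\<in>partitions k l. \<phi> q * \<psi> (part_star p) * t ^ card (components (p \<union> q)))"
    by (rule sum.swap)
  finally show ?thesis by (simp add: pairing_def Un_commute)
qed

lemma pairing_star: "pairing t l k (\<psi> \<circ> part_star) (\<phi> \<circ> part_star) = pairing t k l \<psi> \<phi>"
  unfolding pairing_def sum_partitions_star[of _ l k]
  by (simp add: part_star_def card_components_inj[OF inj_flip_point] image_image)

lemma pairing_commute: "pairing t k l \<phi> \<psi> = pairing t k l \<psi> \<phi>"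
  unfolding pairing_def by (subst sum.swap) (simp add: Un_commute mult_ac)

text \<open>Combines the symmetry of \<open>pairing\<close> with its invariance under flipping both
  arguments.\<close>

lemma lin_trace_cyclic: "lin_trace t l (lin_comp t l k l \<phi> \<psi>) = lin_trace t k (lin_comp t k l k \<psi> \<phi>)"
proof -
  have "pairing t l k \<psi> (\<phi> \<circ> part_star) = pairing t l k ((\<psi> \<circ> part_star) \<circ> part_star) (\<phi> \<circ> part_star)"
    by (simp add: comp_def)
  then show ?thesis unfolding lin_trace_comp pairing_star by (simp only: pairing_commute)
qed

lemma lin_trace_zero [simp]: "lin_trace t k (\<lambda>p. 0) = 0"
  by (simp add: lin_trace_def)

lemma lin_trace_sum: "lin_trace t k (\<lambda>p. \<Sum>j\<in>A. f j p) = (\<Sum>j\<in>A. lin_trace t k (f j))"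
  unfolding lin_trace_def sum_distrib_right by (rule sum.swap)

text \<open>Pulling coefficients back along \<open>rot\<close> is the linear extension of
  \<open>rot\<close>, because \<open>rot\<close> is its own inverse.\<close>

definition lin_rot :: "nat \<Rightarrow> nat \<Rightarrow> lincomb \<Rightarrow> lincomb" where
  "lin_rot k l \<phi> = (\<lambda>r. \<phi> (rot k l r))"

lemma lin_rot_lin_rot [simp]: "lin_rot k l (lin_rot k l \<phi>) = \<phi>"
  by (simp add: lin_rot_def)

lemma lin_star_lin_star [simp]: "lin_star (lin_star \<phi>) = \<phi>"
  by (simp add: lin_star_def)

lemma lin_star_lin_rot: "lin_rot l k (lin_star \<phi>) = lin_star (lin_rot k l \<phi>)"
  by (simp add: lin_rot_def lin_star_def rot_star[symmetric])

text \<open>The form only sees the number of components of \<open>p \<union> q\<close>, so both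
  arguments may be bent simultaneously.\<close>

lemma pairing_lin_rot: "pairing t k (l + 1) (lin_rot k l \<phi>) (lin_rot k l \<psi>) = pairing t (k + 1) l \<phi> \<psi>"
  unfolding pairing_def sum_partitions_rot
  by (simp add: lin_rot_def) (simp add: rot_def card_components_inj[OF inj_rot_point])

text \<open>The condition on tensor products is restricted to the support of \<open>\<phi>\<close>:
  there it follows from the closure of \<open>C\<close> under tensor products.\<close>

lemma lin_rot_eq_lin_comp:
  assumes "\<phi> \<in> lin_hom partitions (k + 1) l"
    and cup: "cup k \<in> partitions k (k + 2)"
    and tens: "\<And>p. p \<in> partitions (k + 1) l \<Longrightarrow> \<phi> p \<noteq> 0 \<Longrightarrow> part_tensor (k + 1) l p (id_part 1) \<in> partitions (k + 2) (l + 1)"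
  shows "lin_comp t k (k + 2) (l + 1) (lin_tensor (k + 1) l 1 1 \<phi> (lin_id 1)) (\<lambda>p. of_bool (p = cup k)) = lin_rot k l \<phi>"
proof
  fix s
  let ?T = "\<lambda>p. part_tensor (k + 1) l p (id_part 1)"
  have tens_eq: "lin_tensor (k + 1) l 1 1 \<phi> (lin_id 1) r = (\<Sum>p\<in>partitions (k + 1) l. \<phi> p * of_bool (r = ?T p))" for r
  proof -
    have "lin_tensor (k + 1) l 1 1 \<phi> (lin_id 1) r = (\<Sum>p\<in>partitions (k + 1) l. \<Sum>q\<in>partitions 1 1.
        if q = id_part 1 then \<phi> p * of_bool (r = part_tensor (k + 1) l p q) else 0)"
      unfolding lin_tensor_def lin_id_def by (intro sum.cong refl) auto
    then show ?thesis by (simp add: finite_partitions id_part_in_partitions)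
  qed
  have "lin_comp t k (k + 2) (l + 1) (lin_tensor (k + 1) l 1 1 \<phi> (lin_id 1)) (\<lambda>p. of_bool (p = cup k)) s
      = (\<Sum>p\<in>partitions k (k + 2). \<Sum>q\<in>partitions (k + 2) (l + 1).
          if p = cup k then lin_tensor (k + 1) l 1 1 \<phi> (lin_id 1) q * t ^ loops q p * of_bool (s = part_comp q p) else 0)"
    unfolding lin_comp_def by (intro sum.cong refl) auto
  also have "\<dots> = (\<Sum>q\<in>partitions (k + 2) (l + 1). \<Sum>p\<in>partitions k (k + 2).
          if p = cup k then lin_tensor (k + 1) l 1 1 \<phi> (lin_id 1) q * t ^ loops q p * of_bool (s = part_comp q p) else 0)"
    by (rule sum.swap)
  also have "\<dots> = (\<Sum>q\<in>partitions (k + 2) (l + 1). \<Sum>p\<in>partitions (k + 1) l.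
      \<phi> p * of_bool (q = ?T p) * (t ^ loops q (cup k) * of_bool (s = part_comp q (cup k))))"
  proof (rule sum.cong[OF refl])
    fix q
    have "(\<Sum>p\<in>partitions k (k + 2). if p = cup k
          then lin_tensor (k + 1) l 1 1 \<phi> (lin_id 1) q * t ^ loops q p * of_bool (s = part_comp q p) else 0)
        = lin_tensor (k + 1) l 1 1 \<phi> (lin_id 1) q * (t ^ loops q (cup k) * of_bool (s = part_comp q (cup k)))"
      using cup by (simp add: finite_partitions)
    then show "(\<Sum>p\<in>partitions k (k + 2). if p = cup k
          then lin_tensor (k + 1) l 1 1 \<phi> (lin_id 1) q * t ^ loops q p * of_bool (s = part_comp q p) else 0)
        = (\<Sum>p\<in>partitions (k + 1) l.
            \<phi> p * of_bool (q = ?T p) * (t ^ loops q (cup k) * of_bool (s = part_comp q (cup k))))"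
      unfolding tens_eq sum_distrib_right .
  qed
  also have "\<dots> = (\<Sum>p\<in>partitions (k + 1) l. \<Sum>q\<in>partitions (k + 2) (l + 1).
      \<phi> p * of_bool (q = ?T p) * (t ^ loops q (cup k) * of_bool (s = part_comp q (cup k))))"
    by (rule sum.swap)
  also have "\<dots> = (\<Sum>p\<in>partitions (k + 1) l. if p = rot k l s then \<phi> p else 0)"
  proof (intro sum.cong refl)
    fix p assume p: "p \<in> partitions (k + 1) l"
    have "(\<Sum>q\<in>partitions (k + 2) (l + 1). \<phi> p * of_bool (q = ?T p) * (t ^ loops q (cup k) * of_bool (s = part_comp q (cup k))))
        = (\<Sum>q\<in>partitions (k + 2) (l + 1). if q = ?T p then \<phi> p * t ^ loops q (cup k) * of_bool (s = part_comp q (cup k)) else 0)"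
      by (intro sum.cong refl) auto
    also have "\<dots> = \<phi> p * of_bool (s = rot k l p)"
      using tens[OF p] rot_eq_part_comp[OF p] by (cases "\<phi> p = 0") (simp_all add: finite_partitions)
    also have "\<dots> = (if p = rot k l s then \<phi> p else 0)" by auto
    finally show "(\<Sum>q\<in>partitions (k + 2) (l + 1). \<phi> p * of_bool (q = ?T p) * (t ^ loops q (cup k) * of_bool (s = part_comp q (cup k))))
      = (if p = rot k l s then \<phi> p else 0)" .
  qed
  also have "\<dots> = lin_rot k l \<phi> s"
    using assms(1) by (simp add: finite_partitions lin_hom_partitions lin_rot_def)
  finally show "lin_comp t k (k + 2) (l + 1) (lin_tensor (k + 1) l 1 1 \<phi> (lin_id 1)) (\<lambda>p. of_bool (p = cup k)) s = lin_rot k l \<phi> s" .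
qed

section \<open>Closure of a category of partitions and of its linear combinations\<close>

context category_of_partitions
begin

lemma partitions_if: "p \<in> C k l \<Longrightarrow> p \<in> partitions k l"
  using subset_partitions by blast

lemma lin_hom_subset: "\<phi> \<in> lin_hom C k l \<Longrightarrow> \<phi> \<in> lin_hom partitions k l"
  using subset_partitions by (auto simp: lin_hom_def)

lemma id_part_in: "id_part k \<in> C k k"
proof (induction k)
  case 0
  \<comment> \<open>Composing the pair with its flip shows that \<open>C 0 0\<close> is inhabited,
    and the empty partition is its only possible element.\<close>
  have "part_comp {{Up 1, Up 2}} (part_star {{Up 1, Up 2}}) \<in> C 0 0"
    using comp_closed[OF star_closed[OF pair_in] pair_in] .
  moreover have "p = {}" if "p \<in> C 0 0" for p
    using partitionsD[OF partitions_if[OF that]] by (auto simp: points_def)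
  ultimately have "{} \<in> C 0 0" by metis
  then show ?case by (simp add: id_part_def)
next
  case (Suc k)
  have "{1..Suc k} = insert (Suc k) {1..k}" by auto
  then have "id_part (Suc k) = part_tensor k k (id_part k) {{Up 1, Lo 1}}"
    by (simp add: id_part_def part_tensor_def insert_commute)
  then show ?case using tensor_closed[OF Suc identity_in] by simp
qed

lemma cup_in: "cup k \<in> C k (k + 2)"
  using tensor_closed[OF id_part_in[of k] star_closed[OF pair_in]] by (simp add: cup_def)

lemma rot_in:
  assumes "p \<in> C (k + 1) l"
  shows "rot k l p \<in> C k (l + 1)"
proof -
  have "part_tensor (k + 1) l p (id_part 1) \<in> C (k + 2) (l + 1)"
    using tensor_closed[OF assms id_part_in[of 1]] by simp
  from comp_closed[OF cup_in this] show ?thesis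
    unfolding rot_eq_part_comp[OF partitions_if[OF assms]] .
qed

text \<open>Bending up is bending down conjugated by the flip, so no separate computation with a cap
  is required.\<close>

lemma rot_in':
  assumes "p \<in> C k (l + 1)"
  shows "rot k l p \<in> C (k + 1) l"
  using star_closed[OF rot_in[OF star_closed[OF assms]]] by (simp add: rot_star[symmetric])

lemma lin_id_hom: "lin_id k \<in> lin_hom C k k"
  using id_part_in by (auto simp: lin_hom_def lin_id_def)

lemma lin_comp_hom:
  assumes "\<phi> \<in> lin_hom C k l" "\<psi> \<in> lin_hom C l m"
  shows "lin_comp t k l m \<psi> \<phi> \<in> lin_hom C k m"
  unfolding lin_hom_def
proof (clarify, unfold lin_comp_def, intro sum.neutral ballI)
  fix r p q assume "r \<notin> C k m"
  then show "\<psi> q * \<phi> p * t ^ loops q p * of_bool (r = part_comp q p) = 0"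
    using assms comp_closed[of p k l q m] by (cases "p \<in> C k l \<and> q \<in> C l m") (auto simp: lin_hom_def)
qed

lemma lin_star_hom: "\<phi> \<in> lin_hom C k l \<Longrightarrow> lin_star \<phi> \<in> lin_hom C l k"
  using star_closed[of "part_star p" k l for p] by (auto simp: lin_hom_def lin_star_def)

lemma lin_rot_hom: "\<phi> \<in> lin_hom C (k + 1) l \<Longrightarrow> lin_rot k l \<phi> \<in> lin_hom C k (l + 1)"
  using rot_in[of "rot k l p" k l for p] by (auto simp: lin_hom_def lin_rot_def)

lemma lin_rot_hom': "\<phi> \<in> lin_hom C k (l + 1) \<Longrightarrow> lin_rot k l \<phi> \<in> lin_hom C (k + 1) l"
  using rot_in'[of "rot k l p" k l for p] by (auto simp: lin_hom_def lin_rot_def)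

lemma lin_tensor_hom:
  assumes "\<phi> \<in> lin_hom C k l" "\<psi> \<in> lin_hom C k' l'"
  shows "lin_tensor k l k' l' \<phi> \<psi> \<in> lin_hom C (k + k') (l + l')"
  unfolding lin_hom_def
proof (clarify, unfold lin_tensor_def, intro sum.neutral ballI)
  fix r p q assume "r \<notin> C (k + k') (l + l')"
  then show "\<phi> p * \<psi> q * of_bool (r = part_tensor k l p q) = 0"
    using assms tensor_closed[of p k l q k' l'] by (cases "p \<in> C k l \<and> q \<in> C k' l'") (auto simp: lin_hom_def)
qed

end


section \<open>The additive and idempotent completions\<close>

lemma mk_mat_eq_iff:
  "mk_mat ks ls M = mk_mat ks ls N \<longleftrightarrow> (\<forall>i<length ks. \<forall>j<length ls. M j i = N j i)"
  by (auto simp: mk_mat_def fun_eq_iff)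

lemma mk_mat_mk_mat [simp]: "mk_mat ks ls (mk_mat ks ls M) = mk_mat ks ls M"
  by (simp add: mk_mat_eq_iff) (simp add: mk_mat_def)

lemma mat_hom_eqI:
  assumes "M \<in> mat_hom C ks ls" "N \<in> mat_hom C' ks ls"
    and "\<And>i j. i < length ks \<Longrightarrow> j < length ls \<Longrightarrow> M j i = N j i"
  shows "M = N"
proof -
  have "M = mk_mat ks ls M" "N = mk_mat ks ls N" using assms by (simp_all add: mat_hom_def)
  moreover have "mk_mat ks ls M = mk_mat ks ls N" using assms(3) by (simp add: mk_mat_eq_iff)
  ultimately show ?thesis by simp
qed

lemma mat_homD: "M \<in> mat_hom C ks ls \<Longrightarrow> i < length ks \<Longrightarrow> j < length ls \<Longrightarrow> M j i \<in> lin_hom C (ks ! i) (ls ! j)"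
  by (simp add: mat_hom_def)

lemma mk_mat_hom_iff:
  "mk_mat ks ls M \<in> mat_hom C ks ls \<longleftrightarrow> (\<forall>i<length ks. \<forall>j<length ls. M j i \<in> lin_hom C (ks ! i) (ls ! j))"
  by (simp add: mat_hom_def) (simp add: mk_mat_def)

lemma mk_mat_entry [simp]: "j < length ls \<Longrightarrow> i < length ks \<Longrightarrow> mk_mat ks ls M j i = M j i"
  by (simp add: mk_mat_def)

lemma mat_comp_entry:
  "n < length ms \<Longrightarrow> i < length ks \<Longrightarrow> mat_comp t ks ls ms N M n i
    = (\<lambda>p. \<Sum>j<length ls. lin_comp t (ks ! i) (ls ! j) (ms ! n) (N n j) (M j i) p)"
  by (simp add: mat_comp_def)

lemma mat_comp_assoc:
  "mat_comp t ks ms ns P (mat_comp t ks ls ms N M) = mat_comp t ks ls ns (mat_comp t ls ms ns P N) M"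
proof -
  have "(\<Sum>n<length ms. lin_comp t (ks ! i) (ms ! n) (ns ! a) (P a n) (mat_comp t ks ls ms N M n i) p)
     = (\<Sum>j<length ls. lin_comp t (ks ! i) (ls ! j) (ns ! a) (mat_comp t ls ms ns P N a j) (M j i) p)"
    if "i < length ks" "a < length ns" for i a p
  proof -
    have "(\<Sum>n<length ms. lin_comp t (ks ! i) (ms ! n) (ns ! a) (P a n) (mat_comp t ks ls ms N M n i) p)
      = (\<Sum>n<length ms. \<Sum>j<length ls.
          lin_comp t (ks ! i) (ls ! j) (ns ! a) (lin_comp t (ls ! j) (ms ! n) (ns ! a) (P a n) (N n j)) (M j i) p)"
      using that by (simp add: mat_comp_entry lin_comp_sum_right lin_comp_assoc)
    also have "\<dots> = (\<Sum>j<length ls. \<Sum>n<length ms.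
          lin_comp t (ks ! i) (ls ! j) (ns ! a) (lin_comp t (ls ! j) (ms ! n) (ns ! a) (P a n) (N n j)) (M j i) p)"
      by (rule sum.swap)
    also have "\<dots> = (\<Sum>j<length ls. lin_comp t (ks ! i) (ls ! j) (ns ! a) (mat_comp t ls ms ns P N a j) (M j i) p)"
      using that by (simp add: mat_comp_entry lin_comp_sum_left)
    finally show ?thesis .
  qed
  then show ?thesis
    unfolding mat_comp_def[of t ks ms ns P] mat_comp_def[of t ks ls ns _ M] mk_mat_eq_iff by blast
qed

lemma mat_comp_add_left:
  "mat_comp t ks ls ms (\<lambda>j i p. N j i p + N' j i p) M
    = (\<lambda>j i p. mat_comp t ks ls ms N M j i p + mat_comp t ks ls ms N' M j i p)"
  by (intro ext) (simp add: mat_comp_def mk_mat_def lin_comp_add_left sum.distrib)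

lemma mat_comp_add_right:
  "mat_comp t ks ls ms N (\<lambda>j i p. M j i p + M' j i p)
    = (\<lambda>j i p. mat_comp t ks ls ms N M j i p + mat_comp t ks ls ms N M' j i p)"
  by (intro ext) (simp add: mat_comp_def mk_mat_def lin_comp_add_right sum.distrib)

lemma mat_comp_scl_left:
  "mat_comp t ks ls ms (\<lambda>j i p. a * N j i p) M = (\<lambda>j i p. a * mat_comp t ks ls ms N M j i p)"
  by (intro ext) (simp add: mat_comp_def mk_mat_def lin_comp_scl_left sum_distrib_left)

lemma mat_comp_scl_right:
  "mat_comp t ks ls ms N (\<lambda>j i p. a * M j i p) = (\<lambda>j i p. a * mat_comp t ks ls ms N M j i p)"
  by (intro ext) (simp add: mat_comp_def mk_mat_def lin_comp_scl_right sum_distrib_left)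

lemma mat_comp_zero_left [simp]: "mat_comp t ks ls ms (\<lambda>j i p. 0) M = (\<lambda>j i p. 0)"
  by (intro ext) (simp add: mat_comp_def mk_mat_def)

lemma mat_comp_zero_right [simp]: "mat_comp t ks ls ms N (\<lambda>j i p. 0) = (\<lambda>j i p. 0)"
  by (intro ext) (simp add: mat_comp_def mk_mat_def)

lemma lin_hom_zero: "(\<lambda>p. 0) \<in> lin_hom C k l"
  and lin_hom_add: "\<phi> \<in> lin_hom C k l \<Longrightarrow> \<psi> \<in> lin_hom C k l \<Longrightarrow> (\<lambda>p. \<phi> p + \<psi> p) \<in> lin_hom C k l"
  and lin_hom_scl: "\<phi> \<in> lin_hom C k l \<Longrightarrow> (\<lambda>p. a * \<phi> p) \<in> lin_hom C k l"
  and lin_hom_sum: "(\<And>j. j \<in> A \<Longrightarrow> f j \<in> lin_hom C k l) \<Longrightarrow> (\<lambda>p. \<Sum>j\<in>A. f j p) \<in> lin_hom C k l"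
  by (auto simp: lin_hom_def)

lemma mat_hom_zero: "(\<lambda>j i p. 0) \<in> mat_hom C ks ls"
  by (simp add: mat_hom_def lin_hom_zero mk_mat_def)

lemma mat_hom_outside: "M \<in> mat_hom C ks ls \<Longrightarrow> \<not> (j < length ls \<and> i < length ks) \<Longrightarrow> M j i = (\<lambda>p. 0)"
proof -
  assume "M \<in> mat_hom C ks ls" "\<not> (j < length ls \<and> i < length ks)"
  moreover then have "M j i = mk_mat ks ls M j i" by (simp add: mat_hom_def)
  ultimately show ?thesis by (simp add: mk_mat_def split: if_splits)
qed

lemma mat_hom_iff: "M \<in> mat_hom C ks ls \<longleftrightarrow>
  (\<forall>j i. if j < length ls \<and> i < length ks then M j i \<in> lin_hom C (ks ! i) (ls ! j) else M j i = (\<lambda>p. 0))"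
proof
  assume "M \<in> mat_hom C ks ls"
  then show "\<forall>j i. if j < length ls \<and> i < length ks then M j i \<in> lin_hom C (ks ! i) (ls ! j) else M j i = (\<lambda>p. 0)"
    using mat_hom_outside mat_homD by (metis (full_types))
next
  assume *: "\<forall>j i. if j < length ls \<and> i < length ks then M j i \<in> lin_hom C (ks ! i) (ls ! j) else M j i = (\<lambda>p. 0)"
  then have "M = mk_mat ks ls M" by (intro ext) (auto simp: mk_mat_def)
  with * show "M \<in> mat_hom C ks ls" by (simp add: mat_hom_def)
qed

lemma mat_hom_add: "M \<in> mat_hom C ks ls \<Longrightarrow> N \<in> mat_hom C ks ls \<Longrightarrow> (\<lambda>j i p. M j i p + N j i p) \<in> mat_hom C ks ls"
  by (simp add: mat_hom_iff lin_hom_add)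

lemma mat_hom_scl: "M \<in> mat_hom C ks ls \<Longrightarrow> (\<lambda>j i p. a * M j i p) \<in> mat_hom C ks ls"
  by (simp add: mat_hom_iff lin_hom_scl)

lemma mat_trace_comp: "mat_trace t ls (mat_comp t ls ks ls M N)
  = (\<Sum>j<length ls. \<Sum>i<length ks. lin_trace t (ls ! j) (lin_comp t (ls ! j) (ks ! i) (ls ! j) (M j i) (N i j)))"
  by (simp add: mat_trace_def mat_comp_entry lin_trace_sum)

lemma mat_trace_cyclic: "mat_trace t ls (mat_comp t ls ks ls M N) = mat_trace t ks (mat_comp t ks ls ks N M)"
  unfolding mat_trace_comp by (subst sum.swap) (simp only: lin_trace_cyclic)

section \<open>Identity matrices and the linear structure of the completions\<close>

context category_of_partitions
begin

lemma mat_id_hom: "mat_id ks \<in> mat_hom C ks ks"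
  unfolding mat_id_def by (simp add: mk_mat_hom_iff lin_id_hom lin_hom_zero)

lemma mat_comp_hom:
  assumes "M \<in> mat_hom C ks ls" "N \<in> mat_hom C ls ms"
  shows "mat_comp t ks ls ms N M \<in> mat_hom C ks ms"
  unfolding mat_comp_def mk_mat_hom_iff
  using assms by (auto intro!: lin_hom_sum lin_comp_hom mat_homD)

lemma mat_comp_id_left:
  assumes "M \<in> mat_hom C ks ls"
  shows "mat_comp t ks ls ls (mat_id ls) M = M"
proof (rule mat_hom_eqI[OF mat_comp_hom[OF assms mat_id_hom] assms])
  fix i j assume ij: "i < length ks" "j < length ls"
  have "mat_comp t ks ls ls (mat_id ls) M j i p = (\<Sum>n<length ls. if n = j then M j i p else 0)" for p
    unfolding mat_comp_entry[OF ij(2,1)]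
  proof (intro sum.cong refl)
    fix n assume "n \<in> {..<length ls}"
    then show "lin_comp t (ks ! i) (ls ! n) (ls ! j) (mat_id ls j n) (M n i) p = (if n = j then M j i p else 0)"
      using lin_comp_id_left[OF lin_hom_subset[OF mat_homD[OF assms ij]]] ij by (auto simp: mat_id_def)
  qed
  then show "mat_comp t ks ls ls (mat_id ls) M j i = M j i" using ij by auto
qed

lemma mat_comp_id_right:
  assumes "M \<in> mat_hom C ks ls"
  shows "mat_comp t ks ks ls M (mat_id ks) = M"
proof (rule mat_hom_eqI[OF mat_comp_hom[OF mat_id_hom assms] assms])
  fix i j assume ij: "i < length ks" "j < length ls"
  have "mat_comp t ks ks ls M (mat_id ks) j i p = (\<Sum>n<length ks. if n = i then M j i p else 0)" for p
    unfolding mat_comp_entry[OF ij(2,1)]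
  proof (intro sum.cong refl)
    fix n assume "n \<in> {..<length ks}"
    then show "lin_comp t (ks ! i) (ks ! n) (ls ! j) (M j n) (mat_id ks n i) p = (if n = i then M j i p else 0)"
      using lin_comp_id_right[OF lin_hom_subset[OF mat_homD[OF assms ij]]] ij by (auto simp: mat_id_def)
  qed
  then show "mat_comp t ks ks ls M (mat_id ks) j i = M j i" using ij by auto
qed

lemma Rep_ob_iff: "X \<in> ob (Rep C t) \<longleftrightarrow>
  snd X \<in> mat_hom C (fst X) (fst X) \<and> mat_comp t (fst X) (fst X) (fst X) (snd X) (snd X) = snd X"
  by (cases X) (simp add: Rep_def Let_def)

lemma Rep_hom_iff: "f \<in> hom (Rep C t) X Y \<longleftrightarrow> (\<exists>M. f = (X, Y, M) \<and> X \<in> ob (Rep C t) \<and> Y \<in> ob (Rep C t) \<and>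
    M \<in> mat_hom C (fst X) (fst Y) \<and> mat_comp t (fst X) (fst X) (fst Y) M (snd X) = M \<and>
    mat_comp t (fst X) (fst Y) (fst Y) (snd Y) M = M)"
  by (cases X; cases Y) (auto simp: Rep_def Let_def)

lemma Rep_simps:
  "ide (Rep C t) X = (X, X, snd X)"
  "cmp (Rep C t) (Y', Z, N) (X, Y, M) = (X, Z, mat_comp t (fst X) (fst Y) (fst Z) N M)"
  "zer (Rep C t) X Y = (X, Y, \<lambda>j i p. 0)"
  "add (Rep C t) (X', Y', N) (X, Y, M) = (X, Y, \<lambda>j i p. N j i p + M j i p)"
  "scl (Rep C t) a (X, Y, M) = (X, Y, \<lambda>j i p. a * M j i p)"
  "unt (Rep C t) = sum_ob [0]"
  "tob (Rep C t) X Y = (list_tensor (fst X) (fst Y), mat_tensor (fst X) (fst X) (fst Y) (fst Y) (snd X) (snd Y))"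
  "tmor (Rep C t) (X, Y, M) (X', Y', N)
    = (tob (Rep C t) X X', tob (Rep C t) Y Y', mat_tensor (fst X) (fst Y) (fst X') (fst Y') M N)"
  by (simp_all add: Rep_def Let_def sum_ob_def split: prod.splits)

lemma linear_category_Rep: "linear_category (Rep C t)"
proof
  fix f X Y assume "f \<in> hom (Rep C t) X Y"
  then show "\<exists>g\<in>hom (Rep C t) X Y. f \<oplus>\<^bsub>Rep C t\<^esub> g = zer (Rep C t) X Y"
    by (intro bexI[of _ "scl (Rep C t) (-1) f"])
      (auto simp: Rep_hom_iff Rep_simps mat_comp_scl_left[of _ _ _ _ "-1", simplified]
        mat_comp_scl_right[of _ _ _ _ _ "-1", simplified] mat_hom_scl[of _ _ _ _ "-1", simplified])
next
  fix f g X Y Z assume "f \<in> hom (Rep C t) X Y" "g \<in> hom (Rep C t) Y Z"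
  then show "g \<cdot>\<^bsub>Rep C t\<^esub> f \<in> hom (Rep C t) X Z"
    by (auto simp: Rep_hom_iff Rep_simps mat_comp_hom mat_comp_assoc)
      (simp_all add: mat_comp_assoc[symmetric])
qed (auto simp: Rep_hom_iff Rep_ob_iff Rep_simps mat_comp_assoc mat_comp_add_left mat_comp_add_right
      mat_comp_scl_left mat_comp_scl_right mat_hom_add mat_hom_scl mat_hom_zero algebra_simps)

end

section \<open>Quotients by the kernel of a functor\<close>

context linear_category
begin

text \<open>Cancellation in the additive group. Absorption laws for zero morphisms follow, since an
  additive operation applied to zero gives such an \<open>x\<close>.\<close>

lemma idempotent_zer: "x \<in> hom A X Y \<Longrightarrow> x \<oplus> x = x \<Longrightarrow> x = zer A X Y"
  by (metis add_assoc add_inverse add_zer)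

lemma scl_zero:
  assumes "f \<in> hom A X Y"
  shows "0 \<odot> f = zer A X Y"
  using idempotent_zer[OF scl_hom[OF assms, of 0]] scl_add_left[OF assms, of 0 0] by simp

lemma add_uminus: "f \<in> hom A X Y \<Longrightarrow> f \<oplus> (-1) \<odot> f = zer A X Y"
  using scl_add_left[of f X Y 1 "-1"] scl_zero[of f X Y] by (simp add: scl_one)

lemma zer_add: "f \<in> hom A X Y \<Longrightarrow> zer A X Y \<oplus> f = f"
  using add_commute add_zer hom_ob zer_hom by metis

lemma cmp_zer_right:
  assumes "g \<in> hom A Y Z" "X \<in> ob A"
  shows "g \<cdot> zer A X Y = zer A X Z"
proof -
  have z: "zer A X Y \<in> hom A X Y" using assms hom_ob zer_hom by metis
  show ?thesis
    using idempotent_zer[OF cmp_hom[OF z assms(1)]] cmp_add_right[OF z z assms(1)] add_zer[OF z] by simp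
qed

lemma cmp_zer_left:
  assumes "f \<in> hom A X Y" "Z \<in> ob A"
  shows "zer A Y Z \<cdot> f = zer A X Z"
proof -
  have z: "zer A Y Z \<in> hom A Y Z" using assms hom_ob zer_hom by metis
  show ?thesis
    using idempotent_zer[OF cmp_hom[OF assms(1) z]] cmp_add_left[OF assms(1) z z] add_zer[OF z] by simp
qed

end

lemma (in monoidal_linear_category) tmor_zer_left:
  assumes "g \<in> hom A X' Y'" "X \<in> ob A" "Y \<in> ob A"
  shows "zer A X Y \<boxtimes> g = zer A (X \<otimes> X') (Y \<otimes> Y')"
proof -
  have z: "zer A X Y \<in> hom A X Y" using assms zer_hom by metis
  show ?thesis
    using idempotent_zer[OF tmor_hom[OF z assms(1)]] tmor_add_left[OF z z assms(1)] add_zer[OF z] by simp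
qed

text \<open>Captures a category on the objects of \<open>A\<close> whose structure is computed on
  representatives in \<open>A\<close>. The quotient and the image are both of this kind, so the
  axioms are transported only once. The condition \<open>im_disjoint\<close> reflects the tagging of
  morphisms with source and target.\<close>

locale linear_category_image = linear_category A
  for A :: "('o, 'm, 'z) lin_cat_scheme" (structure) +
  fixes Q :: "('o, 'n, 'y) lin_cat_scheme" and c :: "'o \<Rightarrow> 'o \<Rightarrow> 'm \<Rightarrow> 'n"
  assumes im_ob: "ob Q = ob A"
    and im_hom: "hom Q X Y = c X Y ` hom A X Y"
    and im_disjoint: "c X Y f = c X' Y' f' \<Longrightarrow> X = X' \<and> Y = Y'"
    and im_ide: "X \<in> ob A \<Longrightarrow> ide Q X = c X X (ide A X)"
    and im_cmp: "f \<in> hom A X Y \<Longrightarrow> g \<in> hom A Y Z \<Longrightarrow> cmp Q (c Y Z g) (c X Y f) = c X Z (g \<cdot> f)"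
    and im_zer: "X \<in> ob A \<Longrightarrow> Y \<in> ob A \<Longrightarrow> zer Q X Y = c X Y (zer A X Y)"
    and im_add: "f \<in> hom A X Y \<Longrightarrow> g \<in> hom A X Y \<Longrightarrow> add Q (c X Y f) (c X Y g) = c X Y (f \<oplus> g)"
    and im_scl: "f \<in> hom A X Y \<Longrightarrow> scl Q a (c X Y f) = c X Y (a \<odot> f)"
begin

lemma im_linear_category: "linear_category Q"
proof
  fix f X Y X' Y'
  assume "f \<in> hom Q X Y"
  then obtain f' where f: "f' \<in> hom A X Y" "f = c X Y f'" by (auto simp: im_hom)
  note X = hom_ob[OF f(1), THEN conjunct1] and Y = hom_ob[OF f(1), THEN conjunct2]
  note ids = ide_hom[OF X] ide_hom[OF Y] zer_hom[OF X Y]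
  show "X \<in> ob Q \<and> Y \<in> ob Q" using X Y by (simp add: im_ob)
  show "f \<in> hom Q X' Y' \<Longrightarrow> X = X' \<and> Y = Y'" using f im_disjoint by (force simp: im_hom)
  show "cmp Q (ide Q Y) f = f" using f X Y ids by (simp add: im_ide im_cmp ide_left)
  show "cmp Q f (ide Q X) = f" using f X Y ids by (simp add: im_ide im_cmp ide_right)
  show "add Q f (zer Q X Y) = f" using f X Y ids by (simp add: im_zer im_add add_zer)
  obtain g where "g \<in> hom A X Y" "f' \<oplus> g = zer A X Y" using add_inverse[OF f(1)] by blast
  then show "\<exists>g\<in>hom Q X Y. add Q f g = zer Q X Y"
    using f X Y by (intro bexI[of _ "c X Y g"]) (auto simp: im_add im_zer im_hom)
  show "scl Q 1 f = f" using f by (simp add: im_scl scl_one)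
  fix a b
  show "scl Q a f \<in> hom Q X Y" using f by (simp add: im_scl im_hom scl_hom)
  show "scl Q a (scl Q b f) = scl Q (a * b) f" using f by (simp add: im_scl scl_scl scl_hom)
  show "scl Q (a + b) f = add Q (scl Q a f) (scl Q b f)"
    using f by (simp add: im_scl im_add scl_add_left scl_hom)
next
  fix f g X Y assume "f \<in> hom Q X Y" "g \<in> hom Q X Y"
  then obtain f' g' where f: "f' \<in> hom A X Y" "f = c X Y f'" and g: "g' \<in> hom A X Y" "g = c X Y g'"
    by (auto simp: im_hom)
  show "add Q f g \<in> hom Q X Y" using f g by (simp add: im_hom im_add add_hom)
  show "add Q f g = add Q g f" using f g by (simp add: im_add add_commute)
  show "scl Q a (add Q f g) = add Q (scl Q a f) (scl Q a g)" for a
    using f g by (simp add: im_add im_scl add_hom scl_hom scl_add_right)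
  fix h assume "h \<in> hom Q X Y"
  then obtain h' where h: "h' \<in> hom A X Y" "h = c X Y h'" by (auto simp: im_hom)
  show "add Q (add Q f g) h = add Q f (add Q g h)" using f g h by (simp add: im_add add_hom add_assoc)
next
  fix f g X Y Z assume "f \<in> hom Q X Y" "g \<in> hom Q Y Z"
  then obtain f' g' where f: "f' \<in> hom A X Y" "f = c X Y f'" and g: "g' \<in> hom A Y Z" "g = c Y Z g'"
    by (auto simp: im_hom)
  note fg = cmp_hom[OF f(1) g(1)]
  show "cmp Q g f \<in> hom Q X Z" using f g fg by (simp add: im_hom im_cmp)
  fix a
  show "cmp Q (scl Q a g) f = scl Q a (cmp Q g f)"
    using f g fg by (simp add: im_cmp im_scl scl_hom cmp_scl_left)
  show "cmp Q g (scl Q a f) = scl Q a (cmp Q g f)"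
    using f g fg by (simp add: im_cmp im_scl scl_hom cmp_scl_right)
next
  fix f g h W X Y Z assume "f \<in> hom Q W X" "g \<in> hom Q X Y" "h \<in> hom Q Y Z"
  then obtain f' g' h' where f: "f' \<in> hom A W X" "f = c W X f'" and g: "g' \<in> hom A X Y" "g = c X Y g'"
      and h: "h' \<in> hom A Y Z" "h = c Y Z h'"
    by (auto simp: im_hom)
  show "cmp Q (cmp Q h g) f = cmp Q h (cmp Q g f)"
    using f g h cmp_hom[OF f(1) g(1)] cmp_hom[OF g(1) h(1)] by (simp add: im_cmp cmp_assoc)
next
  fix f g h X Y Z assume "f \<in> hom Q X Y" "g \<in> hom Q Y Z" "h \<in> hom Q Y Z"
  then obtain f' g' h' where f: "f' \<in> hom A X Y" "f = c X Y f'" and g: "g' \<in> hom A Y Z" "g = c Y Z g'"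
      and h: "h' \<in> hom A Y Z" "h = c Y Z h'"
    by (auto simp: im_hom)
  show "cmp Q (add Q g h) f = add Q (cmp Q g f) (cmp Q h f)"
    using f g h cmp_hom[OF f(1) g(1)] cmp_hom[OF f(1) h(1)] add_hom[OF g(1) h(1)]
    by (simp add: im_cmp im_add cmp_add_left)
next
  fix f g h X Y Z assume "f \<in> hom Q X Y" "g \<in> hom Q X Y" "h \<in> hom Q Y Z"
  then obtain f' g' h' where f: "f' \<in> hom A X Y" "f = c X Y f'" and g: "g' \<in> hom A X Y" "g = c X Y g'"
      and h: "h' \<in> hom A Y Z" "h = c Y Z h'"
    by (auto simp: im_hom)
  show "cmp Q h (add Q f g) = add Q (cmp Q h f) (cmp Q h g)"
    using f g h cmp_hom[OF f(1) h(1)] cmp_hom[OF g(1) h(1)] add_hom[OF f(1) g(1)]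
    by (simp add: im_cmp im_add cmp_add_right)
next
  fix X assume X: "X \<in> ob Q"
  then show "ide Q X \<in> hom Q X X" by (simp add: im_ob im_hom im_ide ide_hom)
  fix Y assume "Y \<in> ob Q"
  with X show "zer Q X Y \<in> hom Q X Y" by (simp add: im_ob im_hom im_zer zer_hom)
qed

text \<open>All operations on both sides are evaluated on common representatives in
  \<open>A\<close>, so compatibility of \<open>H\<close> with them already gives
  functoriality.\<close>

lemma im_linear_functor:
  assumes "linear_category_image A Q' c'"
    and H: "\<And>X Y f. f \<in> hom A X Y \<Longrightarrow> H (c X Y f) = c' X Y f"
  shows "linear_functor Q Q' (\<lambda>X. X) H"
proof -
  interpret Q': linear_category_image A Q' c' by fact
  show ?thesis
  proof
    fix X assume "X \<in> ob Q"
    then show "X \<in> ob Q'" "H (ide Q X) = ide Q' X"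
      by (simp_all add: im_ob Q'.im_ob im_ide Q'.im_ide H ide_hom)
  next
    fix f X Y assume "f \<in> hom Q X Y"
    then show "H f \<in> hom Q' X Y" "H (scl Q a f) = scl Q' a (H f)" for a
      by (auto simp: im_hom Q'.im_hom H im_scl Q'.im_scl scl_hom)
  next
    fix f g X Y Z assume "f \<in> hom Q X Y" "g \<in> hom Q Y Z"
    then obtain f' g' where f: "f' \<in> hom A X Y" "f = c X Y f'" and g: "g' \<in> hom A Y Z" "g = c Y Z g'"
      by (auto simp: im_hom)
    then show "H (cmp Q g f) = cmp Q' (H g) (H f)"
      using cmp_hom[OF f(1) g(1)] by (simp add: im_cmp Q'.im_cmp H)
  next
    fix f g X Y assume "f \<in> hom Q X Y" "g \<in> hom Q X Y"
    then show "H (add Q f g) = add Q' (H f) (H g)"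
      by (auto simp: im_hom im_add Q'.im_add H add_hom)
  qed
qed

end

lemma (in linear_category) natural_isomorphism_identity:
  assumes "\<And>X Y f. f \<in> hom A X Y \<Longrightarrow> Gm f = Fm f \<and> Fm f \<in> hom A X Y"
  shows "natural_isomorphism A A (\<lambda>X. X) Fm (\<lambda>X. X) Gm (ide A)"
  unfolding natural_isomorphism_def isomorphism_def inverse_morphisms_def
proof (intro conjI ballI)
  fix X assume "X \<in> ob A"
  then show "\<exists>g. ide A X \<in> hom A X X \<and> g \<in> hom A X X \<and> g \<cdot> ide A X = ide A X \<and> ide A X \<cdot> g = ide A X"
    using ide_hom ide_left by metis
next
  fix X Y f assume "f \<in> hom A X Y"
  then show "Gm f \<cdot> ide A X = ide A Y \<cdot> Fm f" using assms ide_left ide_right by metis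
qed

text \<open>Both functors fix the objects and are mutually inverse on morphisms, so identity
  morphisms serve as the natural isomorphisms.\<close>

lemma linear_equivalence_images:
  assumes Q: "linear_category_image A Q c" and Q': "linear_category_image A Q' c'"
    and H: "\<And>X Y f. f \<in> hom A X Y \<Longrightarrow> H (c X Y f) = c' X Y f"
    and H': "\<And>X Y f. f \<in> hom A X Y \<Longrightarrow> H' (c' X Y f) = c X Y f"
  shows "linear_equivalence Q Q' (\<lambda>X. X) H"
proof -
  interpret Q: linear_category_image A Q c by fact
  interpret Q': linear_category_image A Q' c' by fact
  interpret LQ: linear_category Q by (rule Q.im_linear_category)
  interpret LQ': linear_category Q' by (rule Q'.im_linear_category)
  have "natural_isomorphism Q Q (\<lambda>X. X) (\<lambda>f. f) ((\<lambda>X. X) \<circ> (\<lambda>X. X)) (H' \<circ> H) (ide Q)"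
    unfolding comp_def by (rule LQ.natural_isomorphism_identity) (auto simp: Q.im_hom H H')
  moreover have "natural_isomorphism Q' Q' ((\<lambda>X. X) \<circ> (\<lambda>X. X)) (H \<circ> H') (\<lambda>X. X) (\<lambda>f. f) (ide Q')"
    unfolding comp_def by (rule LQ'.natural_isomorphism_identity) (auto simp: Q'.im_hom H H')
  ultimately show ?thesis
    unfolding linear_equivalence_def
    using LQ.linear_category_axioms LQ'.linear_category_axioms Q.im_linear_functor[OF Q' H]
      Q'.im_linear_functor[OF Q H'] by blast
qed

lemma functor_zer:
  assumes "linear_category A" "linear_category B" "linear_functor A B Fo Fm" "X \<in> ob A" "Y \<in> ob A"
  shows "Fm (zer A X Y) = zer B (Fo X) (Fo Y)"
proof -
  interpret A: linear_category A by fact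
  interpret B: linear_category B by fact
  interpret linear_functor A B Fo Fm by fact
  have z: "zer A X Y \<in> hom A X Y" using assms A.zer_hom by blast
  show ?thesis
    using fun_scl[OF z, of 0] by (simp add: A.scl_zero[OF z] B.scl_zero[OF fun_hom[OF z]])
qed

text \<open>Two morphisms differ by an element of the kernel iff they have the same image. A coset
  is thus a fibre of \<open>Fm\<close>, which avoids a separate treatment of ideals.\<close>

lemma coset_kernel:
  assumes "linear_category A" "linear_category B" "linear_functor A B Fo Fm"
    and N: "N X Y = {f \<in> hom A X Y. Fm f = zer B (Fo X) (Fo Y)}"
    and f: "f \<in> hom A X Y"
  shows "coset A N X Y f = {g \<in> hom A X Y. Fm g = Fm f}"
proof -
  interpret A: linear_category A by fact
  interpret B: linear_category B by fact
  interpret linear_functor A B Fo Fm by fact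
  show ?thesis
  proof (intro equalityI subsetI)
    fix g assume "g \<in> coset A N X Y f"
    then obtain n where "n \<in> hom A X Y" "Fm n = zer B (Fo X) (Fo Y)" "g = add A f n"
      by (auto simp: coset_def N)
    then show "g \<in> {g \<in> hom A X Y. Fm g = Fm f}"
      using f B.add_zer[OF fun_hom[OF f]] by (simp add: A.add_hom fun_add)
  next
    fix g assume "g \<in> {g \<in> hom A X Y. Fm g = Fm f}"
    then have g: "g \<in> hom A X Y" "Fm g = Fm f" by simp_all
    \<comment> \<open>The difference of \<open>g\<close> and \<open>f\<close>.\<close>
    let ?n = "add A (scl A (-1) f) g"
    have mf: "scl A (-1) f \<in> hom A X Y" using f by (rule A.scl_hom)
    have n: "?n \<in> hom A X Y" using mf g by (simp add: A.add_hom)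
    have "Fm ?n = add B (scl B (-1) (Fm f)) (Fm f)" using mf g f by (simp add: fun_add fun_scl)
    also have "\<dots> = zer B (Fo X) (Fo Y)"
      using B.add_uminus[OF fun_hom[OF f]] B.add_commute[OF fun_hom[OF f] B.scl_hom[OF fun_hom[OF f]]] by simp
    finally have "?n \<in> N X Y" using n by (simp add: N)
    moreover have "add A f ?n = g"
      using A.add_assoc[OF f mf g(1)] A.add_uminus[OF f] A.zer_add[OF g(1)] by simp
    ultimately show "g \<in> coset A N X Y f" by (force simp: coset_def)
  qed
qed

text \<open>The unions in the definition of the quotient are taken over equal sets: cosets are
  fibres, and the functor respects each operation, so the result is independent of
  representatives.\<close>

lemma linear_category_image_quotient:
  assumes A: "linear_category A" and B: "linear_category B" and F: "linear_functor A B Fo Fm"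
    and N: "\<And>X Y. N X Y = {f \<in> hom A X Y. Fm f = zer B (Fo X) (Fo Y)}"
  shows "linear_category_image A (quotient_cat A N) (\<lambda>X Y f. (X, Y, coset A N X Y f))"
proof -
  interpret A: linear_category A by fact
  interpret linear_functor A B Fo Fm by fact
  note coset = coset_kernel[OF A B F N]
  show ?thesis
  proof
    fix X Y Z f g assume fg: "f \<in> hom A X Y" "g \<in> hom A Y Z"
    have "(\<Union>g'\<in>coset A N Y Z g. \<Union>f'\<in>coset A N X Y f. coset A N X Z (cmp A g' f')) = coset A N X Z (cmp A g f)"
    proof -
      have "coset A N X Z (cmp A g' f') = coset A N X Z (cmp A g f)"
        if "g' \<in> coset A N Y Z g" "f' \<in> coset A N X Y f" for f' g'
        using that fg A.cmp_hom[of f X Y g Z] A.cmp_hom[of f' X Y g' Z] fun_cmp[of f X Y g Z] fun_cmp[of f' X Y g' Z]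
        by (simp add: coset)
      moreover have "g \<in> coset A N Y Z g" "f \<in> coset A N X Y f" using fg by (simp_all add: coset)
      ultimately show ?thesis by blast
    qed
    then show "cmp (quotient_cat A N) (Y, Z, coset A N Y Z g) (X, Y, coset A N X Y f) = (X, Z, coset A N X Z (cmp A g f))"
      by (simp add: quotient_cat_def)
  next
    fix X Y f g assume fg: "f \<in> hom A X Y" "g \<in> hom A X Y"
    have "(\<Union>f'\<in>coset A N X Y f. \<Union>g'\<in>coset A N X Y g. coset A N X Y (add A f' g')) = coset A N X Y (add A f g)"
    proof -
      have "coset A N X Y (add A f' g') = coset A N X Y (add A f g)"
        if "g' \<in> coset A N X Y g" "f' \<in> coset A N X Y f" for f' g'
        using that fg A.add_hom[of f X Y g] A.add_hom[of f' X Y g'] fun_add[of f X Y g] fun_add[of f' X Y g']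
        by (simp add: coset)
      moreover have "g \<in> coset A N X Y g" "f \<in> coset A N X Y f" using fg by (simp_all add: coset)
      ultimately show ?thesis by blast
    qed
    then show "add (quotient_cat A N) (X, Y, coset A N X Y f) (X, Y, coset A N X Y g) = (X, Y, coset A N X Y (add A f g))"
      by (simp add: quotient_cat_def)
  next
    fix X Y f a assume f: "f \<in> hom A X Y"
    have "(\<Union>f'\<in>coset A N X Y f. coset A N X Y (scl A a f')) = coset A N X Y (scl A a f)"
    proof -
      have "coset A N X Y (scl A a f') = coset A N X Y (scl A a f)" if "f' \<in> coset A N X Y f" for f'
        using that f A.scl_hom[of f X Y a] A.scl_hom[of f' X Y a] fun_scl[of f X Y a] fun_scl[of f' X Y a]
        by (simp add: coset)
      moreover have "f \<in> coset A N X Y f" using f by (simp add: coset)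
      ultimately show ?thesis by blast
    qed
    then show "scl (quotient_cat A N) a (X, Y, coset A N X Y f) = (X, Y, coset A N X Y (scl A a f))"
      by (simp add: quotient_cat_def)
  qed (auto simp: quotient_cat_def)
qed

lemma linear_category_image_image_cat:
  assumes A: "linear_category A" and B: "linear_category B" and F: "linear_functor A B Fo Fm"
  shows "linear_category_image A (image_cat A B Fo Fm) (\<lambda>X Y f. (X, Y, Fm f))"
proof -
  interpret A: linear_category A by fact
  interpret linear_functor A B Fo Fm by fact
  show ?thesis
  proof
    show "hom (image_cat A B Fo Fm) X Y = (\<lambda>f. (X, Y, Fm f)) ` hom A X Y" for X Y
      by (auto simp: image_cat_def)
  qed (auto simp: image_cat_def fun_ide fun_cmp fun_add fun_scl functor_zer[OF A B F])
qed

lemma kernel_quotient_equivalence: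
  assumes A: "linear_category A" and B: "linear_category B" and F: "linear_functor A B Fo Fm"
    and N: "\<And>X Y. N X Y = {f \<in> hom A X Y. Fm f = zer B (Fo X) (Fo Y)}"
  shows "\<exists>K. (\<forall>X\<in>ob A. \<forall>Y\<in>ob A. \<forall>f\<in>hom A X Y. K (X, Y, coset A N X Y f) = (X, Y, Fm f))
    \<and> linear_equivalence (quotient_cat A N) (image_cat A B Fo Fm) (\<lambda>X. X) K"
proof -
  \<comment> \<open>Any representative of a coset will do, as \<open>Fm\<close> is constant on it.
    The inverse \<open>K'\<close> sends a morphism of the image to its fibre, and the tags single
    out the right hom-set.\<close>
  define K where "K = (\<lambda>(X :: 'a, Y :: 'a, c). (X, Y, Fm (SOME f. f \<in> c)))"
  define K' where "K' = (\<lambda>(X, Y, h). (X, Y, {f \<in> hom A X Y. Fm f = h}))"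
  note coset = coset_kernel[OF A B F N]
  have K: "K (X, Y, coset A N X Y f) = (X, Y, Fm f)" if "f \<in> hom A X Y" for X Y f
  proof -
    have "f \<in> coset A N X Y f" using that by (simp add: coset)
    then have "(SOME f'. f' \<in> coset A N X Y f) \<in> coset A N X Y f" by (rule someI)
    then show ?thesis using that by (simp add: coset K_def)
  qed
  moreover have "K' (X, Y, Fm f) = (X, Y, coset A N X Y f)" if "f \<in> hom A X Y" for X Y f
    using that by (simp add: K'_def coset)
  ultimately have "linear_equivalence (quotient_cat A N) (image_cat A B Fo Fm) (\<lambda>X. X) K"
    using linear_equivalence_images[OF linear_category_image_quotient[OF A B F N]
        linear_category_image_image_cat[OF A B F], of K K'] by blast
  with K show ?thesis by blast
qed

section \<open>Morphisms between the objects \<open>[k]\<close>\<close>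

definition single :: "lincomb \<Rightarrow> lmatrix" where
  "single \<phi> = (\<lambda>j i. if j = 0 \<and> i = 0 then \<phi> else (\<lambda>p. 0))"

lemma mk_mat_single: "mk_mat [k] [l] M = single (M 0 0)"
  by (intro ext) (simp add: mk_mat_def single_def)

lemma single_00 [simp]: "single \<phi> 0 0 = \<phi>"
  by (simp add: single_def)

lemma single_hom_iff: "single \<phi> \<in> mat_hom C [k] [l] \<longleftrightarrow> \<phi> \<in> lin_hom C k l"
  by (auto simp: mat_hom_iff single_def)

lemma mat_id_single: "mat_id [k] = single (lin_id k)"
  by (simp add: mat_id_def mk_mat_single)

lemma mat_comp_single: "mat_comp t [k] [l] [m] (single \<psi>) (single \<phi>) = single (lin_comp t k l m \<psi> \<phi>)"
  by (simp add: mat_comp_def mk_mat_single)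

lemma list_tensor_single [simp]: "list_tensor [k] [k'] = [k + k']"
  by (simp add: list_tensor_def)

lemma mat_tensor_single: "mat_tensor [k] [l] [k'] [l'] (single \<phi>) (single \<psi>) = single (lin_tensor k l k' l' \<phi> \<psi>)"
  by (simp add: mat_tensor_def mk_mat_single)

lemma mat_star_single: "mat_star (single \<phi>) = single (lin_star \<phi>)"
  by (intro ext) (simp add: mat_star_def single_def lin_star_def)

lemma part_tensor_id: "part_tensor k k (id_part k) (id_part l) = id_part (k + l)"
proof -
  have eq: "{1..k + l} = {1..k} \<union> (\<lambda>i. k + i) ` {1..l}"
  proof (rule set_eqI)
    fix x
    show "x \<in> {1..k + l} \<longleftrightarrow> x \<in> {1..k} \<union> (\<lambda>i. k + i) ` {1..l}"
      by (cases "x \<le> k") (auto intro!: image_eqI[of _ _ "x - k"])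
  qed
  show ?thesis unfolding part_tensor_def id_part_def eq image_Un image_image by simp
qed

lemma lin_tensor_id: "lin_tensor k k l l (lin_id k) (lin_id l) = lin_id (k + l)"
proof
  fix r
  have "lin_tensor k k l l (lin_id k) (lin_id l) r = (\<Sum>p\<in>partitions k k. if p = id_part k
      then \<Sum>q\<in>partitions l l. if q = id_part l then of_bool (r = part_tensor k k p q) else 0 else 0)"
    unfolding lin_tensor_def lin_id_def by (intro sum.cong refl) (auto intro!: sum.cong)
  then show "lin_tensor k k l l (lin_id k) (lin_id l) r = lin_id (k + l) r"
    by (simp add: finite_partitions id_part_in_partitions part_tensor_id lin_id_def)
qed

section \<open>Embedding of the objects \<open>[k]\<close> and matrix units\<close>

definition sing :: "nat \<Rightarrow> nat \<Rightarrow> lincomb \<Rightarrow> rep_mor" where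
  "sing k l \<phi> = (sum_ob [k], sum_ob [l], single \<phi>)"

text \<open>Matrix units, with \<open>i\<close> the source summand and \<open>j\<close> the target
  summand. For \<open>lin_id\<close> and a one-element list on one side they are the inclusions and
  projections of the direct sum.\<close>

definition entry_mat :: "nat list \<Rightarrow> nat list \<Rightarrow> nat \<Rightarrow> nat \<Rightarrow> lincomb \<Rightarrow> lmatrix" where
  "entry_mat ks ls i j \<phi> = mk_mat ks ls (\<lambda>j' i'. if j' = j \<and> i' = i then \<phi> else (\<lambda>p. 0))"

lemma entry_mat_hom:
  "\<phi> \<in> lin_hom C (ks ! i) (ls ! j) \<Longrightarrow> entry_mat ks ls i j \<phi> \<in> mat_hom C ks ls"
  by (simp add: entry_mat_def mk_mat_hom_iff lin_hom_zero)

lemma mat_comp_entry_mat: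
  assumes "j < length ls"
  shows "mat_comp t ks ls ms (entry_mat ls ms j n \<psi>) (entry_mat ks ls i j \<phi>)
    = entry_mat ks ms i n (lin_comp t (ks ! i) (ls ! j) (ms ! n) \<psi> \<phi>)"
proof -
  have "(\<Sum>j'<length ls. lin_comp t (ks ! i') (ls ! j') (ms ! n')
        (entry_mat ls ms j n \<psi> n' j') (entry_mat ks ls i j \<phi> j' i') p)
      = (if n' = n \<and> i' = i then lin_comp t (ks ! i) (ls ! j) (ms ! n) \<psi> \<phi> p else 0)"
    if "i' < length ks" "n' < length ms" for i' n' p
  proof -
    have "(\<Sum>j'<length ls. lin_comp t (ks ! i') (ls ! j') (ms ! n')
        (entry_mat ls ms j n \<psi> n' j') (entry_mat ks ls i j \<phi> j' i') p)
      = (\<Sum>j'<length ls. if j' = j then (if n' = n \<and> i' = i then lin_comp t (ks ! i) (ls ! j) (ms ! n) \<psi> \<phi> p else 0) else 0)"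
      using that by (intro sum.cong refl) (auto simp: entry_mat_def)
    then show ?thesis using assms by simp
  qed
  then show ?thesis
    unfolding mat_comp_def entry_mat_def[of ks ms] mk_mat_eq_iff by (auto simp: fun_eq_iff)
qed

lemma entry_mat_single: "entry_mat [k] [l] 0 0 \<phi> = single \<phi>"
  by (simp add: entry_mat_def mk_mat_single)

text \<open>Project to a summand, apply \<open>\<phi>\<close>, include again. A matrix with one
  non-zero entry therefore lies in every ideal containing that entry.\<close>

lemma entry_mat_factor:
  assumes "\<phi> \<in> lin_hom partitions (ks ! i) (ls ! j)"
  shows "mat_comp t ks [ls ! j] ls (entry_mat [ls ! j] ls 0 j (lin_id (ls ! j)))
      (mat_comp t ks [ks ! i] [ls ! j] (single \<phi>) (entry_mat ks [ks ! i] i 0 (lin_id (ks ! i))))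
    = entry_mat ks ls i j \<phi>"
  unfolding entry_mat_single[of "ks ! i" "ls ! j", symmetric]
  by (simp add: mat_comp_entry_mat lin_comp_id_left lin_comp_id_right assms)

text \<open>The opposite direction: an entry is recovered from the matrix by an inclusion and a
  projection.\<close>

lemma single_entry_factor:
  assumes "M \<in> mat_hom partitions ks ls" "i < length ks" "j < length ls"
  shows "mat_comp t [ks ! i] ls [ls ! j] (entry_mat ls [ls ! j] j 0 (lin_id (ls ! j)))
      (mat_comp t [ks ! i] ks ls M (entry_mat [ks ! i] ks 0 i (lin_id (ks ! i))))
    = single (M j i)"
proof -
  note Mji = mat_homD[OF assms]
  have 1: "mat_comp t [ks ! i] ks ls M (entry_mat [ks ! i] ks 0 i (lin_id (ks ! i))) j' 0 = M j' i"
    if j': "j' < length ls" for j'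
  proof
    fix p
    have "lin_comp t (ks ! i) (ks ! i') (ls ! j') (M j' i') (entry_mat [ks ! i] ks 0 i (lin_id (ks ! i)) i' 0) p
        = (if i' = i then M j' i p else 0)" if "i' < length ks" for i'
      using that assms(2) lin_comp_id_right[OF mat_homD[OF assms(1,2) j']] by (simp add: entry_mat_def)
    then
    have "mat_comp t [ks ! i] ks ls M (entry_mat [ks ! i] ks 0 i (lin_id (ks ! i))) j' 0 p
      = (\<Sum>i'<length ks. if i' = i then M j' i p else 0)"
      using j' by (simp add: mat_comp_entry)
    then show "mat_comp t [ks ! i] ks ls M (entry_mat [ks ! i] ks 0 i (lin_id (ks ! i))) j' 0 p = M j' i p"
      using assms(2) by simp
  qed
  have "(\<Sum>j'<length ls. lin_comp t (ks ! i) (ls ! j') (ls ! j) (entry_mat ls [ls ! j] j 0 (lin_id (ls ! j)) 0 j')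
      (mat_comp t [ks ! i] ks ls M (entry_mat [ks ! i] ks 0 i (lin_id (ks ! i))) j' 0) p)
    = (\<Sum>j'<length ls. if j' = j then M j i p else 0)" for p
  proof (intro sum.cong refl)
    fix j' assume "j' \<in> {..<length ls}"
    then have j': "j' < length ls" by simp
    show "lin_comp t (ks ! i) (ls ! j') (ls ! j) (entry_mat ls [ls ! j] j 0 (lin_id (ls ! j)) 0 j')
      (mat_comp t [ks ! i] ks ls M (entry_mat [ks ! i] ks 0 i (lin_id (ks ! i))) j' 0) p
      = (if j' = j then M j i p else 0)"
      unfolding 1[OF j'] using j' lin_comp_id_left[OF Mji] by (simp add: entry_mat_def)
  qed
  then show ?thesis
    using assms(3) unfolding mat_comp_def[of t "[ks ! i]" ls] mk_mat_single by simp
qed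

lemma sum_entry_mat:
  assumes "M \<in> mat_hom C ks ls"
  shows "(\<lambda>j' i' p. \<Sum>(i, j)\<in>{..<length ks} \<times> {..<length ls}. entry_mat ks ls i j (M j i) j' i' p) = M"
proof (intro ext)
  fix j' i' p
  have "(\<Sum>(i, j)\<in>{..<length ks} \<times> {..<length ls}. entry_mat ks ls i j (M j i) j' i' p)
    = (\<Sum>x\<in>{..<length ks} \<times> {..<length ls}. if x = (i', j') then M j' i' p else 0)"
    by (intro sum.cong refl) (auto simp: entry_mat_def mk_mat_def split: if_splits)
  \<comment> \<open>Out of range no summand matches, and the entry of \<open>M\<close> is 0 by
    convention.\<close>
  also have "\<dots> = M j' i' p"
    using mat_hom_outside[OF assms, of j' i'] by auto
  finally show "(\<Sum>(i, j)\<in>{..<length ks} \<times> {..<length ls}. entry_mat ks ls i j (M j i) j' i' p) = M j' i' p" .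
qed

section \<open>The kernel of a *-functor consists of the negligible morphisms\<close>

locale rep_cstar_functor = category_of_partitions C + D: hom_finite_cstar_category D star +
    monoidal_functor "Rep C t" D Fo Fm \<mu> \<epsilon>
  for C :: "nat \<Rightarrow> nat \<Rightarrow> partition set" and t :: complex
    and D :: "('o, 'm, 'z) mon_cat_scheme" and star :: "'m \<Rightarrow> 'm"
    and Fo :: "rep_ob \<Rightarrow> 'o" and Fm :: "rep_mor \<Rightarrow> 'm"
    and \<mu> :: "rep_ob \<Rightarrow> rep_ob \<Rightarrow> 'm" and \<epsilon> :: 'm +
  assumes star_functor: "rep_star_functor C star Fm"
    and nonzero: "\<exists>X\<in>ob (Rep C t). \<exists>Y\<in>ob (Rep C t). \<exists>f\<in>hom (Rep C t) X Y. Fm f \<noteq> zer D (Fo X) (Fo Y)"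
begin

sublocale R: linear_category "Rep C t"
  by (rule linear_category_Rep)

lemma fun_zer: "X \<in> ob (Rep C t) \<Longrightarrow> Y \<in> ob (Rep C t) \<Longrightarrow> Fm (zer (Rep C t) X Y) = zer D (Fo X) (Fo Y)"
  using functor_zer[OF R.linear_category_axioms D.linear_category_axioms linear_functor_axioms] .

lemma sum_ob_in: "sum_ob ks \<in> ob (Rep C t)"
  by (simp add: Rep_ob_iff sum_ob_def mat_id_hom mat_comp_id_left[OF mat_id_hom])

lemma sum_ob_hom_iff: "(sum_ob ks, sum_ob ls, M) \<in> hom (Rep C t) (sum_ob ks) (sum_ob ls) \<longleftrightarrow> M \<in> mat_hom C ks ls"
  by (auto simp: Rep_hom_iff sum_ob_in) (auto simp: sum_ob_def mat_comp_id_left mat_comp_id_right)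

lemma sing_hom: "\<phi> \<in> lin_hom C k l \<Longrightarrow> sing k l \<phi> \<in> hom (Rep C t) (sum_ob [k]) (sum_ob [l])"
  by (simp add: sing_def sum_ob_hom_iff single_hom_iff)

lemma sing_comp: "cmp (Rep C t) (sing l m \<psi>) (sing k l \<phi>) = sing k m (lin_comp t k l m \<psi> \<phi>)"
  by (simp add: sing_def Rep_simps) (simp add: sum_ob_def mat_comp_single)

lemma sing_tensor: "tmor (Rep C t) (sing k l \<phi>) (sing k' l' \<psi>) = sing (k + k') (l + l') (lin_tensor k l k' l' \<phi> \<psi>)"
  by (simp add: sing_def Rep_simps)
    (simp add: sum_ob_def mat_id_single mat_tensor_single lin_tensor_id)

lemma tob_sum_ob: "tob (Rep C t) (sum_ob [k]) (sum_ob [l]) = sum_ob [k + l]"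
  by (simp add: Rep_simps) (simp add: sum_ob_def mat_id_single mat_tensor_single lin_tensor_id)

section \<open>The kernel of the functor as an ideal\<close>

definition kills :: "rep_ob \<Rightarrow> rep_ob \<Rightarrow> rep_mor \<Rightarrow> bool" where
  "kills X Y f \<longleftrightarrow> f \<in> hom (Rep C t) X Y \<and> Fm f = zer D (Fo X) (Fo Y)"

lemma kills_cmp_left:
  assumes "kills Y Z g" and f: "f \<in> hom (Rep C t) X Y"
  shows "kills X Z (cmp (Rep C t) g f)"
proof -
  have g: "g \<in> hom (Rep C t) Y Z" "Fm g = zer D (Fo Y) (Fo Z)" using assms by (simp_all add: kills_def)
  have "Fo Z \<in> ob D" using R.hom_ob[OF g(1)] fun_ob by blast
  then show ?thesis
    using D.cmp_zer_left[OF fun_hom[OF f]] fun_cmp[OF f g(1)] g(2) R.cmp_hom[OF f g(1)] by (simp add: kills_def)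
qed

lemma kills_cmp_right:
  assumes "kills X Y f" and g: "g \<in> hom (Rep C t) Y Z"
  shows "kills X Z (cmp (Rep C t) g f)"
proof -
  have f: "f \<in> hom (Rep C t) X Y" "Fm f = zer D (Fo X) (Fo Y)" using assms by (simp_all add: kills_def)
  have "Fo X \<in> ob D" using R.hom_ob[OF f(1)] fun_ob by blast
  then show ?thesis
    using D.cmp_zer_right[OF fun_hom[OF g]] fun_cmp[OF f(1) g] f(2) R.cmp_hom[OF f(1) g] by (simp add: kills_def)
qed

lemma kills_add:
  assumes "kills X Y f" "kills X Y g"
  shows "kills X Y (add (Rep C t) f g)"
proof -
  have f: "f \<in> hom (Rep C t) X Y" "Fm f = zer D (Fo X) (Fo Y)"
    and g: "g \<in> hom (Rep C t) X Y" "Fm g = zer D (Fo X) (Fo Y)" using assms by (simp_all add: kills_def)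
  show ?thesis
    using fun_add[OF f(1) g(1)] R.add_hom[OF f(1) g(1)] D.add_zer[OF fun_hom[OF f(1)]] f(2) g(2)
    by (simp add: kills_def)
qed

lemma kills_sum:
  assumes "finite A" "X \<in> ob (Rep C t)" "Y \<in> ob (Rep C t)" "\<And>a. a \<in> A \<Longrightarrow> kills X Y (X, Y, M a)"
  shows "kills X Y (X, Y, \<lambda>j i p. \<Sum>a\<in>A. M a j i p)"
  using assms(1,4)
proof (induction A)
  case empty
  then show ?case
    using fun_zer[OF assms(2,3)] R.zer_hom[OF assms(2,3)] by (simp add: kills_def Rep_simps)
next
  case (insert a A)
  have "kills X Y (add (Rep C t) (X, Y, M a) (X, Y, \<lambda>j i p. \<Sum>a\<in>A. M a j i p))"
    using insert by (intro kills_add) auto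
  then show ?case using insert(1,2) by (simp add: Rep_simps)
qed

text \<open>If the identity of the image of \<open>[0]\<close> vanished, so would that of the unit
  of \<open>D\<close>, which factors through it by \<open>\<epsilon>\<close>. Since every object of
  \<open>D\<close> is a tensor product with the unit up to isomorphism, all morphisms would then be
  zero.\<close>

lemma unit_nonzero: "ide D (Fo (sum_ob [0])) \<noteq> zer D (Fo (sum_ob [0])) (Fo (sum_ob [0]))"
proof
  let ?I = "\<I>\<^bsub>D\<^esub>" and ?J = "Fo (sum_ob [0])"
  assume zero: "ide D ?J = zer D ?J ?J"
  have "isomorphism D ?I ?J \<epsilon>" using \<epsilon>_iso by (simp add: Rep_simps)
  then obtain \<epsilon>' where \<epsilon>: "\<epsilon> \<in> hom D ?I ?J" "\<epsilon>' \<in> hom D ?J ?I" "cmp D \<epsilon>' \<epsilon> = ide D ?I"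
    by (auto simp: isomorphism_def inverse_morphisms_def)
  have ob: "?I \<in> ob D" "?J \<in> ob D" using D.hom_ob[OF \<epsilon>(1)] by auto
  have "\<epsilon> = zer D ?I ?J"
    using D.ide_left[OF \<epsilon>(1)] D.cmp_zer_left[OF \<epsilon>(1) ob(2)] zero by simp
  then have I: "ide D ?I = zer D ?I ?I"
    using \<epsilon>(3) D.cmp_zer_right[OF \<epsilon>(2) ob(1)] by simp
  have zero: "f = zer D X Y" if f: "f \<in> hom D X Y" for f X Y
  proof -
    have XY: "X \<in> ob D" "Y \<in> ob D" using D.hom_ob[OF f] by auto
    obtain r where r: "lunit D X \<in> hom D (tob D ?I X) X" "r \<in> hom D X (tob D ?I X)"
      "cmp D (lunit D X) r = ide D X"
      using D.lunit_iso[OF XY(1)] by (auto simp: isomorphism_def inverse_morphisms_def)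
    have lY: "lunit D Y \<in> hom D (tob D ?I Y) Y"
      using D.lunit_iso[OF XY(2)] by (auto simp: isomorphism_def inverse_morphisms_def)
    \<comment> \<open>Naturality of the unitor exhibits \<open>f\<close>, up to isomorphism, as a
      tensor product with the vanishing identity of the unit.\<close>
    have "cmp D f (lunit D X) = cmp D (lunit D Y) (tmor D (ide D ?I) f)"
      using D.lunit_natural[OF f] by simp
    also have "\<dots> = zer D (tob D ?I X) Y"
      unfolding I D.tmor_zer_left[OF f ob(1,1)]
      by (rule D.cmp_zer_right[OF lY]) (rule D.tob_ob[OF ob(1) XY(1)])
    finally have "cmp D (cmp D f (lunit D X)) r = zer D X Y"
      using D.cmp_zer_left[OF r(2) XY(2)] by simp
    then show ?thesis using D.cmp_assoc[OF r(2,1) f] r(3) D.ide_right[OF f] by simp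
  qed
  obtain X Y f where "f \<in> hom (Rep C t) X Y" "Fm f \<noteq> zer D (Fo X) (Fo Y)" using nonzero by blast
  then show False using zero[OF fun_hom] by blast
qed

section \<open>The kernel on morphisms between the objects \<open>[k]\<close>\<close>

definition vanishes :: "nat \<Rightarrow> nat \<Rightarrow> lincomb \<Rightarrow> bool" where
  "vanishes k l \<phi> \<longleftrightarrow> kills (sum_ob [k]) (sum_ob [l]) (sing k l \<phi>)"

lemma vanishes_lin_hom: "vanishes k l \<phi> \<Longrightarrow> \<phi> \<in> lin_hom C k l"
  by (simp add: vanishes_def kills_def sing_def sum_ob_hom_iff single_hom_iff)

lemma vanishes_comp:
  assumes "\<phi> \<in> lin_hom C k l" "\<psi> \<in> lin_hom C l m" "vanishes k l \<phi> \<or> vanishes l m \<psi>"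
  shows "vanishes k m (lin_comp t k l m \<psi> \<phi>)"
  using assms(3) kills_cmp_left[OF _ sing_hom[OF assms(1)], of "sum_ob [m]" "sing l m \<psi>"]
    kills_cmp_right[OF _ sing_hom[OF assms(2)], of "sum_ob [k]" "sing k l \<phi>"]
  unfolding vanishes_def sing_comp by blast

lemma vanishes_star:
  assumes "vanishes k l \<phi>"
  shows "vanishes l k (lin_star \<phi>)"
proof -
  note \<phi> = vanishes_lin_hom[OF assms]
  have "Fm (sing l k (lin_star \<phi>)) = star (Fm (sing k l \<phi>))"
    using star_functor \<phi> by (simp add: rep_star_functor_def sing_def mat_star_single[symmetric] single_hom_iff)
  also have "\<dots> = zer D (Fo (sum_ob [l])) (Fo (sum_ob [k]))"
  proof -
    have ob: "Fo (sum_ob [k]) \<in> ob D" "Fo (sum_ob [l]) \<in> ob D" using fun_ob sum_ob_in by auto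
    have z: "zer D (Fo (sum_ob [k])) (Fo (sum_ob [l])) \<in> hom D (Fo (sum_ob [k])) (Fo (sum_ob [l]))"
      using D.zer_hom[OF ob] .
    have "star (zer D (Fo (sum_ob [k])) (Fo (sum_ob [l]))) = zer D (Fo (sum_ob [l])) (Fo (sum_ob [k]))"
      using D.idempotent_zer[OF D.star_hom[OF z]] D.star_add[OF z z] D.add_zer[OF z] by simp
    then show ?thesis using assms by (simp add: vanishes_def kills_def)
  qed
  finally show ?thesis using lin_star_hom[OF \<phi>] by (simp add: vanishes_def kills_def sing_hom)
qed

text \<open>The image of a tensor product agrees with the tensor product of the images only up to
  \<open>\<mu>\<close>; naturality and invertibility of \<open>\<mu>\<close> transfer the
  zero.\<close>

lemma vanishes_tensor:
  assumes "vanishes k l \<phi>"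
  shows "vanishes (k + 1) (l + 1) (lin_tensor k l 1 1 \<phi> (lin_id 1))"
proof -
  note \<phi> = vanishes_lin_hom[OF assms]
  let ?f = "sing k l \<phi>" and ?g = "sing 1 1 (lin_id 1)"
  let ?X = "sum_ob [k]" and ?Y = "sum_ob [l]" and ?Z = "sum_ob [1]"
  have f: "?f \<in> hom (Rep C t) ?X ?Y" and g: "?g \<in> hom (Rep C t) ?Z ?Z"
    using \<phi> lin_id_hom sing_hom by auto
  have fg: "tmor (Rep C t) ?f ?g = sing (k + 1) (l + 1) (lin_tensor k l 1 1 \<phi> (lin_id 1))"
    by (rule sing_tensor)
  have h: "sing (k + 1) (l + 1) (lin_tensor k l 1 1 \<phi> (lin_id 1)) \<in> hom (Rep C t) (sum_ob [k + 1]) (sum_ob [l + 1])"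
    using lin_tensor_hom[OF \<phi> lin_id_hom] by (rule sing_hom)
  have ob: "Fo ?X \<in> ob D" "Fo ?Y \<in> ob D" "Fo ?Z \<in> ob D" "Fo (sum_ob [k + 1]) \<in> ob D" "Fo (sum_ob [l + 1]) \<in> ob D"
    using fun_ob sum_ob_in by auto
  obtain \<nu> where \<nu>: "\<mu> ?X ?Z \<in> hom D (tob D (Fo ?X) (Fo ?Z)) (Fo (sum_ob [k + 1]))"
    "\<nu> \<in> hom D (Fo (sum_ob [k + 1])) (tob D (Fo ?X) (Fo ?Z))" "cmp D (\<mu> ?X ?Z) \<nu> = ide D (Fo (sum_ob [k + 1]))"
    using \<mu>_iso[OF sum_ob_in sum_ob_in, of "[k]" "[1]"]
    by (auto simp: isomorphism_def inverse_morphisms_def tob_sum_ob[simplified])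
  have \<mu>Y: "\<mu> ?Y ?Z \<in> hom D (tob D (Fo ?Y) (Fo ?Z)) (Fo (sum_ob [l + 1]))"
    using \<mu>_iso[OF sum_ob_in sum_ob_in, of "[l]" "[1]"]
    by (auto simp: isomorphism_def inverse_morphisms_def tob_sum_ob[simplified])
  let ?h = "sing (k + 1) (l + 1) (lin_tensor k l 1 1 \<phi> (lin_id 1))"
  have "cmp D (Fm ?h) (\<mu> ?X ?Z) = cmp D (\<mu> ?Y ?Z) (tmor D (Fm ?f) (Fm ?g))"
    using \<mu>_natural[OF f g] fg by simp
  also have "Fm ?f = zer D (Fo ?X) (Fo ?Y)" using assms by (simp add: vanishes_def kills_def)
  also have "tmor D \<dots> (Fm ?g) = zer D (tob D (Fo ?X) (Fo ?Z)) (tob D (Fo ?Y) (Fo ?Z))"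
    by (rule D.tmor_zer_left[OF fun_hom[OF g] ob(1,2)])
  also have "cmp D (\<mu> ?Y ?Z) \<dots> = zer D (tob D (Fo ?X) (Fo ?Z)) (Fo (sum_ob [l + 1]))"
    by (rule D.cmp_zer_right[OF \<mu>Y]) (rule D.tob_ob[OF ob(1,3)])
  finally have "cmp D (cmp D (Fm ?h) (\<mu> ?X ?Z)) \<nu> = zer D (Fo (sum_ob [k + 1])) (Fo (sum_ob [l + 1]))"
    using D.cmp_zer_left[OF \<nu>(2) ob(5)] by simp
  then have "Fm ?h = zer D (Fo (sum_ob [k + 1])) (Fo (sum_ob [l + 1]))"
    using D.cmp_assoc[OF \<nu>(2,1) fun_hom[OF h]] \<nu>(3) D.ide_right[OF fun_hom[OF h]] by simp
  then show ?thesis using h by (simp add: vanishes_def kills_def)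
qed

lemma vanishes_rot:
  assumes "vanishes (k + 1) l \<phi>"
  shows "vanishes k (l + 1) (lin_rot k l \<phi>)"
proof -
  note \<phi> = vanishes_lin_hom[OF assms]
  let ?\<psi> = "lin_tensor (k + 1) l 1 1 \<phi> (lin_id 1)"
  have v: "vanishes (k + 2) (l + 1) ?\<psi>" using vanishes_tensor[OF assms] by simp
  have cup: "(\<lambda>p. of_bool (p = cup k)) \<in> lin_hom C k (k + 2)" using cup_in by (auto simp: lin_hom_def)
  have "lin_comp t k (k + 2) (l + 1) ?\<psi> (\<lambda>p. of_bool (p = cup k)) = lin_rot k l \<phi>"
  proof (rule lin_rot_eq_lin_comp[OF lin_hom_subset[OF \<phi>] partitions_if[OF cup_in]])
    fix p assume "\<phi> p \<noteq> 0"
    then have "p \<in> C (k + 1) l" using \<phi> by (auto simp: lin_hom_def)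
    from tensor_closed[OF this id_part_in[of 1]]
    show "part_tensor (k + 1) l p (id_part 1) \<in> partitions (k + 2) (l + 1)" by (simp add: partitions_if)
  qed
  then show ?thesis using vanishes_comp[OF cup vanishes_lin_hom[OF v]] v by simp
qed

text \<open>For the converse, the star exchanges the two directions: bending the star of the bent
  morphism gives the star of \<open>\<phi>\<close>.\<close>

lemma vanishes_rot_iff:
  assumes "\<phi> \<in> lin_hom C (k + 1) l"
  shows "vanishes k (l + 1) (lin_rot k l \<phi>) \<longleftrightarrow> vanishes (k + 1) l \<phi>"
proof
  assume "vanishes k (l + 1) (lin_rot k l \<phi>)"
  then have "vanishes l (k + 1) (lin_rot l k (lin_star (lin_rot k l \<phi>)))"
    by (rule vanishes_rot[OF vanishes_star])
  then have "vanishes l (k + 1) (lin_star \<phi>)" by (simp only: lin_star_lin_rot lin_rot_lin_rot)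
  from vanishes_star[OF this] show "vanishes (k + 1) l \<phi>" by simp
qed (rule vanishes_rot)

text \<open>The empty partition is the only basis element, and its closure has no components. Its
  trace is \<open>t ^ 0\<close>, which is 1 for every \<open>t\<close>, so the trace reads off the
  coefficient.\<close>

lemma lin_hom_00:
  assumes "\<phi> \<in> lin_hom C 0 0"
  shows "\<phi> = (\<lambda>p. lin_trace t 0 \<phi> * lin_id 0 p)"
proof -
  have "partitions 0 0 = {{}}"
    by (auto simp: partitions_def partition_on_def points_def)
  moreover have "closure_components 0 {} = 0" by (simp add: closure_components_def components_def)
  ultimately have tr: "lin_trace t 0 \<phi> = \<phi> {}" by (simp add: lin_trace_def)
  show ?thesis
  proof
    fix p show "\<phi> p = lin_trace t 0 \<phi> * lin_id 0 p"
      using lin_hom_subset[OF assms] \<open>partitions 0 0 = {{}}\<close> unfolding tr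
      by (auto simp: lin_hom_partitions lin_id_def id_part_def)
  qed
qed

text \<open>The image is the trace times the identity of the image of \<open>[0]\<close>. That
  identity is non-zero, so a non-zero scalar could be divided out.\<close>

lemma vanishes_00_iff:
  assumes "\<phi> \<in> lin_hom C 0 0"
  shows "vanishes 0 0 \<phi> \<longleftrightarrow> lin_trace t 0 \<phi> = 0"
proof -
  let ?I = "sum_ob [0]"
  have ide: "sing 0 0 (lin_id 0) = ide (Rep C t) ?I"
    by (simp add: sing_def Rep_simps) (simp add: sum_ob_def mat_id_single)
  have I: "?I \<in> ob (Rep C t)" by (rule sum_ob_in)
  have "sing 0 0 \<phi> = scl (Rep C t) (lin_trace t 0 \<phi>) (ide (Rep C t) ?I)"
    unfolding ide[symmetric] by (subst lin_hom_00[OF assms]) (simp add: sing_def Rep_simps single_def fun_eq_iff)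
  then have F: "Fm (sing 0 0 \<phi>) = scl D (lin_trace t 0 \<phi>) (ide D (Fo ?I))"
    using fun_scl[OF R.ide_hom[OF I]] fun_ide[OF I] by simp
  note i = D.ide_hom[OF fun_ob[OF I]]
  have "lin_trace t 0 \<phi> = 0" if z: "scl D (lin_trace t 0 \<phi>) (ide D (Fo ?I)) = zer D (Fo ?I) (Fo ?I)"
  proof (rule ccontr)
    assume nz: "lin_trace t 0 \<phi> \<noteq> 0"
    have "ide D (Fo ?I) = scl D (inverse (lin_trace t 0 \<phi>)) (scl D (lin_trace t 0 \<phi>) (ide D (Fo ?I)))"
      using nz D.scl_scl[OF i] D.scl_one[OF i] by simp
    also have "\<dots> = scl D (inverse (lin_trace t 0 \<phi>)) (scl D 0 (ide D (Fo ?I)))"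
      unfolding z D.scl_zero[OF i] ..
    also have "\<dots> = zer D (Fo ?I) (Fo ?I)"
      unfolding D.scl_scl[OF i] by (simp add: D.scl_zero[OF i])
    finally show False using unit_nonzero by simp
  qed
  then show ?thesis
    unfolding vanishes_def kills_def F using sing_hom[OF assms] D.scl_zero[OF i] by auto
qed

text \<open>Each induction step trades one upper point for a lower one, so \<open>l\<close> and
  \<open>\<phi>\<close> must vary. Only the base case uses positivity and the non-vanishing of the
  unit.\<close>

lemma vanishes_iff_pairing:
  "\<phi> \<in> lin_hom C k l \<Longrightarrow> vanishes k l \<phi> \<longleftrightarrow> (\<forall>\<psi>\<in>lin_hom C k l. pairing t k l \<phi> \<psi> = 0)"
proof (induction k arbitrary: l \<phi>)
  case 0
  have pairing: "pairing t 0 l \<phi> (\<psi> \<circ> part_star) = lin_trace t 0 (lin_comp t 0 l 0 \<psi> \<phi>)" for \<psi>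
    using lin_trace_comp[of t l 0 \<phi> \<psi>] lin_trace_cyclic[of t l 0 \<phi> \<psi>] by simp
  show ?case
  proof
    assume v: "vanishes 0 l \<phi>"
    show "\<forall>\<psi>\<in>lin_hom C 0 l. pairing t 0 l \<phi> \<psi> = 0"
    proof
      fix \<psi> assume \<psi>: "\<psi> \<in> lin_hom C 0 l"
      then have "\<psi> \<circ> part_star \<in> lin_hom C l 0"
        using star_closed[of "part_star p" 0 l for p] by (auto simp: lin_hom_def)
      then have "lin_trace t 0 (lin_comp t 0 l 0 (\<psi> \<circ> part_star) \<phi>) = 0"
        using vanishes_comp[OF 0] v vanishes_00_iff lin_comp_hom[OF 0] by blast
      then show "pairing t 0 l \<phi> \<psi> = 0" using pairing[of "\<psi> \<circ> part_star"] by (simp add: comp_def)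
    qed
  next
    assume *: "\<forall>\<psi>\<in>lin_hom C 0 l. pairing t 0 l \<phi> \<psi> = 0"
    have s: "lin_star \<phi> \<in> lin_hom C l 0" using 0 by (rule lin_star_hom)
    \<comment> \<open>The test vector is the coefficientwise conjugate of \<open>\<phi>\<close>: the
      two flips cancel and only the conjugation remains.\<close>
    have "lin_star \<phi> \<circ> part_star \<in> lin_hom C 0 l" using 0 by (auto simp: lin_hom_def lin_star_def)
    then have "lin_trace t 0 (lin_comp t 0 l 0 (lin_star \<phi>) \<phi>) = 0" using * pairing by metis
    then have "vanishes 0 0 (lin_comp t 0 l 0 (lin_star \<phi>) \<phi>)"
      using vanishes_00_iff lin_comp_hom[OF 0 s] by blast
    then have "cmp D (Fm (sing l 0 (lin_star \<phi>))) (Fm (sing 0 l \<phi>)) = zer D (Fo (sum_ob [0])) (Fo (sum_ob [0]))"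
      using fun_cmp[OF sing_hom[OF 0] sing_hom[OF s]] by (simp add: vanishes_def kills_def sing_comp)
    moreover have "Fm (sing l 0 (lin_star \<phi>)) = star (Fm (sing 0 l \<phi>))"
      using star_functor 0 by (simp add: rep_star_functor_def sing_def mat_star_single[symmetric] single_hom_iff)
    ultimately have "Fm (sing 0 l \<phi>) = zer D (Fo (sum_ob [0])) (Fo (sum_ob [l]))"
      using D.positive[OF fun_hom[OF sing_hom[OF 0]]] by simp
    then show "vanishes 0 l \<phi>" using 0 by (simp add: vanishes_def kills_def sing_hom)
  qed
next
  case (Suc k)
  then have \<phi>: "\<phi> \<in> lin_hom C (k + 1) l" by simp
  have "vanishes (k + 1) l \<phi> \<longleftrightarrow> (\<forall>\<psi>\<in>lin_hom C k (l + 1). pairing t k (l + 1) (lin_rot k l \<phi>) \<psi> = 0)"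
    unfolding vanishes_rot_iff[OF \<phi>, symmetric] by (rule Suc.IH) (rule lin_rot_hom[OF \<phi>])
  also have "\<dots> \<longleftrightarrow> (\<forall>\<psi>\<in>lin_hom C (k + 1) l. pairing t (k + 1) l \<phi> \<psi> = 0)"
  proof
    assume *: "\<forall>\<psi>\<in>lin_hom C k (l + 1). pairing t k (l + 1) (lin_rot k l \<phi>) \<psi> = 0"
    show "\<forall>\<psi>\<in>lin_hom C (k + 1) l. pairing t (k + 1) l \<phi> \<psi> = 0"
      using *[rule_format, OF lin_rot_hom] by (simp only: pairing_lin_rot) simp
  next
    assume *: "\<forall>\<psi>\<in>lin_hom C (k + 1) l. pairing t (k + 1) l \<phi> \<psi> = 0"
    show "\<forall>\<psi>\<in>lin_hom C k (l + 1). pairing t k (l + 1) (lin_rot k l \<phi>) \<psi> = 0"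
    proof
      fix \<psi> assume "\<psi> \<in> lin_hom C k (l + 1)"
      from *[rule_format, OF lin_rot_hom'[OF this]]
      show "pairing t k (l + 1) (lin_rot k l \<phi>) \<psi> = 0"
        using pairing_lin_rot[of t k l \<phi> "lin_rot k l \<psi>"] by simp
    qed
  qed
  finally show ?case by simp
qed

text \<open>Precomposition with \<open>part_star\<close> is a bijection between the test morphisms
  of the trace and those of \<open>pairing\<close>.\<close>

lemma vanishes_iff_trace:
  assumes "\<phi> \<in> lin_hom C k l"
  shows "vanishes k l \<phi> \<longleftrightarrow> (\<forall>\<psi>\<in>lin_hom C l k. lin_trace t l (lin_comp t l k l \<phi> \<psi>) = 0)"
proof -
  have "\<psi> \<circ> part_star \<in> lin_hom C m n" if "\<psi> \<in> lin_hom C n m" for \<psi> m n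
    using that star_closed[of "part_star p" n m for p] by (auto simp: lin_hom_def)
  moreover have "(\<psi> \<circ> part_star) \<circ> part_star = \<psi>" for \<psi> :: lincomb by (simp add: comp_def)
  ultimately show ?thesis unfolding vanishes_iff_pairing[OF assms] lin_trace_comp by metis
qed

text \<open>Passing between \<open>(ks, e)\<close> and the full direct sum is possible inside the
  ideal, because \<open>M\<close> absorbs both idempotents; inclusions and projections of summands
  then reach the entries.\<close>

lemma kills_iff_entries:
  assumes f: "(X, Y, M) \<in> hom (Rep C t) X Y"
  shows "kills X Y (X, Y, M) \<longleftrightarrow>
    (\<forall>i<length (fst X). \<forall>j<length (fst Y). vanishes (fst X ! i) (fst Y ! j) (M j i))"
proof -
  define ks ls e d where "ks = fst X" "ls = fst Y" "e = snd X" "d = snd Y"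
  then have X: "X = (ks, e)" and Y: "Y = (ls, d)" by simp_all
  have M: "M \<in> mat_hom C ks ls" and Me: "mat_comp t ks ks ls M e = M" and dM: "mat_comp t ks ls ls d M = M"
    and ob: "X \<in> ob (Rep C t)" "Y \<in> ob (Rep C t)"
    using f by (auto simp: Rep_hom_iff ks_ls_e_d_def)
  have e: "e \<in> mat_hom C ks ks" "mat_comp t ks ks ks e e = e" and d: "d \<in> mat_hom C ls ls" "mat_comp t ls ls ls d d = d"
    using ob by (auto simp: Rep_ob_iff X Y)
  let ?A = "sum_ob ks" and ?B = "sum_ob ls"
  have AB: "fst ?A = ks" "fst ?B = ls" "snd ?A = mat_id ks" "snd ?B = mat_id ls" by (simp_all add: sum_ob_def)
  \<comment> \<open>The idempotent itself is both the inclusion of its image object into the direct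
    sum and the projection onto it.\<close>
  have "(?A, X, e) \<in> hom (Rep C t) ?A X" "(X, ?A, e) \<in> hom (Rep C t) X ?A"
    "(?B, Y, d) \<in> hom (Rep C t) ?B Y" "(Y, ?B, d) \<in> hom (Rep C t) Y ?B"
    using ob e d by (auto simp: Rep_hom_iff sum_ob_in AB X Y mat_comp_id_left mat_comp_id_right)
  note homs = this
  have 1: "(?A, ?B, M) = cmp (Rep C t) (Y, ?B, d) (cmp (Rep C t) (X, Y, M) (?A, X, e))"
    "(X, Y, M) = cmp (Rep C t) (?B, Y, d) (cmp (Rep C t) (?A, ?B, M) (X, ?A, e))"
    using Me dM by (simp_all add: Rep_simps AB X Y)
  have "kills X Y (X, Y, M) \<longleftrightarrow> kills ?A ?B (?A, ?B, M)"
  proof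
    assume "kills X Y (X, Y, M)"
    from kills_cmp_right[OF kills_cmp_left[OF this homs(1)] homs(4)]
    show "kills ?A ?B (?A, ?B, M)" unfolding 1(1)[symmetric] .
  next
    assume "kills ?A ?B (?A, ?B, M)"
    from kills_cmp_right[OF kills_cmp_left[OF this homs(2)] homs(3)]
    show "kills X Y (X, Y, M)" unfolding 1(2)[symmetric] .
  qed
  also have "\<dots> \<longleftrightarrow> (\<forall>i<length ks. \<forall>j<length ls. vanishes (ks ! i) (ls ! j) (M j i))"
  proof
    assume k: "kills ?A ?B (?A, ?B, M)"
    show "\<forall>i<length ks. \<forall>j<length ls. vanishes (ks ! i) (ls ! j) (M j i)"
    proof (intro allI impI)
      fix i j assume ij: "i < length ks" "j < length ls"
      let ?a = "(sum_ob [ks ! i], ?A, entry_mat [ks ! i] ks 0 i (lin_id (ks ! i)))"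
        and ?b = "(?B, sum_ob [ls ! j], entry_mat ls [ls ! j] j 0 (lin_id (ls ! j)))"
      have "?a \<in> hom (Rep C t) (sum_ob [ks ! i]) ?A" "?b \<in> hom (Rep C t) ?B (sum_ob [ls ! j])"
        unfolding sum_ob_hom_iff by (simp_all add: entry_mat_hom lin_id_hom)
      then have "kills (sum_ob [ks ! i]) (sum_ob [ls ! j]) (cmp (Rep C t) ?b (cmp (Rep C t) (?A, ?B, M) ?a))"
        using kills_cmp_right[OF kills_cmp_left[OF k]] by blast
      moreover have "M \<in> mat_hom partitions ks ls" using M by (simp add: mat_hom_def lin_hom_subset)
      then have "cmp (Rep C t) ?b (cmp (Rep C t) (?A, ?B, M) ?a) = sing (ks ! i) (ls ! j) (M j i)"
        using single_entry_factor[of M ks ls i j t] ij by (simp add: Rep_simps sum_ob_def sing_def)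
      ultimately show "vanishes (ks ! i) (ls ! j) (M j i)" by (simp add: vanishes_def)
    qed
  next
    assume v: "\<forall>i<length ks. \<forall>j<length ls. vanishes (ks ! i) (ls ! j) (M j i)"
    have "kills ?A ?B (?A, ?B, entry_mat ks ls i j (M j i))" if ij: "i < length ks" "j < length ls" for i j
    proof -
      let ?a = "(?A, sum_ob [ks ! i], entry_mat ks [ks ! i] i 0 (lin_id (ks ! i)))"
        and ?b = "(sum_ob [ls ! j], ?B, entry_mat [ls ! j] ls 0 j (lin_id (ls ! j)))"
      have "?a \<in> hom (Rep C t) ?A (sum_ob [ks ! i])" "?b \<in> hom (Rep C t) (sum_ob [ls ! j]) ?B"
        unfolding sum_ob_hom_iff by (simp_all add: entry_mat_hom lin_id_hom)
      then have "kills ?A ?B (cmp (Rep C t) ?b (cmp (Rep C t) (sing (ks ! i) (ls ! j) (M j i)) ?a))"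
        using v ij kills_cmp_right[OF kills_cmp_left] unfolding vanishes_def by blast
      moreover have "cmp (Rep C t) ?b (cmp (Rep C t) (sing (ks ! i) (ls ! j) (M j i)) ?a)
          = (?A, ?B, entry_mat ks ls i j (M j i))"
        using entry_mat_factor[OF lin_hom_subset[OF mat_homD[OF M ij]]] by (simp add: Rep_simps sum_ob_def sing_def)
      ultimately show ?thesis by simp
    qed
    then have "kills ?A ?B (?A, ?B, \<lambda>j' i' p. \<Sum>x\<in>{..<length ks} \<times> {..<length ls}.
        (case x of (i, j) \<Rightarrow> entry_mat ks ls i j (M j i)) j' i' p)"
      by (intro kills_sum) (auto simp: sum_ob_in)
    then show "kills ?A ?B (?A, ?B, M)"
      using sum_entry_mat[OF M] by (simp add: case_prod_beta')
  qed
  finally show ?thesis by (simp add: X Y)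
qed

text \<open>The trace of a product of matrices is a sum of traces of entries, so vanishing entrywise
  suffices. Conversely, each entry is isolated by a matrix unit, adapted to the idempotents.\<close>

lemma negligible_iff_entries:
  assumes f: "(X, Y, M) \<in> hom (Rep C t) X Y"
  shows "(X, Y, M) \<in> negligible C t X Y \<longleftrightarrow>
    (\<forall>i<length (fst X). \<forall>j<length (fst Y). \<forall>\<psi>\<in>lin_hom C (fst Y ! j) (fst X ! i).
      lin_trace t (fst Y ! j) (lin_comp t (fst Y ! j) (fst X ! i) (fst Y ! j) (M j i) \<psi>) = 0)"
proof -
  define ks ls e d where "ks = fst X" "ls = fst Y" "e = snd X" "d = snd Y"
  then have X: "X = (ks, e)" and Y: "Y = (ls, d)" by simp_all
  have M: "M \<in> mat_hom C ks ls" and Me: "mat_comp t ks ks ls M e = M" and dM: "mat_comp t ks ls ls d M = M"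
    and ob: "X \<in> ob (Rep C t)" "Y \<in> ob (Rep C t)"
    using f by (auto simp: Rep_hom_iff ks_ls_e_d_def)
  have e: "e \<in> mat_hom C ks ks" "mat_comp t ks ks ks e e = e" and d: "d \<in> mat_hom C ls ls" "mat_comp t ls ls ls d d = d"
    using ob by (auto simp: Rep_ob_iff X Y)
  have neg: "(X, Y, M) \<in> negligible C t X Y \<longleftrightarrow>
      (\<forall>G. (Y, X, G) \<in> hom (Rep C t) Y X \<longrightarrow> mat_trace t ls (mat_comp t ls ks ls M G) = 0)"
  proof -
    have homE: "\<exists>G. g = (Y, X, G)" if "g \<in> hom (Rep C t) Y X" for g
      using that by (auto simp: Rep_hom_iff)
    have tr: "rep_trace t (cmp (Rep C t) (X, Y, M) (Y, X, G)) = mat_trace t ls (mat_comp t ls ks ls M G)" for G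
      by (simp add: Rep_simps rep_trace_def X Y)
    have "(X, Y, M) \<in> negligible C t X Y \<longleftrightarrow>
        (\<forall>g\<in>hom (Rep C t) Y X. rep_trace t (cmp (Rep C t) (X, Y, M) g) = 0)"
      using f by (simp add: negligible_def)
    also have "\<dots> \<longleftrightarrow> (\<forall>G. (Y, X, G) \<in> hom (Rep C t) Y X \<longrightarrow> rep_trace t (cmp (Rep C t) (X, Y, M) (Y, X, G)) = 0)"
      using homE by metis
    finally show ?thesis unfolding tr .
  qed
  have "(X, Y, M) \<in> negligible C t X Y \<longleftrightarrow>
    (\<forall>i<length ks. \<forall>j<length ls. \<forall>\<psi>\<in>lin_hom C (ls ! j) (ks ! i).
      lin_trace t (ls ! j) (lin_comp t (ls ! j) (ks ! i) (ls ! j) (M j i) \<psi>) = 0)"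
    unfolding neg
  proof (intro iffI allI impI ballI)
    fix i j \<psi> assume ij: "i < length ks" "j < length ls" and \<psi>: "\<psi> \<in> lin_hom C (ls ! j) (ks ! i)"
      and *: "\<forall>G. (Y, X, G) \<in> hom (Rep C t) Y X \<longrightarrow> mat_trace t ls (mat_comp t ls ks ls M G) = 0"
    let ?N = "entry_mat ls ks j i \<psi>"
    have N: "?N \<in> mat_hom C ls ks" using \<psi> by (rule entry_mat_hom)
    \<comment> \<open>The matrix unit alone need not be a morphism from \<open>Y\<close> to
      \<open>X\<close>, so it is compressed by \<open>e\<close> and \<open>d\<close>. The trace does
      not notice: \<open>M\<close> absorbs \<open>e\<close> directly, and \<open>d\<close> after a
      cyclic permutation.\<close>
    let ?G = "mat_comp t ls ks ks e (mat_comp t ls ls ks ?N d)"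
    have "?G \<in> mat_hom C ls ks" using N e d by (intro mat_comp_hom)
    moreover have "mat_comp t ls ls ks ?G d = ?G" using d(2) by (simp add: mat_comp_assoc[symmetric])
    moreover have "mat_comp t ls ks ks e ?G = ?G" using e(2) by (simp add: mat_comp_assoc)
    ultimately have "(Y, X, ?G) \<in> hom (Rep C t) Y X" using ob by (simp add: Rep_hom_iff X Y)
    then have "0 = mat_trace t ls (mat_comp t ls ks ls M ?G)" using * by simp
    also have "mat_comp t ls ks ls M ?G = mat_comp t ls ls ls (mat_comp t ls ks ls M ?N) d"
      using Me by (simp add: mat_comp_assoc)
    also have "mat_trace t ls \<dots> = mat_trace t ls (mat_comp t ls ls ls d (mat_comp t ls ks ls M ?N))"
      by (rule mat_trace_cyclic)
    also have "mat_comp t ls ls ls d (mat_comp t ls ks ls M ?N) = mat_comp t ls ks ls M ?N"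
      using dM by (simp add: mat_comp_assoc)
    also have "mat_trace t ls \<dots> = (\<Sum>j'<length ls. \<Sum>i'<length ks. if i' = i then
        (if j' = j then lin_trace t (ls ! j) (lin_comp t (ls ! j) (ks ! i) (ls ! j) (M j i) \<psi>) else 0) else 0)"
      unfolding mat_trace_comp by (intro sum.cong refl) (auto simp: entry_mat_def)
    also have "\<dots> = lin_trace t (ls ! j) (lin_comp t (ls ! j) (ks ! i) (ls ! j) (M j i) \<psi>)"
      using ij by simp
    finally show "lin_trace t (ls ! j) (lin_comp t (ls ! j) (ks ! i) (ls ! j) (M j i) \<psi>) = 0" by simp
  next
    fix G assume *: "\<forall>i<length ks. \<forall>j<length ls. \<forall>\<psi>\<in>lin_hom C (ls ! j) (ks ! i).
        lin_trace t (ls ! j) (lin_comp t (ls ! j) (ks ! i) (ls ! j) (M j i) \<psi>) = 0"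
      and "(Y, X, G) \<in> hom (Rep C t) Y X"
    then have "G \<in> mat_hom C ls ks" by (simp add: Rep_hom_iff X Y)
    then show "mat_trace t ls (mat_comp t ls ks ls M G) = 0"
      unfolding mat_trace_comp using * mat_homD by (intro sum.neutral ballI) auto
  qed
  then show ?thesis by (simp add: X Y)
qed

lemma negligible_eq_kernel: "negligible C t X Y = {f \<in> hom (Rep C t) X Y. Fm f = zer D (Fo X) (Fo Y)}"
proof (intro set_eqI)
  fix f
  show "f \<in> negligible C t X Y \<longleftrightarrow> f \<in> {f \<in> hom (Rep C t) X Y. Fm f = zer D (Fo X) (Fo Y)}"
  proof (cases "f \<in> hom (Rep C t) X Y")
    case True
    then obtain M where f: "f = (X, Y, M)" and M: "M \<in> mat_hom C (fst X) (fst Y)" by (auto simp: Rep_hom_iff)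
    have "f \<in> negligible C t X Y \<longleftrightarrow> kills X Y f"
      using True unfolding f kills_iff_entries[OF True[unfolded f]] negligible_iff_entries[OF True[unfolded f]]
      using vanishes_iff_trace[OF mat_homD[OF M]] by blast
    then show ?thesis using True by (simp add: kills_def)
  qed (simp add: negligible_def)
qed

end

theorem proposition3p16:
  fixes C :: "nat \<Rightarrow> nat \<Rightarrow> partition set"
    and t :: complex
    and D :: "('o, 'm, 'z) mon_cat_scheme"
    and star :: "'m \<Rightarrow> 'm"
    and Fo :: "rep_ob \<Rightarrow> 'o" and Fm :: "rep_mor \<Rightarrow> 'm"
    and \<mu> :: "rep_ob \<Rightarrow> rep_ob \<Rightarrow> 'm" and \<epsilon> :: 'm
  assumes "category_of_partitions C"
    and "hom_finite_cstar_category D star"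
    and "monoidal_functor (Rep C t) D Fo Fm \<mu> \<epsilon>"
    and "rep_star_functor C star Fm"
    and nonzero: "\<exists>X\<in>ob (Rep C t). \<exists>Y\<in>ob (Rep C t). \<exists>f\<in>hom (Rep C t) X Y.
           Fm f \<noteq> zer D (Fo X) (Fo Y)"
  shows "\<exists>K. (\<forall>X\<in>ob (Rep C t). \<forall>Y\<in>ob (Rep C t). \<forall>f\<in>hom (Rep C t) X Y.
              K (X, Y, coset (Rep C t) (negligible C t) X Y f) = (X, Y, Fm f))
           \<and> linear_equivalence (semisimplification C t) (image_cat (Rep C t) D Fo Fm) (\<lambda>X. X) K"
proof -
  interpret rep_cstar_functor C t D star Fo Fm \<mu> \<epsilon>
    using assms by (intro rep_cstar_functor.intro rep_cstar_functor_axioms.intro)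
  show ?thesis
    unfolding semisimplification_def
    by (rule kernel_quotient_equivalence[OF R.linear_category_axioms D.linear_category_axioms
          linear_functor_axioms negligible_eq_kernel])
qed

end
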